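(* Let $\alpha>0$, let $A,B,B_1$ be real random variables and let $\Psi:\mathbb{R}\to\mathbb{R}$ be a random Lipschitz mapping (all defined on a common probability space), with $\mathbb{E}\log^+L(\Psi)<\infty$, $\mathbb{E}\log^+|\Psi(0)|<\infty$ and $\lim_{n\to\infty}\frac1n\log L(\Psi_{n,1})<0$ a.s. Suppose that (1) $A\ge 0$ a.s. and the conditional law of $\log A$ given $A>0$ is non-arithmetic; (2) $\mathbb{E}A^{\alpha}=1$ and $\rho:=\mathbb{E}[A^{\alpha}\log A]<\infty$; (3) the functions $L_r(x):=x^{\alpha}\mathbb{P}(B>x)$ and $L_{1,r}(x):=x^{\alpha}\mathbb{P}(B_1>x)$ are slowly varying, $\mathbb{E}B_+^{\alpha}=\mathbb{E}(B_1)_+^{\alpha}=\infty$, and $\mathbb{E}B_-^{\alpha-\varepsilon}<\infty$, $\mathbb{E}(B_1)_-^{\alpha-\varepsilon}<\infty$ for all $\varepsilon\in(0,\alpha)$; (4) $\mathbb{E}[A^{\eta}B_+^{\alpha-\eta}]<\infty$ for some $\eta\in(0,\alpha)\cap(0,1]$ and $\mathbb{E}[A^{\eta_1}(B_1)_+^{\alpha-\eta_1}]<\infty$ for some $\eta_1\in(0,\alpha)\cap(0,1]$. Suppose further that $$\max\{Ax,B_1\}\le\Psi(x)\le Ax+B\quad\text{a.s.},\qquad x\ge0 .$$ Let $X$ be the random variable with the stationary law, $X\stackrel{d}{=}\Psi(X)$ with $X$ and $\Psi$ independent. Then for every $\varepsilon>0$ and all sufficiently large $x$, $$\frac{1-\varepsilon}{\rho}\,\widetilde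 L_{1,r}(x)\le x^{\alpha}\,\mathbb{P}(X>x)\le\frac{1+\varepsilon}{\rho}\,\widetilde L_r(x).$$ In particular, if $\widetilde L_r(x)\sim\widetilde L_{1,r}(x)$, then $x^{\alpha}\,\mathbb{P}(X>x)\sim\frac1\rho\widetilde L_r(x)$ as $x\to\infty$.
   Context: $a_+=\max\{a,0\}$ and $a_-=\max\{-a,0\}$. $f(x)\sim g(x)$ means $\lim_{x\to\infty}f(x)/g(x)=1$. A measurable $L:(0,\infty)\to(0,\infty)$ is slowly varying if $L(\lambda x)/L(x)\to1$ as $x\to\infty$ for every $\lambda>0$. A law on $\mathbb{R}$ is arithmetic if it is supported in $d\mathbb{Z}$ for some $d>0$, and non-arithmetic otherwise. The convention $0^\alpha\log0=0$ is used. $\widetilde L_r(x)=\int_0^x\frac{L_r(t)}{t}\,dt$ and $\widetilde L_{1,r}(x)=\int_0^x\frac{L_{1,r}(t)}{t}\,dt$. $(\Psi_n)_{n\ge1}$ are i.i.d. copies of $\Psi$, $\Psi_{n,1}=\Psi_n\circ\dots\circ\Psi_1$, and $L(\Psi)$, $L(\Psi_{n,1})$ denote Lipschitz constants. Under the stated integrability and contractivity conditions on $\Psi$, the recursion $X_n=\Psi_n(X_{n-1})$ (with $X_0$ independent of $(\Psi_n)$) converges in law to a random variable $X$ whose law does not depend on $X_0$ and which satisfies $X\stackrel{d}{=}\Psi(X)$ with $X$ and $\Psi$ independent; this is the $X$ in the claim. *)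

theory Defs
  imports "HOL-Probability.Probability" "HOL-Library.Landau_Symbols"
begin

definition slowly_varying :: "(real \<Rightarrow> real) \<Rightarrow> bool" where
  "slowly_varying L \<longleftrightarrow>
     L \<in> borel_measurable (restrict_space borel {0<..}) \<and>
     (\<forall>x>0. L x > 0) \<and>
     (\<forall>c>0. ((\<lambda>x. L (c * x) / L x) \<longlongrightarrow> 1) at_top)"

definition arithmetic_law :: "real measure \<Rightarrow> bool" where
  "arithmetic_law \<mu> \<longleftrightarrow> (\<exists>d>0. AE x in \<mu>. \<exists>k::int. x = d * of_int k)"

definition cond_law_log :: "'a measure \<Rightarrow> ('a \<Rightarrow> real) \<Rightarrow> real measure" where
  "cond_law_log M A = distr (uniform_measure M {\<omega> \<in> space M. A \<omega> > 0}) borel (\<lambda>\<omega>. ln (A \<omega>))"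

text \<open>Random maps are measured with respect to the cylinder sigma-algebra on the space of all
  functions. On Lipschitz (indeed on continuous) functions, evaluation at the rationals already
  generates it, and it makes the evaluation map and the Lipschitz constant measurable.\<close>

abbreviation map_space :: "(real \<Rightarrow> real) measure" where
  "map_space \<equiv> PiM UNIV (\<lambda>_. borel)"

definition random_lipschitz_map :: "'a measure \<Rightarrow> ('a \<Rightarrow> real \<Rightarrow> real) \<Rightarrow> bool" where
  "random_lipschitz_map M \<Psi> \<longleftrightarrow>
     \<Psi> \<in> measurable M map_space \<and> (\<forall>\<omega>\<in>space M. \<exists>C. C-lipschitz_on UNIV (\<Psi> \<omega>))"

definition random_map_copy ::
  "'a measure \<Rightarrow> ('a \<Rightarrow> real \<Rightarrow> real) \<Rightarrow> 'b measure \<Rightarrow> ('b \<Rightarrow> real \<Rightarrow> real) \<Rightarrow> bool" where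
  "random_map_copy M \<Psi> N \<Phi> \<longleftrightarrow>
     random_lipschitz_map N \<Phi> \<and> distr N map_space \<Phi> = distr M map_space \<Psi>"

definition lip_const :: "(real \<Rightarrow> real) \<Rightarrow> real" where
  "lip_const f = (SUP (x, y) \<in> {(x, y). x \<noteq> y}. \<bar>f x - f y\<bar> / \<bar>x - y\<bar>)"

definition log_plus :: "real \<Rightarrow> real" where
  "log_plus x = ln (max 1 x)"

text \<open>Extended logarithm, with value \<open>-\<infinity>\<close> at \<open>0\<close>: a Lipschitz constant may vanish, and
  \<open>ln 0 = 0\<close> would be the wrong value in the contractivity condition.\<close>

definition ext_log :: "real \<Rightarrow> ereal" where
  "ext_log x = (if x > 0 then ereal (ln x) else - \<infinity>)"

text \<open>\<open>comp_upto \<psi> n\<close> is \<open>\<psi> n \<circ> \<dots> \<circ> \<psi> 1\<close>; the value \<open>\<psi> 0\<close> is never used.\<close>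

fun comp_upto :: "(nat \<Rightarrow> real \<Rightarrow> real) \<Rightarrow> nat \<Rightarrow> real \<Rightarrow> real" where
  "comp_upto \<psi> 0 = id"
| "comp_upto \<psi> (Suc n) = \<psi> (Suc n) \<circ> comp_upto \<psi> n"

definition iid_copies ::
  "'a measure \<Rightarrow> ('a \<Rightarrow> real \<Rightarrow> real) \<Rightarrow> 'b measure \<Rightarrow> (nat \<Rightarrow> 'b \<Rightarrow> real \<Rightarrow> real) \<Rightarrow> bool" where
  "iid_copies M \<Psi> N \<Psi>s \<longleftrightarrow>
     (\<forall>n\<ge>1. random_map_copy M \<Psi> N (\<Psi>s n)) \<and>
     prob_space.indep_vars N (\<lambda>_. map_space) \<Psi>s {1..}"

definition contractive_as :: "'b measure \<Rightarrow> (nat \<Rightarrow> 'b \<Rightarrow> real \<Rightarrow> real) \<Rightarrow> bool" where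
  "contractive_as N \<Psi>s \<longleftrightarrow>
     (AE \<omega> in N. \<exists>l<0.
        (\<lambda>n. ext_log (lip_const (comp_upto (\<lambda>k. \<Psi>s k \<omega>) n)) / ereal (real n)) \<longlonglongrightarrow> l)"

text \<open>\<open>X\<close> has the same law as \<open>\<Phi>(X)\<close>, where \<open>\<Phi>\<close> is a copy of \<open>\<Psi>\<close> independent of \<open>X\<close>.
  Independence is phrased through the generated sigma-algebras because
  \<^const>\<open>prob_space.indep_var\<close> requires both variables to have the same value type.\<close>

definition stationary_solution ::
  "'a measure \<Rightarrow> ('a \<Rightarrow> real \<Rightarrow> real) \<Rightarrow> 'c measure \<Rightarrow> ('c \<Rightarrow> real \<Rightarrow> real) \<Rightarrow> ('c \<Rightarrow> real) \<Rightarrow> bool" where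
  "stationary_solution M \<Psi> K \<Phi> X \<longleftrightarrow>
     X \<in> borel_measurable K \<and> random_map_copy M \<Psi> K \<Phi> \<and>
     prob_space.indep_set K {X -` S \<inter> space K | S. S \<in> sets borel}
                            {\<Phi> -` S \<inter> space K | S. S \<in> sets map_space} \<and>
     distr K borel X = distr K borel (\<lambda>\<omega>. \<Phi> \<omega> (X \<omega>))"

definition tail_fn :: "'a measure \<Rightarrow> real \<Rightarrow> ('a \<Rightarrow> real) \<Rightarrow> real \<Rightarrow> real" where
  "tail_fn M \<alpha> Y x = x powr \<alpha> * measure M {\<omega> \<in> space M. Y \<omega> > x}"

definition int_tilde :: "(real \<Rightarrow> real) \<Rightarrow> real \<Rightarrow> real" where
  "int_tilde L x = (LBINT t:{0<..x}. L t / t)"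

abbreviation pos_part :: "real \<Rightarrow> real" where "pos_part a \<equiv> max a 0"
abbreviation neg_part :: "real \<Rightarrow> real" where "neg_part a \<equiv> max (- a) 0"

end

theory Submission
  imports Defs
begin

text \<open>
  Let \<open>P u x = E[A\<^sup>\<alpha> u(x/A)]\<close>, \<open>f x = x\<^sup>\<alpha> P(X > x)\<close>, and let \<open>G\<close> be the integral of \<open>g x = x\<^sup>\<alpha> P(B > x)\<close>
  against \<open>dx/x\<close>. No renewal theorem is needed: \<open>P 1 = 1\<close> and \<open>P x\<^sup>\<delta> = q x\<^sup>\<delta>\<close> with \<open>q < 1\<close>, so a function
  \<open>d \<ge> 0\<close> with \<open>d \<le> P d\<close> and \<open>d = O(x\<^sup>\<delta>)\<close> vanishes, which gives a comparison principle for sub- and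
  supersolutions of \<open>u = P u + s\<close>. Since \<open>g\<close> varies slowly, \<open>G x - P G x = E[A\<^sup>\<alpha> \<integral>\<^bsub>x/A\<^esub>\<^bsup>x\<^esup> g(t) dt/t]\<close> is close to
  \<open>\<rho> g x\<close>, so that \<open>G/\<rho>\<close> nearly solves the equation with source \<open>g\<close>. The recursion turns into
  \<open>f = P f + s\<close> where \<open>s\<close> differs from \<open>g\<close> by a relatively small term and a term that is merely integrable
  against \<open>dx/x\<close>, by the mixed moment condition. The latter has a bounded potential after
  averaging over a short window, because \<open>min 1 x\<^sup>\<delta>\<close> is a supersolution with a source bounded below on
  windows; averaging commutes with \<open>P\<close> and is undone by the monotonicity of \<open>P(X > x)\<close>. Bounded
  errors disappear in the end because \<open>G\<close> tends to infinity.

  The stationary law lives on \<open>[0, \<infinity>)\<close> because the composed maps contract and send \<open>0\<close> into \<open>[0, \<infinity>)\<close>.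
  Non-arithmeticity enters only through \<open>A \<noteq> 1\<close>, which yields \<open>\<rho> > 0\<close> and \<open>E[A\<^sup>p] < 1\<close> for \<open>0 < p < \<alpha>\<close>.
\<close>

section \<open>The measure \<open>dt/t\<close>\<close>

text \<open>All functions take values in \<open>ennreal\<close>, so \<open>P\<close> acts on every
  measurable function and Fubini asks for no integrability. The price is that subtraction truncates:
  identities such as G - P G = Dp - Dm are kept in additive form, and each cancellation is preceded
  by a finiteness proof. Truncation also helps, since \<open>u - w\<close> is the positive part to
  which the vanishing argument applies. Constants solve d = P d when E[A^\<alpha>] = 1; a growth
  bound by x^\<delta> with \<delta> > 0 excludes them because it forces smallness at 0. The two
  halves are not symmetric. For the upper bound \<open>f\<close> is the subsolution and must be
  known in advance to be O(x^\<delta>); this comes from the same comparison principle at exponent 0,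
  with A enlarged to A/c. For the lower bound the integrated tail of B1 is the subsolution, and the
  supersolution is built from the averaged \<open>f\<close>. There the contribution of large A must
  be bounded from above although A may have no moment of order above \<alpha>; it is dominated
  through a crude supersolution of the size of G and then absorbed on the left.\<close>

definition haar :: "real measure" where
  "haar = density lborel (\<lambda>t. ennreal (indicator {0<..} t / t))"

lemma sets_haar [measurable_cong, simp]: "sets haar = sets borel"
  by (simp add: haar_def)

lemma space_haar [simp]: "space haar = UNIV"
  by (simp add: haar_def)

lemma nn_integral_haar:
  assumes [measurable]: "u \<in> borel_measurable borel"
  shows "(\<integral>\<^sup>+t. u t \<partial>haar) = (\<integral>\<^sup>+t. ennreal (indicator {0<..} t / t) * u t \<partial>lborel)"
  unfolding haar_def by (rule nn_integral_density) auto

lemma AE_haar_pos: "AE t in haar. 0 < t"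
  unfolding haar_def by (subst AE_density) (auto simp: indicator_def)

lemma AE_haar_neq: "AE t in haar. t \<noteq> c"
  unfolding haar_def by (subst AE_density) (auto intro: AE_mp[OF AE_lborel_singleton[of c]])

lemma sigma_finite_haar: "sigma_finite_measure haar"
  unfolding haar_def
  by (subst sigma_finite_measure.sigma_finite_iff_density_finite[OF lborel.sigma_finite_measure_axioms]) auto

interpretation haar: sigma_finite_measure haar
  by (rule sigma_finite_haar)

lemma nn_integral_haar_scale:
  assumes [measurable]: "u \<in> borel_measurable borel" and c: "0 < c"
  shows "(\<integral>\<^sup>+t. u (c * t) \<partial>haar) = (\<integral>\<^sup>+t. u t \<partial>haar)"
proof -
  have "(\<integral>\<^sup>+t. u t \<partial>haar)
      = ennreal c * (\<integral>\<^sup>+t. ennreal (indicator {0<..} (c * t) / (c * t)) * u (c * t) \<partial>lborel)"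
    using c by (subst nn_integral_haar, simp, subst nn_integral_real_affine[where c = c and t = 0]) auto
  also have "\<dots> = (\<integral>\<^sup>+t. ennreal c * (ennreal (indicator {0<..} (c * t) / (c * t)) * u (c * t)) \<partial>lborel)"
    by (rule nn_integral_cmult[symmetric]) auto
  also have "\<dots> = (\<integral>\<^sup>+t. ennreal (indicator {0<..} t / t) * u (c * t) \<partial>lborel)"
    using c
    by (intro nn_integral_cong) (auto simp: indicator_def zero_less_mult_iff mult.assoc[symmetric]
        simp flip: ennreal_mult)
  finally show ?thesis by (simp add: nn_integral_haar)
qed

lemma nn_integral_haar_Icc:
  assumes ab: "0 < a" "a \<le> b"
  shows "(\<integral>\<^sup>+t. indicator {a..b} t \<partial>haar) = ennreal (ln (b / a))"
proof -
  have "(\<integral>\<^sup>+t. indicator {a..b} t \<partial>haar)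
      = (\<integral>\<^sup>+t. ennreal (1 / t) * indicator {a..b} t \<partial>lborel)"
    using ab by (subst nn_integral_haar, simp, intro nn_integral_cong)
      (auto simp: indicator_def)
  also have "\<dots> = ennreal (ln b - ln a)"
    using ab by (intro nn_integral_FTC_Icc)
      (auto intro!: derivative_eq_intros)
  finally show ?thesis using ab by (simp add: ln_div)
qed

lemma nn_integral_haar_powr_atMost:
  assumes p: "0 < p"
  shows "(\<integral>\<^sup>+t. ennreal (t powr p) * indicator {..c} t \<partial>haar) = ennreal (max 0 c powr p / p)"
proof (cases "0 < c")
  case False
  have "(\<integral>\<^sup>+t. ennreal (t powr p) * indicator {..c} t \<partial>haar) = (\<integral>\<^sup>+t. 0 \<partial>haar)"
    using AE_haar_pos False by (intro nn_integral_cong_AE) (auto simp: indicator_def)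
  with False show ?thesis by (simp add: max_def)
next
  case True
  have "(\<integral>\<^sup>+t. ennreal (t powr p) * indicator {..c} t \<partial>haar)
      = (\<integral>\<^sup>+t. ennreal (t powr (p - 1)) * indicator {0..c} t \<partial>lborel)"
    by (simp add: nn_integral_haar, intro nn_integral_cong)
      (auto simp: indicator_def powr_diff simp flip: ennreal_mult)
  also have "\<dots> = ennreal (c powr p / p - 0 powr p / p)"
  proof (subst nn_integral_set_ennreal, rule nn_integral_has_integral_lborel)
    show "((\<lambda>t. t powr (p - 1) * indicator {0..c} t) has_integral (c powr p / p - 0 powr p / p)) UNIV"
    proof -
      \<comment> \<open>The derivative is unbounded at 0 for p < 1, so differentiability is used in
        the interior only, together with continuity on the closed interval.\<close>
      have *: "((\<lambda>t. t powr (p - 1)) has_integral (c powr p / p - 0 powr p / p)) {0..c}"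
      proof (rule fundamental_theorem_of_calculus_interior)
        show "continuous_on {0..c} (\<lambda>t. t powr p / p)"
          using p by (intro continuous_on_divide continuous_on_powr' continuous_intros) auto
        fix t assume "t \<in> {0<..<c}"
        then show "((\<lambda>t. t powr p / p) has_vector_derivative t powr (p - 1)) (at t)"
          using p unfolding has_real_derivative_iff_has_vector_derivative[symmetric]
          by (auto intro!: derivative_eq_intros simp: powr_diff)
      qed (use True in simp)
      show ?thesis
        using has_integral_restrict_UNIV[THEN iffD2, OF *]
        by (rule has_integral_eq[rotated]) (auto simp: indicator_def)
    qed
  qed auto
  finally show ?thesis using True p by (simp add: max_def)
qed

section \<open>Sub- and supersolutions\<close>

lemma le_add_diff_ennreal: "x \<le> y + (x - y)" for x y :: ennreal
proof (cases "x \<le> y")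
  case True
  then show ?thesis by (simp add: add_increasing2)
next
  case False
  then have "y \<le> x" by simp
  then show ?thesis by (simp add: add_diff_inverse_ennreal)
qed

text \<open>The exponent \<open>a\<close> is a parameter separate from A because the locale serves
  twice: with a = \<alpha>, and with a = 0 and A/c in place of A for the a priori tail
  bound.\<close>

locale dilation = prob_space M for M :: "'a measure" +
  fixes A :: "'a \<Rightarrow> real" and a :: real
  assumes A_measurable [measurable]: "A \<in> borel_measurable M"
    and A_nonneg: "\<And>\<omega>. \<omega> \<in> space M \<Longrightarrow> 0 \<le> A \<omega>"
begin

definition mom :: "real \<Rightarrow> ennreal" where
  "mom p = (\<integral>\<^sup>+\<omega>. ennreal (A \<omega> powr p) \<partial>M)"

text \<open>The event \<open>A = 0\<close> does not contribute, even for \<open>a = 0\<close>, because \<open>0 powr 0 = 0\<close>.\<close>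

definition P :: "(real \<Rightarrow> ennreal) \<Rightarrow> real \<Rightarrow> ennreal" where
  "P u x = (\<integral>\<^sup>+\<omega>. ennreal (A \<omega> powr a) * u (x / A \<omega>) \<partial>M)"

definition subsol :: "(real \<Rightarrow> ennreal) \<Rightarrow> (real \<Rightarrow> ennreal) \<Rightarrow> bool" where
  "subsol u s \<longleftrightarrow> (\<forall>x>0. u x \<le> P u x + s x)"

definition supersol :: "(real \<Rightarrow> ennreal) \<Rightarrow> (real \<Rightarrow> ennreal) \<Rightarrow> bool" where
  "supersol u s \<longleftrightarrow> (\<forall>x>0. P u x + s x \<le> u x)"

lemma P_mono:
  assumes "\<And>x. 0 < x \<Longrightarrow> u x \<le> v x" and "0 < x"
  shows "P u x \<le> P v x"
  unfolding P_def
proof (rule nn_integral_mono)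
  fix \<omega> assume "\<omega> \<in> space M"
  then show "ennreal (A \<omega> powr a) * u (x / A \<omega>) \<le> ennreal (A \<omega> powr a) * v (x / A \<omega>)"
    using A_nonneg[of \<omega>] assms by (cases "A \<omega> = 0") (auto intro!: mult_left_mono)
qed

lemma P_measurable [measurable]:
  assumes [measurable]: "u \<in> borel_measurable borel"
  shows "P u \<in> borel_measurable borel"
  unfolding P_def by measurable

lemma P_add:
  assumes [measurable]: "u \<in> borel_measurable borel" "v \<in> borel_measurable borel"
  shows "P (\<lambda>x. u x + v x) x = P u x + P v x"
  unfolding P_def by (simp add: distrib_left nn_integral_add)

lemma P_cmult:
  assumes [measurable]: "u \<in> borel_measurable borel"
  shows "P (\<lambda>x. c * u x) x = c * P u x"
  unfolding P_def by (simp add: nn_integral_cmult[symmetric] mult.left_commute)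

lemma P_const: "P (\<lambda>x. c) x = c * mom a"
  unfolding P_def mom_def by (simp add: nn_integral_cmult[symmetric] mult.commute)

text \<open>Powers are eigenfunctions of \<open>P\<close>, because (x/A)^b splits into a factor in x
  and one in A. All contraction in the proof comes from an eigenvalue \<open>mom (a - b)\<close>
  below 1.\<close>

lemma P_powr:
  assumes "0 < x"
  shows "P (\<lambda>x. ennreal (x powr b)) x = ennreal (x powr b) * mom (a - b)"
  unfolding P_def mom_def
proof (subst nn_integral_cmult[symmetric])
  show "(\<integral>\<^sup>+\<omega>. ennreal (A \<omega> powr a) * ennreal ((x / A \<omega>) powr b) \<partial>M)
      = (\<integral>\<^sup>+\<omega>. ennreal (x powr b) * ennreal (A \<omega> powr (a - b)) \<partial>M)"
    using assms A_nonneg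
    by (intro nn_integral_cong) (simp add: powr_divide powr_diff flip: ennreal_mult)
qed auto

lemma supersol_mono:
  assumes "supersol u s" and "\<And>x. 0 < x \<Longrightarrow> t x \<le> s x"
  shows "supersol u t"
  using assms unfolding supersol_def by (meson add_left_mono order_trans)

lemma supersol_add:
  assumes [measurable]: "u \<in> borel_measurable borel" "v \<in> borel_measurable borel"
    and "supersol u s" "supersol v t"
  shows "supersol (\<lambda>x. u x + v x) (\<lambda>x. s x + t x)"
  unfolding supersol_def
proof (intro allI impI)
  fix x :: real assume "0 < x"
  then have "(P u x + s x) + (P v x + t x) \<le> u x + v x"
    using assms(3,4) unfolding supersol_def by (intro add_mono) auto
  then show "P (\<lambda>x. u x + v x) x + (s x + t x) \<le> u x + v x"
    by (simp add: P_add ac_simps)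
qed

lemma supersol_cmult:
  assumes [measurable]: "u \<in> borel_measurable borel" and "supersol u s"
  shows "supersol (\<lambda>x. c * u x) (\<lambda>x. c * s x)"
  using assms(2) unfolding supersol_def
  by (simp add: P_cmult distrib_left[symmetric] mult_left_mono)

text \<open>The bound e + C x^b reproduces itself under \<open>P\<close> with C replaced by C q: the
  constant does not grow since \<open>mom a\<close> is at most 1, and the power contracts. Iterating
  removes the power, and then e tends to 0. The slack e admits functions that merely tend to 0 at
  infinity, as needed when b is negative.\<close>

lemma vanish_of_le_P:
  assumes le: "\<And>x. 0 < x \<Longrightarrow> d x \<le> P d x"
    and mom_a: "mom a \<le> 1"
    and q: "mom (a - b) \<le> ennreal q" "0 \<le> q" "q < 1"
    and growth: "\<And>e. 0 < e \<Longrightarrow> \<exists>C\<ge>0. \<forall>x>0. d x \<le> ennreal (e + C * x powr b)"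
    and x: "0 < x"
  shows "d x = 0"
proof -
  have "d x \<le> ennreal e" if e: "0 < e" for e
  proof -
    obtain C where C: "0 \<le> C" "\<And>x. 0 < x \<Longrightarrow> d x \<le> ennreal (e + C * x powr b)"
      using growth[OF e] by auto
    have step: "d x \<le> ennreal (e + C * q ^ n * x powr b)" if "0 < x" for n x
      using that
    proof (induction n arbitrary: x)
      case 0
      then show ?case using C by simp
    next
      case (Suc n)
      have "d x \<le> P (\<lambda>x. ennreal e + ennreal (C * q ^ n) * ennreal (x powr b)) x"
        using Suc e C q by (intro order_trans[OF le P_mono])
          (auto simp flip: ennreal_mult ennreal_plus)
      also have "\<dots> = ennreal e * mom a + ennreal (C * q ^ n) * (ennreal (x powr b) * mom (a - b))"
        using Suc.prems by (simp add: P_add P_cmult P_powr P_const)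
      also have "\<dots> \<le> ennreal e * 1 + ennreal (C * q ^ n) * (ennreal (x powr b) * ennreal q)"
        by (intro add_mono mult_left_mono mom_a q) auto
      also have "\<dots> = ennreal (e + C * q ^ Suc n * x powr b)"
        using e C(1) q(2) by (simp add: algebra_simps ennreal_mult ennreal_plus)
      finally show ?case .
    qed
    have "(\<lambda>n. ennreal (e + C * q ^ n * x powr b)) \<longlonglongrightarrow> ennreal (e + C * 0 * x powr b)"
      using q by (intro tendsto_ennrealI tendsto_intros LIMSEQ_realpow_zero) auto
    then show ?thesis
      using step[OF x] by (intro LIMSEQ_le_const[where X = "\<lambda>n. ennreal (e + C * q ^ n * x powr b)"]) auto
  qed
  then have "d x \<le> 0 + ennreal e" if "0 < e" for e using that by simp
  then have "d x \<le> 0" by (rule ennreal_le_epsilon) simp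
  then show ?thesis by simp
qed

text \<open>The truncated difference \<open>u - w\<close> satisfies d \<le> P d, so it vanishes. The
  growth bound is imposed on the subsolution and passes to the difference; finiteness of the
  supersolution is what allows \<open>w\<close> to be moved across the inequality.\<close>

lemma comparison:
  assumes [measurable]: "u \<in> borel_measurable borel" "w \<in> borel_measurable borel"
    and sub: "subsol u s" and super: "supersol w s"
    and w_fin: "\<And>x. 0 < x \<Longrightarrow> w x < \<infinity>"
    and mom_a: "mom a \<le> 1"
    and q: "mom (a - b) \<le> ennreal q" "0 \<le> q" "q < 1"
    and growth: "\<And>e. 0 < e \<Longrightarrow> \<exists>C\<ge>0. \<forall>x>0. u x \<le> ennreal (e + C * x powr b)"
    and x: "0 < x"
  shows "u x \<le> w x"
proof -
  have "u x - w x = 0"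
  proof (rule vanish_of_le_P[OF _ mom_a q _ x])
    fix y :: real assume y: "0 < y"
    have "P u y \<le> P (\<lambda>x. w x + (u x - w x)) y"
      using y by (intro P_mono) (simp_all add: le_add_diff_ennreal)
    also have "\<dots> = P w y + P (\<lambda>x. u x - w x) y" by (rule P_add) auto
    finally have "u y \<le> (P w y + P (\<lambda>x. u x - w x) y) + s y"
      using sub y unfolding subsol_def by (meson add_right_mono order_trans)
    also have "\<dots> = (P w y + s y) + P (\<lambda>x. u x - w x) y" by (simp add: ac_simps)
    also have "\<dots> \<le> w y + P (\<lambda>x. u x - w x) y"
      using super y unfolding supersol_def by (intro add_right_mono) auto
    finally show "u y - w y \<le> P (\<lambda>x. u x - w x) y"
      using w_fin[OF y] by (subst ennreal_minus_le_iff) (auto)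
  next
    fix e :: real assume "0 < e"
    from growth[OF this] show "\<exists>C\<ge>0. \<forall>x>0. u x - w x \<le> ennreal (e + C * x powr b)"
      by (meson diff_le_self_ennreal order_trans)
  qed
  then show ?thesis using w_fin[OF x] by (simp add: diff_eq_0_iff_ennreal)
qed

text \<open>A superposition of dilations with weights \<open>k\<close>. Window averages, a single
  dilation (point mass), the potentials below and the operator \<open>R\<close> are all of this
  shape, so commutation with \<open>P\<close> and preservation of sub- and supersolutions are proved
  once.\<close>

definition mix :: "'b measure \<Rightarrow> ('b \<Rightarrow> ennreal) \<Rightarrow> ('b \<Rightarrow> real) \<Rightarrow> (real \<Rightarrow> ennreal) \<Rightarrow> real \<Rightarrow> ennreal"
  where "mix m k c u x = (\<integral>\<^sup>+s. k s * u (x * c s) \<partial>m)"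

context
  fixes m :: "'b measure" and k :: "'b \<Rightarrow> ennreal" and c :: "'b \<Rightarrow> real"
  assumes m: "sigma_finite_measure m"
    and k [measurable]: "k \<in> borel_measurable m" and c [measurable]: "c \<in> borel_measurable m"
    and c_pos: "AE s in m. 0 < c s"
begin

lemma mix_measurable [measurable]:
  assumes [measurable]: "u \<in> borel_measurable borel"
  shows "mix m k c u \<in> borel_measurable borel"
proof -
  interpret m: sigma_finite_measure m by (rule m)
  show ?thesis unfolding mix_def by measurable
qed

lemma mix_mono:
  assumes "\<And>x. 0 < x \<Longrightarrow> u x \<le> v x" and "0 < x"
  shows "mix m k c u x \<le> mix m k c v x"
  unfolding mix_def using c_pos assms
  by (intro nn_integral_mono_AE) (auto intro!: mult_left_mono)

lemma mix_add:
  assumes [measurable]: "u \<in> borel_measurable borel" "v \<in> borel_measurable borel"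
  shows "mix m k c (\<lambda>x. u x + v x) x = mix m k c u x + mix m k c v x"
  unfolding mix_def by (simp add: distrib_left nn_integral_add)

text \<open>Dilations commute with each other, so only the order of integration has to be
  exchanged.\<close>

lemma P_mix:
  assumes [measurable]: "u \<in> borel_measurable borel"
  shows "P (mix m k c u) x = mix m k c (P u) x"
proof -
  interpret m: sigma_finite_measure m by (rule m)
  interpret pair_sigma_finite M m ..
  have "P (mix m k c u) x
      = (\<integral>\<^sup>+\<omega>. (\<integral>\<^sup>+s. ennreal (A \<omega> powr a) * (k s * u (x / A \<omega> * c s)) \<partial>m) \<partial>M)"
    unfolding P_def mix_def by (intro nn_integral_cong) (simp add: nn_integral_cmult)
  also have "\<dots> = (\<integral>\<^sup>+s. (\<integral>\<^sup>+\<omega>. ennreal (A \<omega> powr a) * (k s * u (x / A \<omega> * c s)) \<partial>M) \<partial>m)"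
    by (rule Fubini'[symmetric]) measurable
  also have "\<dots> = mix m k c (P u) x"
    unfolding P_def mix_def
    by (intro nn_integral_cong) (simp add: nn_integral_cmult[symmetric] ac_simps)
  finally show ?thesis .
qed

lemma supersol_mix:
  assumes [measurable]: "u \<in> borel_measurable borel" "s \<in> borel_measurable borel"
    and "supersol u s"
  shows "supersol (mix m k c u) (mix m k c s)"
  using assms(3) unfolding supersol_def
  by (auto simp: P_mix mix_add[symmetric] intro!: mix_mono)

lemma subsol_mix:
  assumes [measurable]: "u \<in> borel_measurable borel" "s \<in> borel_measurable borel"
    and "subsol u s"
  shows "subsol (mix m k c u) (mix m k c s)"
  using assms(3) unfolding subsol_def
  by (auto simp: P_mix mix_add[symmetric] intro!: mix_mono)

end

end

section \<open>Bounded supersolutions\<close>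

locale contracting_dilation = dilation +
  fixes b q :: real
  assumes mom_a: "mom a \<le> 1" and mom_b: "mom (a - b) \<le> ennreal q"
    and q: "0 \<le> q" "q < 1" and b_pos: "0 < b"
begin

text \<open>Each branch of the minimum is a supersolution by itself: the constant because
  \<open>mom a\<close> is at most 1, the power because its eigenvalue is at most q. On x \<le> 1,
  where the power is the active branch, the spare factor 1 - q is the source.\<close>

lemma supersol_barrier:
  "supersol (\<lambda>x. min 1 (ennreal (x powr b))) (\<lambda>x. ennreal ((1 - q) * x powr b) * indicator {..1} x)"
  unfolding supersol_def
proof (intro allI impI)
  fix x :: real assume x: "0 < x"
  let ?v = "\<lambda>x. min 1 (ennreal (x powr b))"
  show "P ?v x + ennreal ((1 - q) * x powr b) * indicator {..1} x \<le> ?v x"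
  proof (cases "x \<le> 1")
    case True
    have "P ?v x \<le> P (\<lambda>x. ennreal (x powr b)) x" using x by (intro P_mono) auto
    also have "\<dots> = ennreal (x powr b) * mom (a - b)" using x by (rule P_powr)
    also have "\<dots> \<le> ennreal (x powr b) * ennreal q" by (intro mult_left_mono mom_b) auto
    finally have "P ?v x + ennreal ((1 - q) * x powr b) \<le> ennreal (x powr b * q) + ennreal ((1 - q) * x powr b)"
      using q by (intro add_right_mono) (simp add: ennreal_mult)
    also have "\<dots> = ennreal (x powr b)"
      using q by (subst ennreal_plus[symmetric], simp, simp, simp add: algebra_simps)
    also have "\<dots> = ?v x"
      using True x b_pos by (simp add: min_absorb2 powr_le1)
    finally show ?thesis using True by simp
  next
    case False
    have "P ?v x \<le> P (\<lambda>_. 1) x" using x by (intro P_mono) auto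
    also have "\<dots> \<le> 1" using mom_a by (simp add: P_const)
    also have "1 = ?v x"
      using False b_pos by (simp add: min_absorb1 ge_one_powr_ge_zero)
    finally show ?thesis using False by simp
  qed
qed

text \<open>Potentials of sources that live near the origin are bounded, so an inequality need only be
  checked for large arguments.\<close>

lemma bounded_supersol_near_0:
  assumes "0 < x0" "0 \<le> C"
  obtains E c where "E \<in> borel_measurable borel" "0 \<le> c" "\<And>x. E x \<le> ennreal c"
    "supersol E (\<lambda>x. ennreal (C * x powr b) * indicator {..x0} x)"
proof
  \<comment> \<open>Dilating the barrier by 1/x0 moves its source from {..1} to {..x0};
    \<open>k\<close> compensates for the resulting factor (1 - q) / x0^b.\<close>
  define k where "k = C * x0 powr b / (1 - q)"
  let ?v = "\<lambda>x. min 1 (ennreal (x powr b))"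
  let ?s = "\<lambda>x. ennreal ((1 - q) * x powr b) * indicator {..1} x"
  have k: "0 \<le> k" using assms q by (simp add: k_def)
  \<comment> \<open>The dilation is written as a mixture over a point mass so that
    \<open>supersol_mix\<close> applies to it.\<close>
  define E where "E x = ennreal k * mix (return borel (1 / x0)) (\<lambda>_. 1) (\<lambda>s. s) ?v x" for x
  have sf: "sigma_finite_measure (return borel (1 / x0))"
    by (intro prob_space_imp_sigma_finite prob_space_return) auto
  have mix_eq: "mix (return borel (1 / x0)) (\<lambda>_. 1) (\<lambda>s. s) u x = u (x / x0)"
    if [measurable]: "u \<in> borel_measurable borel" for u x
    unfolding mix_def by (subst nn_integral_return) auto
  show "E \<in> borel_measurable borel" unfolding E_def by (simp add: mix_eq)
  show "0 \<le> k" by fact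
  show "E x \<le> ennreal k" for x
    unfolding E_def by (subst mix_eq) (auto intro!: mult_left_mono[of _ "1::ennreal", simplified])
  have "supersol E (\<lambda>x. ennreal k * mix (return borel (1 / x0)) (\<lambda>_. 1) (\<lambda>s. s) ?s x)"
    unfolding E_def
    by (intro supersol_cmult supersol_mix mix_measurable supersol_barrier sf)
      (auto simp: AE_return assms)
  then show "supersol E (\<lambda>x. ennreal (C * x powr b) * indicator {..x0} x)"
  proof (rule supersol_mono)
    fix x :: real assume x: "0 < x"
    have "C * x powr b = k * ((1 - q) * (x / x0) powr b)"
      using assms x q by (simp add: k_def powr_divide)
    then show "ennreal (C * x powr b) * indicator {..x0} x
        \<le> ennreal k * mix (return borel (1 / x0)) (\<lambda>_. 1) (\<lambda>s. s) ?s x"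
      using assms x q k by (subst mix_eq) (auto simp: indicator_def ennreal_mult)
  qed
qed

text \<open>The potential of a source that is integrable against \<open>dt/t\<close> is bounded once the source is
  averaged over a window; this replaces local boundedness of the renewal measure.\<close>

lemma bounded_supersol_window:
  assumes [measurable]: "\<psi> \<in> borel_measurable borel"
    and fin: "(\<integral>\<^sup>+t. \<psi> t \<partial>haar) < \<infinity>" and l: "1 \<le> l"
  obtains V c where "V \<in> borel_measurable borel" "0 \<le> c" "\<And>x. V x \<le> ennreal c"
    "supersol V (\<lambda>x. \<integral>\<^sup>+t. \<psi> t * indicator {x / l..x * l} t \<partial>haar)"
proof -
  \<comment> \<open>For t in the window around x the ratio x / (l t) lies between l^(-2) and 1.
    There the source of the barrier is at least (1 - q) l^(-2b), and \<open>k\<close> normalises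
    this to at least 1.\<close>
  define k where "k = l powr (2 * b) / (1 - q)"
  have k: "0 \<le> k" using q by (simp add: k_def)
  let ?v = "\<lambda>x. min 1 (ennreal (x powr b))"
  let ?s = "\<lambda>x. ennreal ((1 - q) * x powr b) * indicator {..1} x"
  obtain r where r: "0 \<le> r" "(\<integral>\<^sup>+t. \<psi> t \<partial>haar) = ennreal r"
    using fin by (cases "\<integral>\<^sup>+t. \<psi> t \<partial>haar") auto
  \<comment> \<open>One dilated barrier for each t, with weight k \<psi>(t). Every barrier is at
    most 1, so the total is bounded by k times the integral of \<psi>.\<close>
  let ?V = "mix haar (\<lambda>t. ennreal k * \<psi> t) (\<lambda>t. 1 / (l * t)) ?v"
  have pos: "AE t in haar. 0 < 1 / (l * t)" using AE_haar_pos l by auto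
  show thesis
  proof (rule that[of ?V "k * r"])
    show "?V \<in> borel_measurable borel" by (rule mix_measurable[OF sigma_finite_haar _ _ pos]) auto
    show "0 \<le> k * r" using k r by simp
    show "?V x \<le> ennreal (k * r)" for x
    proof -
      have "?V x \<le> (\<integral>\<^sup>+t. ennreal k * \<psi> t \<partial>haar)"
        unfolding mix_def by (intro nn_integral_mono) (auto intro!: mult_left_mono[of _ "1::ennreal", simplified])
      also have "\<dots> = ennreal (k * r)" using k r by (simp add: nn_integral_cmult ennreal_mult)
      finally show ?thesis .
    qed
    have "supersol ?V (mix haar (\<lambda>t. ennreal k * \<psi> t) (\<lambda>t. 1 / (l * t)) ?s)"
      by (rule supersol_mix[OF sigma_finite_haar _ _ pos _ _ supersol_barrier]) auto
    then show "supersol ?V (\<lambda>x. \<integral>\<^sup>+t. \<psi> t * indicator {x / l..x * l} t \<partial>haar)"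
    proof (rule supersol_mono)
      fix x :: real assume x: "0 < x"
      have "\<psi> t * indicator {x / l..x * l} t \<le> ennreal k * \<psi> t * ?s (x * (1 / (l * t)))" if t: "0 < t" for t
      proof (cases "t \<in> {x / l..x * l}")
        case True
        have "x \<le> l * t" using True l by (simp add: divide_simps mult.commute)
        have "l powr - 2 = 1 / (l * l)" using l by (simp add: powr_minus divide_simps power2_eq_square)
        also have "\<dots> \<le> x / (l * t)"
          using True l t by (simp add: divide_simps)
        finally have "(l powr - 2) powr b \<le> (x / (l * t)) powr b"
          using b_pos by (intro powr_mono2) auto
        then have "l powr (2 * b) * (l powr - 2) powr b \<le> l powr (2 * b) * (x / (l * t)) powr b"
          by (intro mult_left_mono) auto
        moreover have "l powr (2 * b) * (l powr - 2) powr b = 1"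
          using l by (simp only: powr_powr powr_add[symmetric]) simp
        moreover have "k * ((1 - q) * (x / (l * t)) powr b) = l powr (2 * b) * (x / (l * t)) powr b"
          using q by (simp add: k_def)
        ultimately have "1 \<le> k * ((1 - q) * (x / (l * t)) powr b)" by (simp only:)
        then have "1 \<le> ennreal k * ennreal ((1 - q) * (x / (l * t)) powr b)"
          using k q by (simp flip: ennreal_mult)
        then have "\<psi> t * 1 \<le> \<psi> t * (ennreal k * ennreal ((1 - q) * (x / (l * t)) powr b))"
          by (intro mult_left_mono) auto
        then show ?thesis using True \<open>x \<le> l * t\<close> l t by (simp add: mult_ac)
      qed auto
      then show "(\<integral>\<^sup>+t. \<psi> t * indicator {x / l..x * l} t \<partial>haar)
          \<le> mix haar (\<lambda>t. ennreal k * \<psi> t) (\<lambda>t. 1 / (l * t)) ?s x"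
        unfolding mix_def using AE_haar_pos by (intro nn_integral_mono_AE) auto
    qed
  qed
qed

end

section \<open>Regularly varying tails\<close>

lemma borel_measurable_indicator_interval [measurable]:
  fixes f h k :: "'a \<Rightarrow> real"
  assumes [measurable]: "f \<in> borel_measurable N" "h \<in> borel_measurable N" "k \<in> borel_measurable N"
  shows "(\<lambda>x. indicator {..f x} (h x) :: ennreal) \<in> borel_measurable N"
    and "(\<lambda>x. indicator {..<f x} (h x) :: ennreal) \<in> borel_measurable N"
    and "(\<lambda>x. indicator {f x..k x} (h x) :: ennreal) \<in> borel_measurable N"
  unfolding indicator_def by (simp_all)

lemma nn_integral_haar_powr_lessThan:
  assumes p: "0 < p"
  shows "(\<integral>\<^sup>+t. ennreal (t powr p) * indicator {..<c} t \<partial>haar) = ennreal (max 0 c powr p / p)"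
proof -
  have "(\<integral>\<^sup>+t. ennreal (t powr p) * indicator {..<c} t \<partial>haar)
      = (\<integral>\<^sup>+t. ennreal (t powr p) * indicator {..c} t \<partial>haar)"
    by (rule nn_integral_cong_AE, rule AE_mp[OF AE_haar_neq[of c]]) (auto simp: indicator_def)
  then show ?thesis using nn_integral_haar_powr_atMost[OF p] by simp
qed

text \<open>Layer-cake formula in the scale dt/t: the power of the positive part is p times the
  integral of t^p over t < Y, and Fubini does the rest.\<close>

lemma (in prob_space) nn_integral_powr_eq_tail:
  assumes [measurable]: "Y \<in> borel_measurable M" and p: "0 < p"
  shows "(\<integral>\<^sup>+\<omega>. ennreal (max 0 (Y \<omega>) powr p) \<partial>M)
    = ennreal p * (\<integral>\<^sup>+t. ennreal (t powr p * prob {\<omega> \<in> space M. t < Y \<omega>}) \<partial>haar)"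
proof -
  interpret pair_sigma_finite M haar ..
  have "(\<integral>\<^sup>+\<omega>. ennreal (max 0 (Y \<omega>) powr p) \<partial>M)
      = (\<integral>\<^sup>+\<omega>. ennreal p * (\<integral>\<^sup>+t. ennreal (t powr p) * indicator {..<Y \<omega>} t \<partial>haar) \<partial>M)"
    using p by (intro nn_integral_cong) (simp add: nn_integral_haar_powr_lessThan flip: ennreal_mult)
  also have "\<dots> = ennreal p * (\<integral>\<^sup>+\<omega>. (\<integral>\<^sup>+t. ennreal (t powr p) * indicator {..<Y \<omega>} t \<partial>haar) \<partial>M)"
    by (rule nn_integral_cmult) measurable
  also have "(\<integral>\<^sup>+\<omega>. (\<integral>\<^sup>+t. ennreal (t powr p) * indicator {..<Y \<omega>} t \<partial>haar) \<partial>M)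
      = (\<integral>\<^sup>+t. (\<integral>\<^sup>+\<omega>. ennreal (t powr p) * indicator {..<Y \<omega>} t \<partial>M) \<partial>haar)"
    by (rule Fubini'[symmetric]) measurable
  also have "\<dots> = (\<integral>\<^sup>+t. ennreal (t powr p * prob {\<omega> \<in> space M. t < Y \<omega>}) \<partial>haar)"
  proof (intro nn_integral_cong)
    fix t
    have "(\<integral>\<^sup>+\<omega>. ennreal (t powr p) * indicator {..<Y \<omega>} t \<partial>M)
        = (\<integral>\<^sup>+\<omega>. ennreal (t powr p) * indicator {\<omega> \<in> space M. t < Y \<omega>} \<omega> \<partial>M)"
      by (intro nn_integral_cong) (auto simp: indicator_def)
    then show "(\<integral>\<^sup>+\<omega>. ennreal (t powr p) * indicator {..<Y \<omega>} t \<partial>M)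
        = ennreal (t powr p * prob {\<omega> \<in> space M. t < Y \<omega>})"
      by (simp add: nn_integral_cmult emeasure_eq_measure ennreal_mult)
  qed
  finally show ?thesis .
qed

lemma borel_measurable_antimono:
  fixes h :: "real \<Rightarrow> real"
  assumes "antimono h"
  shows "h \<in> borel_measurable borel"
proof -
  have "(\<lambda>x. - h x) \<in> borel_measurable borel"
    using assms by (intro borel_measurable_mono) (simp add: monotone_def)
  then show ?thesis using borel_measurable_uminus_eq by blast
qed

lemma borel_measurable_tail_fn:
  assumes "prob_space M" and [measurable]: "Y \<in> borel_measurable M"
  shows "tail_fn M \<alpha> Y \<in> borel_measurable borel"
proof -
  interpret prob_space M by fact
  have [measurable]: "(\<lambda>x. prob {\<omega> \<in> space M. Y \<omega> > x}) \<in> borel_measurable borel"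
    by (intro borel_measurable_antimono antimonoI finite_measure_mono) auto
  show ?thesis unfolding tail_fn_def by measurable
qed

section \<open>Uniformity in slow variation for tail functions\<close>

locale sv_tail = prob_space M for M :: "'a measure" +
  fixes Y :: "'a \<Rightarrow> real" and \<alpha> :: real
  assumes Y_measurable [measurable]: "Y \<in> borel_measurable M"
    and \<alpha>_pos: "0 < \<alpha>"
    and sv: "slowly_varying (tail_fn M \<alpha> Y)"
begin

abbreviation "g \<equiv> tail_fn M \<alpha> Y"

lemma g_measurable [measurable]: "g \<in> borel_measurable borel"
  by (rule borel_measurable_tail_fn[OF prob_space_axioms Y_measurable])

lemma g_pos: "0 < x \<Longrightarrow> 0 < g x"
  using sv by (auto simp: slowly_varying_def)

lemma g_nonneg [simp]: "0 \<le> g x"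
  by (simp add: tail_fn_def)

lemma g_le_powr: "g x \<le> x powr \<alpha>"
  unfolding tail_fn_def using mult_left_mono[OF prob_le_1, of "x powr \<alpha>"] by simp

text \<open>The tail probability decreases, so \<open>g\<close> grows at most like t^\<alpha>. This
  one-sided regularity is what upgrades the pointwise limits in the definition of slow variation to
  uniform bounds.\<close>

lemma g_le_step:
  assumes "0 < x" "x \<le> t"
  shows "g t \<le> (t / x) powr \<alpha> * g x"
proof -
  have "g t \<le> t powr \<alpha> * prob {\<omega> \<in> space M. Y \<omega> > x}"
    unfolding tail_fn_def using assms by (intro mult_left_mono finite_measure_mono) auto
  then show ?thesis using assms by (simp add: tail_fn_def powr_divide)
qed

lemma g_ratio: "0 < c \<Longrightarrow> ((\<lambda>x. g (c * x) / g x) \<longlongrightarrow> 1) at_top"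
  using sv by (auto simp: slowly_varying_def)

text \<open>Slow variation is applied at the finitely many points of a geometric grid of ratio r.
  Between grid points \<open>g_le_step\<close> gives control from the point below for the upper
  bound and from the point above for the lower bound; r is chosen so that one step costs the factor
  1 + e/3.\<close>

lemma g_uniform:
  assumes K: "1 \<le> K" and e: "0 < e" "e < 1"
  shows "\<forall>\<^sub>F x in at_top. \<forall>t\<in>{x / K..x * K}. (1 - e) * g x \<le> g t \<and> g t \<le> (1 + e) * g x"
proof -
  define r where "r = (1 + e / 3) powr (1 / \<alpha>)"
  have r: "1 < r" using e \<alpha>_pos by (simp add: r_def gr_one_powr)
  have r_\<alpha>: "r powr \<alpha> = 1 + e / 3" using e \<alpha>_pos by (simp add: r_def powr_powr)
  \<comment> \<open>The extra 1 leaves room for both grid neighbours of t, with indices i and i +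
    1.\<close>
  define n where "n = \<lceil>log r K\<rceil> + 1"
  have "\<forall>\<^sub>F x in at_top. \<bar>g (r powr real_of_int i * x) / g x - 1\<bar> < e / 3" for i
    using tendstoD[OF g_ratio[of "r powr real_of_int i"], of "e / 3"] r e by (simp add: dist_real_def)
  then have "\<forall>\<^sub>F x in at_top. \<forall>i\<in>{-n..n}. \<bar>g (r powr real_of_int i * x) / g x - 1\<bar> < e / 3"
    by (intro eventually_ball_finite) auto
  then show ?thesis using eventually_gt_at_top[of 0]
  proof eventually_elim
    case (elim x)
    have near: "(1 - e / 3) * g x \<le> g (r powr real_of_int i * x)"
        "g (r powr real_of_int i * x) \<le> (1 + e / 3) * g x" if "i \<in> {-n..n}" for i
    proof -
      have "1 - e / 3 \<le> g (r powr real_of_int i * x) / g x" "g (r powr real_of_int i * x) / g x \<le> 1 + e / 3"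
        using bspec[OF elim(1) that] by linarith+
      then show "(1 - e / 3) * g x \<le> g (r powr real_of_int i * x)"
        "g (r powr real_of_int i * x) \<le> (1 + e / 3) * g x"
        using g_pos[OF elim(2)] by (simp_all add: field_simps)
    qed
    show ?case
    proof
      fix t assume t: "t \<in> {x / K..x * K}"
      have t_pos: "0 < t" using t K elim(2) by (auto intro: less_le_trans[of 0 "x / K"])
      define i where "i = \<lfloor>log r (t / x)\<rfloor>"
      have "t / x \<le> K" "1 / K \<le> t / x" using t K elim(2) by (auto simp: divide_simps mult.commute)
      then have "log r (t / x) \<le> log r K" "log r (1 / K) \<le> log r (t / x)"
        using K r t_pos elim(2) by (auto simp: log_le_cancel_iff)
      then have "log r (t / x) \<le> log r K" "- log r K \<le> log r (t / x)"
        using K r by (auto simp: log_divide)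
      then have i: "i \<in> {-n..n}" "i + 1 \<in> {-n..n}" unfolding i_def n_def by (auto simp: algebra_simps) linarith+
      have "r powr real_of_int i \<le> r powr (log r (t / x))" "r powr (log r (t / x)) \<le> r powr (real_of_int (i + 1))"
        using r unfolding i_def by (intro powr_mono; linarith)+
      then have le: "r powr real_of_int i \<le> t / x" "t / x \<le> r powr (real_of_int (i + 1))"
        using r t_pos elim(2) by auto
      let ?y = "r powr real_of_int i * x" and ?z = "r powr real_of_int (i + 1) * x"
      have y: "0 < ?y" "?y \<le> t" "t \<le> ?z" using le r elim(2) by (simp_all add: divide_simps)
      have "?z = r * ?y" using r by (simp add: powr_add)
      then have "t / ?y \<le> r" "?z / t \<le> r" using y t_pos r mult_left_mono[OF y(2), of r]
        by (simp_all only: pos_divide_le_eq)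
      then have ratio: "(t / ?y) powr \<alpha> \<le> 1 + e / 3" "(?z / t) powr \<alpha> \<le> 1 + e / 3"
        using powr_mono2[of \<alpha> "t / ?y" r] powr_mono2[of \<alpha> "?z / t" r] y t_pos \<alpha>_pos r_\<alpha> by auto
      have "g t \<le> (t / ?y) powr \<alpha> * g ?y" using y by (intro g_le_step)
      also have "\<dots> \<le> (1 + e / 3) * ((1 + e / 3) * g x)"
        using ratio near(2)[OF i(1)] e by (intro mult_mono) auto
      also have "\<dots> = ((1 + e / 3) * (1 + e / 3)) * g x" by simp
      also have "\<dots> \<le> (1 + e) * g x"
      proof (rule mult_right_mono)
        have "e * e \<le> e" using e mult_left_mono[of e 1 e] by simp
        moreover have "(1 + e / 3) * (1 + e / 3) = 1 + 2 / 3 * e + e * e / 9" by (simp add: field_simps)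
        ultimately show "(1 + e / 3) * (1 + e / 3) \<le> 1 + e" using e by linarith
      qed simp
      finally have upper: "g t \<le> (1 + e) * g x" .
      have "(1 - e / 3) * g x \<le> g ?z" by (rule near(1)[OF i(2)])
      also have "\<dots> \<le> (?z / t) powr \<alpha> * g t" using y t_pos by (intro g_le_step)
      also have "\<dots> \<le> (1 + e / 3) * g t" using ratio by (intro mult_right_mono) auto
      finally have "(1 - e / 3) / (1 + e / 3) * g x \<le> g t" using e by (simp add: field_simps)
      moreover have "(1 - e) * g x \<le> (1 - e / 3) / (1 + e / 3) * g x"
        using e g_pos[OF elim(2)] by (intro mult_right_mono) (auto simp: field_simps)
      ultimately show "(1 - e) * g x \<le> g t \<and> g t \<le> (1 + e) * g x" using upper by linarith
    qed
  qed
qed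

text \<open>Potter-type bound. From some point on, doubling the argument multiplies \<open>g\<close>
  by at most 2^d; this is iterated over all full doublings between x and t, and the last incomplete
  one costs 2^\<alpha> by \<open>g_le_step\<close>.\<close>

lemma g_potter:
  assumes d: "0 < d"
  shows "\<exists>x0>0. \<forall>x\<ge>x0. \<forall>t\<ge>x. g t \<le> 2 powr \<alpha> * (t / x) powr d * g x"
proof -
  have "\<forall>\<^sub>F x in at_top. g (2 * x) / g x < 2 powr d"
    using g_ratio[of 2] d by (intro order_tendstoD) (auto simp: gr_one_powr)
  then obtain x1 where x1: "\<And>x. x1 \<le> x \<Longrightarrow> g (2 * x) / g x < 2 powr d"
    by (auto simp: eventually_at_top_linorder)
  define x0 where "x0 = max x1 1"
  have iter: "g (2 ^ n * x) \<le> (2 powr d) ^ n * g x" if x: "x0 \<le> x" for n x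
  proof (induction n)
    case (Suc n)
    have "x \<le> 2 ^ n * x" using x mult_right_mono[of 1 "2 ^ n" x] by (simp add: x0_def)
    then have "x1 \<le> 2 ^ n * x" "0 < 2 ^ n * x" using x unfolding x0_def by (linarith, simp)
    then have "g (2 * (2 ^ n * x)) \<le> 2 powr d * g (2 ^ n * x)"
      using x1[of "2 ^ n * x"] g_pos[of "2 ^ n * x"] by (simp add: divide_simps)
    also have "\<dots> \<le> 2 powr d * ((2 powr d) ^ n * g x)" using Suc by (intro mult_left_mono) auto
    finally show ?case by (simp add: mult.assoc)
  qed simp
  have "g t \<le> 2 powr \<alpha> * (t / x) powr d * g x" if x: "x0 \<le> x" "x \<le> t" for x t
  proof -
    have pos: "0 < x" "0 < t" using x by (auto simp: x0_def)
    define n where "n = nat \<lfloor>log 2 (t / x)\<rfloor>"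
    have "0 \<le> log 2 (t / x)" using x pos by simp
    then have n: "real n \<le> log 2 (t / x)" "log 2 (t / x) \<le> real n + 1"
      unfolding n_def by linarith+
    have "2 powr real n \<le> 2 powr (log 2 (t / x))" "2 powr (log 2 (t / x)) \<le> 2 powr (real n + 1)"
      using n by (auto intro: powr_mono)
    then have le: "2 ^ n \<le> t / x" "t / x \<le> 2 * 2 ^ n"
      using pos by (simp_all add: powr_add powr_realpow)
    then have y: "2 ^ n * x \<le> t" "t / (2 ^ n * x) \<le> 2"
      using pos by (simp_all add: field_simps)
    have "g t \<le> (t / (2 ^ n * x)) powr \<alpha> * g (2 ^ n * x)"
      using y pos by (intro g_le_step) auto
    also have "\<dots> \<le> 2 powr \<alpha> * ((2 powr d) ^ n * g x)"
      using y pos \<alpha>_pos by (intro mult_mono powr_mono2 iter x) auto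
    also have "(2 powr d) ^ n = (2 ^ n) powr d"
      by (simp add: powr_powr powr_realpow[symmetric] mult.commute)
    also have "2 powr \<alpha> * ((2 ^ n) powr d * g x) \<le> 2 powr \<alpha> * ((t / x) powr d * g x)"
      using le d by (intro mult_left_mono mult_right_mono powr_mono2) auto
    finally show ?thesis by (simp add: mult.assoc)
  qed
  moreover have "0 < x0" by (simp add: x0_def)
  ultimately show ?thesis by blast
qed

text \<open>Far out this is the Potter bound started at a fixed point. Near 0 it is the trivial
  bound x^\<alpha>, which is at most a constant times x^d because d \<le> \<alpha>.\<close>

lemma g_growth:
  assumes d: "0 < d" "d \<le> \<alpha>"
  shows "\<exists>C\<ge>0. \<forall>x>0. g x \<le> C * x powr d"
proof -
  obtain x0 where x0: "0 < x0" "\<And>x t. x0 \<le> x \<Longrightarrow> x \<le> t \<Longrightarrow> g t \<le> 2 powr \<alpha> * (t / x) powr d * g x"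
    using g_potter[OF d(1)] by auto
  define C where "C = max (x0 powr (\<alpha> - d)) (2 powr \<alpha> * g x0 / x0 powr d)"
  have "g x \<le> C * x powr d" if x: "0 < x" for x
  proof (cases "x \<le> x0")
    case True
    have "g x \<le> x powr (\<alpha> - d) * x powr d" using g_le_powr[of x] by (simp flip: powr_add)
    also have "\<dots> \<le> C * x powr d"
      using True x d by (intro mult_right_mono) (auto simp: C_def intro!: le_max_iff_disj[THEN iffD2] disjI1 powr_mono2)
    finally show ?thesis .
  next
    case False
    then have "g x \<le> 2 powr \<alpha> * g x0 / x0 powr d * x powr d"
      using x0(2)[of x0 x] x0(1) x by (simp add: powr_divide mult_ac)
    also have "\<dots> \<le> C * x powr d" by (intro mult_right_mono) (auto simp: C_def)
    finally show ?thesis .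
  qed
  moreover have "0 \<le> C" by (simp add: C_def le_max_iff_disj)
  ultimately show ?thesis by blast
qed

text \<open>The integrated tail as an \<open>ennreal\<close> function, the form in which
  \<open>P\<close> acts on it. As \<open>haar\<close> does not charge the negative half-line,
  \<open>{..x}\<close> amounts to the interval from 0 to x; \<open>G_eq\<close> links this to
  \<open>int_tilde\<close>.\<close>

definition G :: "real \<Rightarrow> ennreal" where
  "G x = (\<integral>\<^sup>+t. ennreal (g t) * indicator {..x} t \<partial>haar)"

lemma G_measurable [measurable]: "G \<in> borel_measurable borel"
  unfolding G_def by measurable

lemma G_mono: "x \<le> y \<Longrightarrow> G x \<le> G y"
  unfolding G_def by (intro nn_integral_mono mult_left_mono) (auto simp: indicator_def)

lemma G_growth:
  assumes d: "0 < d" "d \<le> \<alpha>"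
  shows "\<exists>C\<ge>0. \<forall>x>0. G x \<le> ennreal (C * x powr d)"
proof -
  obtain C where C: "0 \<le> C" "\<And>x. 0 < x \<Longrightarrow> g x \<le> C * x powr d" using g_growth[OF d] by auto
  have "G x \<le> ennreal (C / d * x powr d)" if x: "0 < x" for x
  proof -
    have "G x \<le> (\<integral>\<^sup>+t. ennreal C * (ennreal (t powr d) * indicator {..x} t) \<partial>haar)"
      unfolding G_def using AE_haar_pos C
      by (intro nn_integral_mono_AE) (auto simp: indicator_def simp flip: ennreal_mult)
    also have "\<dots> = ennreal (C / d * x powr d)"
      using x C d by (simp add: nn_integral_cmult nn_integral_haar_powr_atMost flip: ennreal_mult)
    finally show ?thesis .
  qed
  then show ?thesis using C d by (intro exI[of _ "C / d"]) auto
qed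

lemma G_finite: "0 < x \<Longrightarrow> G x < \<infinity>"
  using G_growth[OF \<alpha>_pos order.refl] by (metis ennreal_less_top infinity_ennreal_def le_less_trans)

lemma int_tilde_nonneg: "0 \<le> int_tilde g x"
  unfolding int_tilde_def set_lebesgue_integral_def
  by (intro integral_nonneg_AE AE_I2) (auto simp: indicator_def)

lemma G_eq:
  assumes "0 < x"
  shows "G x = ennreal (int_tilde g x)"
proof -
  have eq: "G x = (\<integral>\<^sup>+t. ennreal (indicator {0<..x} t * (g t / t)) \<partial>lborel)"
    unfolding G_def by (subst nn_integral_haar, simp, intro nn_integral_cong)
      (auto simp: indicator_def simp flip: ennreal_mult)
  then have "integrable lborel (\<lambda>t. indicator {0<..x} t * (g t / t))"
    using G_finite[OF assms] by (intro integrableI_nonneg) (auto simp: indicator_def)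
  then show ?thesis
    unfolding eq int_tilde_def set_lebesgue_integral_def real_scaleR_def
    by (intro nn_integral_eq_integral) (auto simp: indicator_def)
qed

text \<open>By the layer-cake formula the \<alpha>-th moment of the positive part of Y is \<alpha>
  times the full integral of g(t) dt/t, so its divergence is the divergence of G.\<close>

lemma int_tilde_at_top:
  assumes inf: "(\<integral>\<^sup>+\<omega>. ennreal (max (Y \<omega>) 0 powr \<alpha>) \<partial>M) = \<infinity>"
  shows "filterlim (int_tilde g) at_top at_top"
proof -
  have "ennreal \<alpha> * (\<integral>\<^sup>+t. ennreal (g t) \<partial>haar) = \<infinity>"
    using inf nn_integral_powr_eq_tail[OF Y_measurable \<alpha>_pos] by (simp add: tail_fn_def max.commute)
  then have top: "(\<integral>\<^sup>+t. ennreal (g t) \<partial>haar) = \<infinity>" by (auto simp: ennreal_mult_eq_top_iff)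
  have "(SUP n. G (real n)) = (\<integral>\<^sup>+t. (SUP n. ennreal (g t) * indicator {..real n} t) \<partial>haar)"
    unfolding G_def
    by (intro nn_integral_monotone_convergence_SUP[symmetric] incseq_SucI le_funI mult_left_mono)
      (auto simp: indicator_def)
  also have "\<dots> = (\<integral>\<^sup>+t. ennreal (g t) \<partial>haar)"
  proof (intro nn_integral_cong antisym)
    fix t
    show "(SUP n. ennreal (g t) * indicator {..real n} t) \<le> ennreal (g t)"
      by (intro SUP_least) (auto simp: indicator_def)
    obtain n where "t \<le> real n" using real_arch_simple by blast
    then show "ennreal (g t) \<le> (SUP n. ennreal (g t) * indicator {..real n} t)"
      by (intro SUP_upper2[of n]) auto
  qed
  finally have sup: "(SUP n. G (real n)) = \<infinity>" using top by simp
  show ?thesis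
    unfolding filterlim_at_top
  proof
    fix Z :: real
    have "ennreal Z < (SUP n. G (real n))" unfolding sup by (simp only: infinity_ennreal_def ennreal_less_top)
    then obtain n where n: "ennreal Z < G (real n)" by (auto simp: less_SUP_iff)
    show "\<forall>\<^sub>F x in at_top. Z \<le> int_tilde g x"
      using eventually_ge_at_top[of "real n"] eventually_gt_at_top[of 0]
    proof eventually_elim
      case (elim x)
      have "ennreal Z < ennreal (int_tilde g x)"
        using n G_mono[OF elim(1)] G_eq[OF elim(2)] by simp
      then show ?case by (meson ennreal_leI linorder_not_le less_imp_le)
    qed
  qed
qed

end

section \<open>The operator on integrated slowly varying functions\<close>

locale renewal_kernel = contracting_dilation M A a b q
  for M :: "'a measure" and A a b q +
  assumes mom_1: "mom a = 1" and b_less: "b < a"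
    and integrable_log: "integrable M (\<lambda>\<omega>. A \<omega> powr a * ln (A \<omega>))"
begin

definition "\<rho> = (\<integral>\<omega>. A \<omega> powr a * ln (A \<omega>) \<partial>M)"
definition "\<rho>p = (\<integral>\<omega>. A \<omega> powr a * max 0 (ln (A \<omega>)) \<partial>M)"
definition "\<rho>m = (\<integral>\<omega>. A \<omega> powr a * max 0 (- ln (A \<omega>)) \<partial>M)"

lemma integrable_log_parts:
  "integrable M (\<lambda>\<omega>. A \<omega> powr a * max 0 (ln (A \<omega>)))"
  "integrable M (\<lambda>\<omega>. A \<omega> powr a * max 0 (- ln (A \<omega>)))"
  by (rule Bochner_Integration.integrable_bound[OF integrable_log];
      auto intro!: AE_I2 simp: abs_mult intro: mult_left_mono)+

lemma \<rho>_eq: "\<rho> = \<rho>p - \<rho>m"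
  unfolding \<rho>_def \<rho>p_def \<rho>m_def
  by (subst Bochner_Integration.integral_diff[symmetric, OF integrable_log_parts])
    (auto intro!: Bochner_Integration.integral_cong simp: max_def algebra_simps)

lemma \<rho>p_nonneg: "0 \<le> \<rho>p" and \<rho>m_nonneg: "0 \<le> \<rho>m"
  unfolding \<rho>p_def \<rho>m_def by (auto intro!: integral_nonneg_AE)

lemma nn_integral_\<rho>p: "(\<integral>\<^sup>+\<omega>. ennreal (A \<omega> powr a * max 0 (ln (A \<omega>))) \<partial>M) = ennreal \<rho>p"
  unfolding \<rho>p_def by (rule nn_integral_eq_integral[OF integrable_log_parts(1)]) auto

lemma nn_integral_\<rho>m: "(\<integral>\<^sup>+\<omega>. ennreal (A \<omega> powr a * max 0 (- ln (A \<omega>))) \<partial>M) = ennreal \<rho>m"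
  unfolding \<rho>m_def by (rule nn_integral_eq_integral[OF integrable_log_parts(2)]) auto

text \<open>Weighted excess of |log A| over log K: the share of the drift that is invisible when
  \<open>g\<close> is controlled only on [x/K, xK].\<close>

definition log_tail :: "real \<Rightarrow> ennreal" where
  "log_tail K = (\<integral>\<^sup>+\<omega>. ennreal (A \<omega> powr a * max 0 (\<bar>ln (A \<omega>)\<bar> - ln K)) \<partial>M)"

lemma log_tail_small:
  assumes e: "0 < e"
  shows "\<forall>\<^sub>F K in at_top. log_tail K \<le> ennreal e"
proof -
  have int: "integrable M (\<lambda>\<omega>. A \<omega> powr a * max 0 (\<bar>ln (A \<omega>)\<bar> - ln K))" if "1 \<le> K" for K
    using that by (intro Bochner_Integration.integrable_bound[OF integrable_log])
      (auto intro!: AE_I2 mult_left_mono simp: abs_mult)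
  have "((\<lambda>K. \<integral>\<omega>. A \<omega> powr a * max 0 (\<bar>ln (A \<omega>)\<bar> - ln K) \<partial>M) \<longlongrightarrow> (\<integral>\<omega>. 0 \<partial>M)) at_top"
  proof (rule integral_dominated_convergence_at_top[where w = "\<lambda>\<omega>. A \<omega> powr a * \<bar>ln (A \<omega>)\<bar>"])
    show "integrable M (\<lambda>\<omega>. A \<omega> powr a * \<bar>ln (A \<omega>)\<bar>)"
      using integrable_abs[OF integrable_log] by (simp add: abs_mult)
    show "\<forall>\<^sub>F K in at_top. AE \<omega> in M. norm (A \<omega> powr a * max 0 (\<bar>ln (A \<omega>)\<bar> - ln K)) \<le> A \<omega> powr a * \<bar>ln (A \<omega>)\<bar>"
      using eventually_ge_at_top[of 1]
      by eventually_elim (auto intro!: AE_I2 mult_left_mono simp: abs_mult)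
    show "AE \<omega> in M. ((\<lambda>K. A \<omega> powr a * max 0 (\<bar>ln (A \<omega>)\<bar> - ln K)) \<longlongrightarrow> 0) at_top"
    proof (intro AE_I2 tendsto_eventually)
      fix \<omega>
      show "\<forall>\<^sub>F K in at_top. A \<omega> powr a * max 0 (\<bar>ln (A \<omega>)\<bar> - ln K) = 0"
        using filterlim_at_top[THEN iffD1, OF ln_at_top, rule_format, of "\<bar>ln (A \<omega>)\<bar>"]
        by eventually_elim auto
    qed
  qed auto
  then have "((\<lambda>K. \<integral>\<omega>. A \<omega> powr a * max 0 (\<bar>ln (A \<omega>)\<bar> - ln K) \<partial>M) \<longlongrightarrow> 0) at_top" by simp
  from order_tendstoD(2)[OF this e] eventually_ge_at_top[of 1] show ?thesis
  proof eventually_elim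
    case (elim K)
    have "log_tail K = ennreal (\<integral>\<omega>. A \<omega> powr a * max 0 (\<bar>ln (A \<omega>)\<bar> - ln K) \<partial>M)"
      unfolding log_tail_def by (rule nn_integral_eq_integral[OF int[OF elim(2)]]) auto
    then show ?case using elim by (simp add: ennreal_leI)
  qed
qed

text \<open>Window integrals are bounded below by c times u minus the excess of |log A| over log K.
  Integrated against A^a the excess becomes \<open>log_tail K\<close>; it stands on the right as a
  summand because subtraction in \<open>ennreal\<close> would truncate.\<close>

lemma truncated_lower:
  assumes [measurable]: "u \<in> borel_measurable M" "W \<in> borel_measurable M" and c: "0 \<le> c"
    and u: "\<And>\<omega>. 0 \<le> u \<omega>"
    and le: "\<And>\<omega>. 0 < A \<omega> \<Longrightarrow> ennreal (c * (u \<omega> - max 0 (\<bar>ln (A \<omega>)\<bar> - ln K))) \<le> W \<omega>"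
  shows "ennreal c * (\<integral>\<^sup>+\<omega>. ennreal (A \<omega> powr a * u \<omega>) \<partial>M)
    \<le> (\<integral>\<^sup>+\<omega>. ennreal (A \<omega> powr a) * W \<omega> \<partial>M) + ennreal c * log_tail K"
proof -
  have "ennreal c * (\<integral>\<^sup>+\<omega>. ennreal (A \<omega> powr a * u \<omega>) \<partial>M)
      = (\<integral>\<^sup>+\<omega>. ennreal c * ennreal (A \<omega> powr a * u \<omega>) \<partial>M)"
    by (rule nn_integral_cmult[symmetric]) measurable
  also have "\<dots> \<le> (\<integral>\<^sup>+\<omega>. ennreal (A \<omega> powr a) * W \<omega>
      + ennreal c * ennreal (A \<omega> powr a * max 0 (\<bar>ln (A \<omega>)\<bar> - ln K)) \<partial>M)"
  proof (intro nn_integral_mono)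
    fix \<omega> assume "\<omega> \<in> space M"
    then consider "A \<omega> = 0" | "0 < A \<omega>" using A_nonneg by fastforce
    then show "ennreal c * ennreal (A \<omega> powr a * u \<omega>)
      \<le> ennreal (A \<omega> powr a) * W \<omega> + ennreal c * ennreal (A \<omega> powr a * max 0 (\<bar>ln (A \<omega>)\<bar> - ln K))"
    proof cases
      case 2
      let ?v = "max 0 (\<bar>ln (A \<omega>)\<bar> - ln K)"
      have "ennreal (c * u \<omega>) \<le> ennreal (max 0 (c * (u \<omega> - ?v)) + c * ?v)"
      proof (rule ennreal_leI)
        show "c * u \<omega> \<le> max 0 (c * (u \<omega> - ?v)) + c * ?v"
          using max.cobounded2[of "c * (u \<omega> - ?v)" 0] unfolding right_diff_distrib by linarith
      qed
      also have "\<dots> = ennreal (c * (u \<omega> - ?v)) + ennreal (c * ?v)"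
        using c by (subst ennreal_plus) (auto simp: max_def ennreal_neg)
      also have "\<dots> \<le> W \<omega> + ennreal (c * ?v)"
        by (intro add_right_mono le 2)
      finally have "ennreal (A \<omega> powr a) * ennreal (c * u \<omega>)
          \<le> ennreal (A \<omega> powr a) * (W \<omega> + ennreal (c * ?v))"
        by (rule mult_left_mono) simp
      then show ?thesis using c u by (simp add: ennreal_mult distrib_left mult_ac)
    qed simp
  qed
  also have "\<dots> = (\<integral>\<^sup>+\<omega>. ennreal (A \<omega> powr a) * W \<omega> \<partial>M) + ennreal c * log_tail K"
    unfolding log_tail_def by (simp add: nn_integral_add nn_integral_cmult)
  finally show ?thesis .
qed

text \<open>For large \<open>A\<close> no dominating function is available, as \<open>A\<close> need not have a moment of order above
  \<open>a\<close>. That part is kept as the error \<open>R K g\<close>; being a mixture of dilations, \<open>R K\<close> commutes with \<open>P\<close>,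
  so \<open>R K H\<close> controls its potential whenever \<open>H\<close> is a supersolution with source \<open>g\<close>.\<close>

definition R :: "real \<Rightarrow> (real \<Rightarrow> ennreal) \<Rightarrow> real \<Rightarrow> ennreal" where
  "R K = mix (M \<Otimes>\<^sub>M haar)
    (\<lambda>(\<omega>, s). ennreal (A \<omega> powr a) * indicator {K..A \<omega>} (A \<omega>) * indicator {1 / A \<omega>..1 / K} s) snd"

lemma R_facts:
  "sigma_finite_measure (M \<Otimes>\<^sub>M haar)"
  "(\<lambda>(\<omega>, s). ennreal (A \<omega> powr a) * indicator {K..A \<omega>} (A \<omega>) * indicator {1 / A \<omega>..1 / K} s)
    \<in> borel_measurable (M \<Otimes>\<^sub>M haar)"
  "snd \<in> borel_measurable (M \<Otimes>\<^sub>M haar)"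
  "AE z in M \<Otimes>\<^sub>M haar. 0 < snd z"
proof -
  interpret pair_sigma_finite M haar ..
  show "sigma_finite_measure (M \<Otimes>\<^sub>M haar)" ..
  show "(\<lambda>(\<omega>, s). ennreal (A \<omega> powr a) * indicator {K..A \<omega>} (A \<omega>) * indicator {1 / A \<omega>..1 / K} s)
    \<in> borel_measurable (M \<Otimes>\<^sub>M haar)"
    by measurable
  show "snd \<in> borel_measurable (M \<Otimes>\<^sub>M haar)" by measurable
  show "AE z in M \<Otimes>\<^sub>M haar. 0 < snd z"
    by (rule AE_pair_measure, measurable, simp add: AE_haar_pos)
qed

lemma R_measurable [measurable]: "u \<in> borel_measurable borel \<Longrightarrow> R K u \<in> borel_measurable borel"
  unfolding R_def by (rule mix_measurable[OF R_facts])

lemma R_supersol: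
  "u \<in> borel_measurable borel \<Longrightarrow> s \<in> borel_measurable borel \<Longrightarrow> supersol u s \<Longrightarrow> supersol (R K u) (R K s)"
  unfolding R_def by (rule supersol_mix[OF R_facts])

text \<open>Unfolds the mixture over the product space into an iterated integral. The factor
  \<open>indicator {K..A \<omega>} (A \<omega>)\<close> is the event K \<le> A, in a form covered by
  the measurability rule for intervals.\<close>

lemma R_eq:
  assumes [measurable]: "u \<in> borel_measurable borel"
  shows "R K u x = (\<integral>\<^sup>+\<omega>. ennreal (A \<omega> powr a) * (indicator {K..A \<omega>} (A \<omega>)
    * (\<integral>\<^sup>+s. u (x * s) * indicator {1 / A \<omega>..1 / K} s \<partial>haar)) \<partial>M)"
proof -
  interpret pair_sigma_finite M haar ..
  show ?thesis
    unfolding R_def mix_def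
    by (subst haar.nn_integral_fst[symmetric], measurable, intro nn_integral_cong)
      (simp add: nn_integral_cmult[symmetric] mult_ac)
qed

text \<open>Only arguments x s with s \<le> 1/K \<le> 1 enter, where a nondecreasing
  \<open>u\<close> is at most u(x), and the window from 1/A to 1/K has mass log A - log K.\<close>

lemma R_le:
  assumes K: "1 \<le> K" and u [measurable]: "u \<in> borel_measurable borel"
    and mono: "\<And>y z. 0 < y \<Longrightarrow> y \<le> z \<Longrightarrow> u y \<le> u z" and x: "0 < x"
  shows "R K u x \<le> u x * log_tail K"
proof -
  have "R K u x \<le> (\<integral>\<^sup>+\<omega>. u x * ennreal (A \<omega> powr a * max 0 (\<bar>ln (A \<omega>)\<bar> - ln K)) \<partial>M)"
    unfolding R_eq[OF u]
  proof (intro nn_integral_mono)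
    fix \<omega>
    have "indicator {K..A \<omega>} (A \<omega>) * (\<integral>\<^sup>+s. u (x * s) * indicator {1 / A \<omega>..1 / K} s \<partial>haar)
        \<le> u x * ennreal (max 0 (\<bar>ln (A \<omega>)\<bar> - ln K))"
    proof (cases "K \<le> A \<omega>")
      case True
      have "(\<integral>\<^sup>+s. u (x * s) * indicator {1 / A \<omega>..1 / K} s \<partial>haar)
          \<le> (\<integral>\<^sup>+s. u x * indicator {1 / A \<omega>..1 / K} s \<partial>haar)"
      proof (rule nn_integral_mono_AE, rule AE_mp[OF AE_haar_pos], rule AE_I2, rule impI)
        fix s :: real assume s: "0 < s"
        show "u (x * s) * indicator {1 / A \<omega>..1 / K} s \<le> u x * indicator {1 / A \<omega>..1 / K} s"
        proof (cases "s \<le> 1 / K")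
          case True
          then have "s \<le> 1" using K by (simp add: divide_le_eq_1 order_trans[of s "1 / K" 1])
          then show ?thesis using s x by (intro mult_right_mono mono) (auto simp: mult_le_cancel_left1)
        qed auto
      qed
      also have "\<dots> = u x * ennreal (ln (1 / K / (1 / A \<omega>)))"
        using True K by (subst nn_integral_cmult, simp, subst nn_integral_haar_Icc) (auto simp: frac_le)
      also have "ln (1 / K / (1 / A \<omega>)) = max 0 (\<bar>ln (A \<omega>)\<bar> - ln K)"
        using True K by (simp add: ln_div max_absorb2)
      finally show ?thesis using True by simp
    qed simp
    then have "ennreal (A \<omega> powr a) * (indicator {K..A \<omega>} (A \<omega>) * (\<integral>\<^sup>+s. u (x * s) * indicator {1 / A \<omega>..1 / K} s \<partial>haar))
        \<le> ennreal (A \<omega> powr a) * (u x * ennreal (max 0 (\<bar>ln (A \<omega>)\<bar> - ln K)))"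
      by (intro mult_left_mono) auto
    then show "ennreal (A \<omega> powr a) * (indicator {K..A \<omega>} (A \<omega>) * (\<integral>\<^sup>+s. u (x * s) * indicator {1 / A \<omega>..1 / K} s \<partial>haar))
        \<le> u x * ennreal (A \<omega> powr a * max 0 (\<bar>ln (A \<omega>)\<bar> - ln K))"
      by (simp add: ennreal_mult mult_ac)
  qed
  also have "\<dots> = u x * log_tail K" unfolding log_tail_def by (rule nn_integral_cmult) measurable
  finally show ?thesis .
qed

end

section \<open>The defect of \<open>G\<close> under \<open>P\<close>\<close>

locale renewal_tail = renewal_kernel M A a b q + sv_tail M Y a
  for M :: "'a measure" and A a b q Y +
  assumes \<rho>_pos: "0 < \<rho>"
begin

abbreviation window :: "real \<Rightarrow> real \<Rightarrow> ennreal" where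
  "window u v \<equiv> \<integral>\<^sup>+t. ennreal (g t) * indicator {u..v} t \<partial>haar"

text \<open>The positive and the negative part of E[A^a times the integral of g(t) dt/t from x/A to
  x]. A window with reversed endpoints is empty, so \<open>Dp\<close> sees A > 1 and
  \<open>Dm\<close> sees A < 1; where A = 0 the weight vanishes.\<close>

definition "Dp x = (\<integral>\<^sup>+\<omega>. ennreal (A \<omega> powr a) * (window (x / A \<omega>) x) \<partial>M)"
definition "Dm x = (\<integral>\<^sup>+\<omega>. ennreal (A \<omega> powr a) * (window x (x / A \<omega>)) \<partial>M)"

lemma G_diff: "G x + (window x y)
    = G y + (window y x)"
  unfolding G_def
  by (subst (1 2) nn_integral_add[symmetric], measurable, rule nn_integral_cong_AE,
      rule AE_mp[OF AE_haar_neq[of x]], rule AE_mp[OF AE_haar_neq[of y]])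
    (auto simp: indicator_def)

lemma G_P_growth: "\<exists>C\<ge>0. \<forall>x>0. G x \<le> ennreal (C * x powr b) \<and> P G x \<le> ennreal (C * x powr b)"
proof -
  obtain C where C: "0 \<le> C" "\<And>x. 0 < x \<Longrightarrow> G x \<le> ennreal (C * x powr b)"
    using G_growth[of b] b_pos b_less by auto
  have "P G x \<le> ennreal (C * x powr b)" if x: "0 < x" for x
  proof -
    have "P G x \<le> P (\<lambda>x. ennreal C * ennreal (x powr b)) x"
      using C x by (intro P_mono) (auto simp flip: ennreal_mult)
    also have "\<dots> = ennreal C * (ennreal (x powr b) * mom (a - b))"
      using x by (simp add: P_cmult P_powr)
    also have "\<dots> \<le> ennreal C * (ennreal (x powr b) * 1)"
      using mom_b q by (intro mult_left_mono) (auto intro: order_trans simp: ennreal_le_1)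
    also have "\<dots> = ennreal (C * x powr b)" using C by (simp add: ennreal_mult)
    finally show ?thesis .
  qed
  with C show ?thesis by blast
qed

lemma P_G_finite: "0 < x \<Longrightarrow> P G x < \<infinity>"
  using G_P_growth by (metis ennreal_less_top infinity_ennreal_def le_less_trans)

text \<open>As \<open>mom a = 1\<close>, G(x) is the average of G(x) with weight A^a and can be
  compared with G(x/A) inside the expectation. This is G - P G = Dp - Dm without
  subtraction.\<close>

lemma G_identity:
  assumes x: "0 < x"
  shows "G x + Dm x = P G x + Dp x"
proof -
  have "G x + Dm x = (\<integral>\<^sup>+\<omega>. ennreal (A \<omega> powr a) * G x \<partial>M) + Dm x"
    using mom_1 by (simp add: nn_integral_multc mom_def)
  also have "\<dots> = (\<integral>\<^sup>+\<omega>. ennreal (A \<omega> powr a) * (G x + (window x (x / A \<omega>))) \<partial>M)"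
    unfolding Dm_def by (simp add: nn_integral_add[symmetric] distrib_left)
  also have "\<dots> = (\<integral>\<^sup>+\<omega>. ennreal (A \<omega> powr a) * (G (x / A \<omega>) + (window (x / A \<omega>) x)) \<partial>M)"
    by (simp add: G_diff)
  also have "\<dots> = P G x + Dp x"
    unfolding P_def Dp_def by (simp add: nn_integral_add[symmetric] distrib_left)
  finally show ?thesis .
qed

lemma Dm_finite:
  assumes x: "0 < x"
  shows "Dm x < \<infinity>"
proof -
  have "Dm x \<le> P G x"
    unfolding Dm_def P_def G_def
    by (intro nn_integral_mono mult_left_mono) (auto simp: indicator_def)
  then show ?thesis using P_G_finite[OF x] by (rule le_less_trans)
qed

lemma window_bounds:
  assumes "0 < u" "u \<le> v" and "0 \<le> c"
  shows "(\<And>t. t \<in> {u..v} \<Longrightarrow> c \<le> g t) \<Longrightarrow>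
      ennreal (c * ln (v / u)) \<le> (window u v)"
    and "(\<And>t. t \<in> {u..v} \<Longrightarrow> g t \<le> c) \<Longrightarrow>
      (window u v) \<le> ennreal (c * ln (v / u))"
proof -
  have eq: "ennreal (c * ln (v / u)) = (\<integral>\<^sup>+t. ennreal c * indicator {u..v} t \<partial>haar)"
    using assms by (subst nn_integral_cmult, simp, subst nn_integral_haar_Icc) (auto simp: ennreal_mult)
  show "(\<And>t. t \<in> {u..v} \<Longrightarrow> c \<le> g t) \<Longrightarrow>
      ennreal (c * ln (v / u)) \<le> (window u v)"
    unfolding eq by (intro nn_integral_mono) (auto simp: indicator_def intro!: ennreal_leI)
  show "(\<And>t. t \<in> {u..v} \<Longrightarrow> g t \<le> c) \<Longrightarrow>
      (window u v) \<le> ennreal (c * ln (v / u))"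
    unfolding eq by (intro nn_integral_mono) (auto simp: indicator_def intro!: ennreal_leI)
qed

section \<open>Windows around a point where \<open>g\<close> is nearly constant on [x/K, xK]\<close>

context
  fixes x K e :: real
  assumes x: "0 < x" and K: "1 \<le> K" and e: "0 < e" "e < 1"
    and unif: "\<And>t. t \<in> {x / K..x * K} \<Longrightarrow> (1 - e) * g x \<le> g t \<and> g t \<le> (1 + e) * g x"
begin

text \<open>The window is cut at x/K, where uniform control ends. The remaining logarithmic length
  min (ln y) (ln K) is exactly ln y minus the excess over ln K.\<close>

lemma down_window_lower:
  assumes y: "0 < y"
  shows "ennreal ((1 - e) * g x * (max 0 (ln y) - max 0 (\<bar>ln y\<bar> - ln K)))
    \<le> (window (x / y) x)"
proof (cases "1 \<le> y")
  case True
  define r where "r = min y K"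
  have r: "1 \<le> r" "r \<le> K" "r \<le> y" using True K by (auto simp: r_def)
  have "max 0 (ln y) - max 0 (\<bar>ln y\<bar> - ln K) = ln (x / (x / r))"
    using True K x by (auto simp: r_def min_def max_def)
  moreover have "ennreal ((1 - e) * g x * ln (x / (x / r))) \<le> (window (x / r) x)"
  proof (rule window_bounds(1))
    fix t assume "t \<in> {x / r..x}"
    moreover have "x / K \<le> x / r" "x \<le> x * K" using r x K by (auto intro: divide_left_mono)
    ultimately show "(1 - e) * g x \<le> g t" using unif[of t] by auto
  qed (use r x e in \<open>auto simp: divide_le_eq\<close>)
  moreover have "(window (x / r) x)
      \<le> (window (x / y) x)"
  proof -
    have "x / y \<le> x / r" using r x by (auto intro: divide_left_mono)
    then show ?thesis by (intro nn_integral_mono) (auto simp: indicator_def)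
  qed
  ultimately show ?thesis by (simp only:)
next
  case False
  then have "max 0 (ln y) - max 0 (\<bar>ln y\<bar> - ln K) \<le> 0" using y by (simp add: max_def)
  then have "(1 - e) * g x * (max 0 (ln y) - max 0 (\<bar>ln y\<bar> - ln K)) \<le> 0"
    using e by (intro mult_nonneg_nonpos) auto
  then show ?thesis by (simp add: ennreal_neg)
qed

lemma up_window_lower:
  assumes y: "0 < y"
  shows "ennreal ((1 - e) * g x * (max 0 (- ln y) - max 0 (\<bar>ln y\<bar> - ln K)))
    \<le> (window x (x / y))"
proof (cases "y \<le> 1")
  case True
  define r where "r = max y (1 / K)"
  have r: "r \<le> 1" "1 / K \<le> r" "y \<le> r" using True K by (auto simp: r_def)
  have "0 < r" using y r by linarith
  have "max 0 (- ln y) - max 0 (\<bar>ln y\<bar> - ln K) = ln (x / r / x)"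
  proof -
    have "ln y \<le> 0" using True y by simp
    moreover have "ln (x / r / x) = - ln r" using x \<open>0 < r\<close> by (simp add: ln_div)
    moreover have "ln r = max (ln y) (- ln K)"
    proof (cases "y \<le> 1 / K")
      case True
      then have "ln y \<le> ln (1 / K)" using y K by (subst ln_le_cancel_iff) auto
      then show ?thesis using True K by (simp add: r_def ln_div max_def)
    next
      case False
      then have "ln (1 / K) \<le> ln y" using y K by (subst ln_le_cancel_iff) auto
      then show ?thesis using False K by (simp add: r_def ln_div max_def)
    qed
    ultimately show ?thesis by (simp add: max_def)
  qed
  moreover have "ennreal ((1 - e) * g x * ln (x / r / x)) \<le> (window x (x / r))"
  proof (rule window_bounds(1))
    fix t assume "t \<in> {x..x / r}"
    moreover have "x / r \<le> x / (1 / K)" using r x K \<open>0 < r\<close> by (intro divide_left_mono) auto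
    moreover have "x / K \<le> x" using x K by (simp add: divide_le_eq)
    ultimately show "(1 - e) * g x \<le> g t" using unif[of t] by auto
  qed (use r x e \<open>0 < r\<close> in \<open>auto simp: le_divide_eq\<close>)
  moreover have "(window x (x / r))
      \<le> (window x (x / y))"
  proof -
    have "x / r \<le> x / y" using r x y by (intro divide_left_mono) auto
    then show ?thesis by (intro nn_integral_mono) (auto simp: indicator_def)
  qed
  ultimately show ?thesis by (simp only:)
next
  case False
  then have "max 0 (- ln y) - max 0 (\<bar>ln y\<bar> - ln K) \<le> 0" using y by (simp add: max_def)
  then have "(1 - e) * g x * (max 0 (- ln y) - max 0 (\<bar>ln y\<bar> - ln K)) \<le> 0"
    using e by (intro mult_nonneg_nonpos) auto
  then show ?thesis by (simp add: ennreal_neg)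
qed

text \<open>On the part above x/K the factor 1 + e suffices. The part below x/K is left as it is, to
  be collected by \<open>R K\<close>.\<close>

lemma down_window_upper:
  assumes y: "0 < y"
  shows "(window (x / y) x)
    \<le> ennreal ((1 + e) * g x * max 0 (ln y))
      + indicator {K..y} y * (window (x / y) (x / K))"
proof (cases "1 \<le> y")
  case True
  define r where "r = min y K"
  have r: "1 \<le> r" "r \<le> K" "r \<le> y" using True K by (auto simp: r_def)
  have *: "(window (x / r) x) \<le> ennreal ((1 + e) * g x * ln (x / (x / r)))"
  proof (rule window_bounds(2))
    fix t assume "t \<in> {x / r..x}"
    moreover have "x / K \<le> x / r" "x \<le> x * K" using r x K by (auto intro: divide_left_mono)
    ultimately show "g t \<le> (1 + e) * g x" using unif[of t] by auto
  qed (use r x e in \<open>auto simp: divide_le_eq\<close>)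
  have "ln (x / (x / r)) \<le> max 0 (ln y)" using r x by simp
  then have "(1 + e) * g x * ln (x / (x / r)) \<le> (1 + e) * g x * max 0 (ln y)"
    using e by (intro mult_left_mono) auto
  with * have 1: "(window (x / r) x) \<le> ennreal ((1 + e) * g x * max 0 (ln y))"
    by (meson ennreal_leI order_trans)
  have "(window (x / y) x)
      \<le> (\<integral>\<^sup>+t. ennreal (g t) * indicator {x / r..x} t
          + indicator {K..y} y * (ennreal (g t) * indicator {x / y..x / K} t) \<partial>haar)"
    by (intro nn_integral_mono) (auto simp: indicator_def r_def min_def)
  also have "\<dots> = (window (x / r) x)
      + indicator {K..y} y * (window (x / y) (x / K))"
    by (simp add: nn_integral_add nn_integral_cmult)
  finally show ?thesis using 1 by (meson add_right_mono order_trans)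
next
  case False
  then have "x < x / y" using y x by (simp add: less_divide_eq)
  then show ?thesis by simp
qed

text \<open>For y below 1/K the Potter bound gives a multiple of g(x) y^(-b). Writing y^(-b) =
  y^(a-b) y^(-a) makes the first factor at most K^(b-a), which is small; the second factor cancels
  the weight A^a on integration.\<close>

lemma up_window_upper:
  assumes y: "0 < y"
    and potter: "\<And>t. x \<le> t \<Longrightarrow> g t \<le> 2 powr a * (t / x) powr b * g x"
  shows "(window x (x / y))
    \<le> ennreal (g x * ((1 + e) * max 0 (- ln y) + 2 powr a / b * K powr (b - a) * y powr (-a)))"
proof (cases "1 / K \<le> y")
  case True
  show ?thesis
  proof (cases "y \<le> 1")
    case y1: True
    have "(window x (x / y)) \<le> ennreal ((1 + e) * g x * ln (x / y / x))"
    proof (rule window_bounds(2))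
      fix t assume "t \<in> {x..x / y}"
      moreover have "x / y \<le> x / (1 / K)" using True x K y by (intro divide_left_mono) auto
      moreover have "x / K \<le> x" using x K by (simp add: divide_le_eq)
      ultimately show "g t \<le> (1 + e) * g x" using unif[of t] by auto
    qed (use y y1 x e in \<open>auto simp: le_divide_eq\<close>)
    also have "ln (x / y / x) = max 0 (- ln y)" using x y y1 by (simp add: ln_div)
    also have "ennreal ((1 + e) * g x * max 0 (- ln y))
        \<le> ennreal (g x * ((1 + e) * max 0 (- ln y) + 2 powr a / b * K powr (b - a) * y powr (-a)))"
      using b_pos by (intro ennreal_leI) (simp add: algebra_simps)
    finally show ?thesis .
  next
    case False
    then have "x / y < x" using y x by (simp add: divide_less_eq)
    then show ?thesis by simp
  qed
next
  case False
  have y1: "y < 1" using False K by (auto simp: not_le intro: less_le_trans[of y "1 / K"])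
  have "(window x (x / y))
      \<le> (\<integral>\<^sup>+t. ennreal (2 powr a * x powr (- b) * g x) * (ennreal (t powr b) * indicator {..x / y} t) \<partial>haar)"
  proof (intro nn_integral_mono)
    fix t
    show "ennreal (g t) * indicator {x..x / y} t
        \<le> ennreal (2 powr a * x powr (- b) * g x) * (ennreal (t powr b) * indicator {..x / y} t)"
      using potter[of t] x
      by (auto simp: indicator_def powr_divide powr_minus divide_simps mult_ac simp flip: ennreal_mult)
  qed
  also have "\<dots> = ennreal (2 powr a * x powr (- b) * g x * ((x / y) powr b / b))"
    using x y b_pos by (simp add: nn_integral_cmult nn_integral_haar_powr_atMost flip: ennreal_mult)
  also have "2 powr a * x powr (- b) * g x * ((x / y) powr b / b) = g x * (2 powr a / b * y powr (- b))"
    using x y by (simp add: powr_divide powr_minus field_simps)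
  also have "ennreal \<dots> \<le> ennreal (g x * ((1 + e) * max 0 (- ln y) + 2 powr a / b * K powr (b - a) * y powr (-a)))"
  proof (intro ennreal_leI mult_left_mono)
    have "y powr (- b) = y powr (a - b) * y powr (- a)" using y by (simp flip: powr_add)
    also have "\<dots> \<le> (1 / K) powr (a - b) * y powr (- a)"
      using False y K b_less by (intro mult_right_mono powr_mono2) auto
    also have "(1 / K) powr (a - b) = K powr (b - a)"
      using K by (simp add: powr_divide powr_diff)
    finally have "2 powr a / b * y powr (- b) \<le> 2 powr a / b * (K powr (b - a) * y powr (- a))"
      using b_pos by (intro mult_left_mono) auto
    moreover have "0 \<le> (1 + e) * max 0 (- ln y)" using e by simp
    ultimately show "2 powr a / b * y powr (- b)
        \<le> (1 + e) * max 0 (- ln y) + 2 powr a / b * K powr (b - a) * y powr (-a)"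
      by (simp add: mult.assoc)
  qed simp
  finally show ?thesis .
qed

lemma Dp_lower: "ennreal ((1 - e) * g x * \<rho>p) \<le> Dp x + ennreal ((1 - e) * g x) * log_tail K"
proof -
  have "ennreal ((1 - e) * g x) * (\<integral>\<^sup>+\<omega>. ennreal (A \<omega> powr a * max 0 (ln (A \<omega>))) \<partial>M)
      \<le> Dp x + ennreal ((1 - e) * g x) * log_tail K"
    unfolding Dp_def
    by (rule truncated_lower) (use e down_window_lower in \<open>auto simp: mult_le_0_iff\<close>)
  then show ?thesis using e \<rho>p_nonneg by (subst (asm) nn_integral_\<rho>p) (simp add: ennreal_mult)
qed

lemma Dm_lower: "ennreal ((1 - e) * g x * \<rho>m) \<le> Dm x + ennreal ((1 - e) * g x) * log_tail K"
proof -
  have "ennreal ((1 - e) * g x) * (\<integral>\<^sup>+\<omega>. ennreal (A \<omega> powr a * max 0 (- ln (A \<omega>))) \<partial>M)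
      \<le> Dm x + ennreal ((1 - e) * g x) * log_tail K"
    unfolding Dm_def
    by (rule truncated_lower) (use e up_window_lower in \<open>auto simp: mult_le_0_iff\<close>)
  then show ?thesis using e \<rho>m_nonneg by (subst (asm) nn_integral_\<rho>m) (simp add: ennreal_mult)
qed

lemma Dp_upper: "Dp x \<le> ennreal ((1 + e) * g x * \<rho>p) + R K (\<lambda>x. ennreal (g x)) x"
proof -
  have "Dp x \<le> (\<integral>\<^sup>+\<omega>. ennreal ((1 + e) * g x) * ennreal (A \<omega> powr a * max 0 (ln (A \<omega>)))
      + ennreal (A \<omega> powr a) * (indicator {K..A \<omega>} (A \<omega>)
        * (\<integral>\<^sup>+s. ennreal (g (x * s)) * indicator {1 / A \<omega>..1 / K} s \<partial>haar)) \<partial>M)"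
    unfolding Dp_def
  proof (intro nn_integral_mono)
    fix \<omega> assume "\<omega> \<in> space M"
    then consider "A \<omega> = 0" | "0 < A \<omega>" using A_nonneg by fastforce
    then show "ennreal (A \<omega> powr a) * (window (x / A \<omega>) x)
      \<le> ennreal ((1 + e) * g x) * ennreal (A \<omega> powr a * max 0 (ln (A \<omega>)))
        + ennreal (A \<omega> powr a) * (indicator {K..A \<omega>} (A \<omega>)
          * (\<integral>\<^sup>+s. ennreal (g (x * s)) * indicator {1 / A \<omega>..1 / K} s \<partial>haar))"
    proof cases
      case 2
      have "(\<integral>\<^sup>+s. ennreal (g (x * s)) * indicator {1 / A \<omega>..1 / K} s \<partial>haar)
          = (\<integral>\<^sup>+s. ennreal (g (x * s)) * indicator {x / A \<omega>..x / K} (x * s) \<partial>haar)"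
        using x K 2 by (intro nn_integral_cong) (auto simp: indicator_def field_simps)
      also have "\<dots> = (window (x / A \<omega>) (x / K))"
        by (rule nn_integral_haar_scale[OF _ x, of "\<lambda>t. ennreal (g t) * indicator {x / A \<omega>..x / K} t"]) measurable
      finally have eq: "(\<integral>\<^sup>+s. ennreal (g (x * s)) * indicator {1 / A \<omega>..1 / K} s \<partial>haar)
          = (window (x / A \<omega>) (x / K))" .
      have "ennreal (A \<omega> powr a) * (window (x / A \<omega>) x)
          \<le> ennreal (A \<omega> powr a) * (ennreal ((1 + e) * g x * max 0 (ln (A \<omega>)))
            + indicator {K..A \<omega>} (A \<omega>) * (window (x / A \<omega>) (x / K)))"
        by (intro mult_left_mono down_window_upper[OF 2]) simp_all
      then show ?thesis unfolding eq using e by (simp add: ennreal_mult distrib_left mult_ac)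
    qed simp
  qed
  also have "\<dots> = ennreal ((1 + e) * g x) * ennreal \<rho>p + R K (\<lambda>x. ennreal (g x)) x"
    by (simp add: R_eq nn_integral_add nn_integral_cmult nn_integral_\<rho>p)
  finally show ?thesis using e \<rho>p_nonneg by (simp add: ennreal_mult)
qed

lemma Dm_upper:
  assumes potter: "\<And>t. x \<le> t \<Longrightarrow> g t \<le> 2 powr a * (t / x) powr b * g x"
  shows "Dm x \<le> ennreal (g x * ((1 + e) * \<rho>m + 2 powr a / b * K powr (b - a)))"
proof -
  let ?c = "2 powr a / b * K powr (b - a)"
  have c: "0 \<le> ?c" using b_pos by simp
  have "Dm x \<le> (\<integral>\<^sup>+\<omega>. ennreal (g x * (1 + e)) * ennreal (A \<omega> powr a * max 0 (- ln (A \<omega>))) + ennreal (g x * ?c) \<partial>M)"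
    unfolding Dm_def
  proof (intro nn_integral_mono)
    fix \<omega> assume "\<omega> \<in> space M"
    then consider "A \<omega> = 0" | "0 < A \<omega>" using A_nonneg by fastforce
    then show "ennreal (A \<omega> powr a) * (window x (x / A \<omega>))
      \<le> ennreal (g x * (1 + e)) * ennreal (A \<omega> powr a * max 0 (- ln (A \<omega>))) + ennreal (g x * ?c)"
    proof cases
      case 2
      have "ennreal (A \<omega> powr a) * (window x (x / A \<omega>))
        \<le> ennreal (A \<omega> powr a) * ennreal (g x * ((1 + e) * max 0 (- ln (A \<omega>)) + ?c * A \<omega> powr (-a)))"
        by (intro mult_left_mono up_window_upper[OF 2 potter]) simp_all
      also have "\<dots> = ennreal (A \<omega> powr a * (g x * ((1 + e) * max 0 (- ln (A \<omega>)) + ?c * A \<omega> powr (-a))))"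
        by (rule ennreal_mult'[symmetric]) simp
      also have "A \<omega> powr a * (g x * ((1 + e) * max 0 (- ln (A \<omega>)) + ?c * A \<omega> powr (-a)))
          = g x * (1 + e) * (A \<omega> powr a * max 0 (- ln (A \<omega>))) + g x * ?c * (A \<omega> powr a * A \<omega> powr (- a))"
        by (simp add: algebra_simps)
      also have "A \<omega> powr a * A \<omega> powr (- a) = 1" using 2 by (simp flip: powr_add)
      also have "ennreal (g x * (1 + e) * (A \<omega> powr a * max 0 (- ln (A \<omega>))) + g x * ?c * 1)
          = ennreal (g x * (1 + e)) * ennreal (A \<omega> powr a * max 0 (- ln (A \<omega>))) + ennreal (g x * ?c)"
      proof -
        have nn: "0 \<le> g x * (1 + e)" "0 \<le> A \<omega> powr a * max 0 (- ln (A \<omega>))" "0 \<le> g x * ?c"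
          using e mult_nonneg_nonneg[OF g_nonneg c] by (simp_all only: g_nonneg) auto
        show ?thesis
          by (simp only: ennreal_plus[OF mult_nonneg_nonneg[OF nn(1,2)] nn(3)] ennreal_mult[OF nn(1,2)] mult_1_right)
      qed
      finally show ?thesis .
    qed simp
  qed
  also have "\<dots> = ennreal (g x * (1 + e)) * ennreal \<rho>m + ennreal (g x * ?c)"
    by (subst nn_integral_add, measurable, subst nn_integral_cmult, measurable, subst nn_integral_\<rho>m)
      (simp add: emeasure_space_1)
  also have "\<dots> = ennreal (g x * ((1 + e) * \<rho>m + ?c))"
  proof -
    have nn: "0 \<le> g x * (1 + e)" "0 \<le> g x * ?c" using e mult_nonneg_nonneg[OF g_nonneg c] by auto
    show ?thesis
      unfolding ennreal_mult[OF nn(1) \<rho>m_nonneg, symmetric]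
        ennreal_plus[OF mult_nonneg_nonneg[OF nn(1) \<rho>m_nonneg] nn(2), symmetric]
      by (simp add: algebra_simps)
  qed
  finally show ?thesis .
qed

end

text \<open>As \<rho> is the difference of \<rho>p and \<rho>m, relative errors in these two numbers
  have to be measured against \<rho>.\<close>

lemma small_window:
  assumes e: "0 < e"
  obtains d where "0 < d" "d < 1" "d * (\<rho>p + \<rho>m) \<le> e * \<rho> / 4"
proof
  define d where "d = min (1 / 2) (e * \<rho> / (4 * (\<rho>p + \<rho>m + 1)))"
  show "0 < d" "d < 1" using e \<rho>_pos \<rho>p_nonneg \<rho>m_nonneg by (auto simp: d_def)
  have "d \<le> e * \<rho> / (4 * (\<rho>p + \<rho>m + 1))" by (simp add: d_def)
  then have "d * (4 * (\<rho>p + \<rho>m + 1)) \<le> e * \<rho>"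
    using \<rho>p_nonneg \<rho>m_nonneg by (subst (asm) pos_le_divide_eq) auto
  then have "4 * (d * (\<rho>p + \<rho>m)) + 4 * d \<le> e * \<rho>" by (simp add: algebra_simps)
  then show "d * (\<rho>p + \<rho>m) \<le> e * \<rho> / 4" using \<open>0 < d\<close> by linarith
qed

text \<open>Here \<open>Dp\<close> is needed from below and \<open>Dm\<close> from above. Large A
  only enlarges \<open>Dp\<close>, and for small A the Potter bound is available, so no error of
  type \<open>R\<close> appears.\<close>

lemma G_super_eventually:
  assumes e: "0 < e" "e < 1"
  shows "\<exists>x0>0. \<forall>x\<ge>x0. P G x + ennreal ((1 - e) * \<rho> * g x) \<le> G x"
proof -
  obtain d where d: "0 < d" "d < 1" "d * (\<rho>p + \<rho>m) \<le> e * \<rho> / 4" using small_window[OF e(1)] .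
  \<comment> \<open>A quarter of the margin e \<rho>. Three errors of this size are paid: the
    factors 1 + d and 1 - d, the truncation \<open>log_tail K\<close>, and the Potter
    remainder.\<close>
  define \<tau> where "\<tau> = e * \<rho> / 4"
  have \<tau>: "0 < \<tau>" using e \<rho>_pos by (simp add: \<tau>_def)
  have h: "d * \<rho>p + d * \<rho>m \<le> \<tau>" "0 < d * \<tau>" "e * \<rho> = 4 * \<tau>" "0 < \<tau>"
    using d \<tau> by (simp_all only: \<tau>_def distrib_left) auto
  have "((\<lambda>K. 2 powr a / b * K powr (b - a)) \<longlongrightarrow> 2 powr a / b * 0) at_top"
    using b_less by (intro tendsto_intros tendsto_neg_powr filterlim_ident) auto
  then have "\<forall>\<^sub>F K in at_top. 2 powr a / b * K powr (b - a) < \<tau>"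
    using \<tau> by (auto dest: order_tendstoD(2))
  with log_tail_small[OF \<tau>] eventually_ge_at_top[of 1]
  have "\<forall>\<^sub>F K in at_top. log_tail K \<le> ennreal \<tau> \<and> 2 powr a / b * K powr (b - a) < \<tau> \<and> 1 \<le> K"
    by eventually_elim auto
  then obtain K where K: "log_tail K \<le> ennreal \<tau>" "2 powr a / b * K powr (b - a) < \<tau>" "1 \<le> K"
    by (auto dest: eventually_happens)
  obtain x1 where x1: "0 < x1" "\<And>x t. x1 \<le> x \<Longrightarrow> x \<le> t \<Longrightarrow> g t \<le> 2 powr a * (t / x) powr b * g x"
    using g_potter[OF b_pos] by auto
  obtain x2 where x2: "\<And>x t. x2 \<le> x \<Longrightarrow> t \<in> {x / K..x * K} \<Longrightarrow> (1 - d) * g x \<le> g t \<and> g t \<le> (1 + d) * g x"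
    using g_uniform[OF K(3) d(1,2)] unfolding eventually_at_top_linorder by blast
  have "P G x + ennreal ((1 - e) * \<rho> * g x) \<le> G x" if "max x1 x2 \<le> x" for x
  proof -
    have x: "0 < x" using that x1(1) by simp
    note unif = x2[of x] and potter = x1(2)[of x]
    let ?c = "ennreal ((1 - d) * g x * \<tau>)"
    have Dm: "Dm x \<le> ennreal (g x * ((1 + d) * \<rho>m + \<tau>))"
      using that K(2) by (intro order_trans[OF Dm_upper[OF x K(3) d(1,2) unif potter]] ennreal_leI mult_left_mono) auto
    have "ennreal ((1 - d) * g x * \<rho>p) \<le> Dp x + ennreal ((1 - d) * g x) * log_tail K"
      using that by (intro Dp_lower[OF x K(3) d(1,2) unif]) auto
    also have "\<dots> \<le> Dp x + ennreal ((1 - d) * g x) * ennreal \<tau>"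
      by (intro add_left_mono mult_left_mono K) auto
    finally have Dp: "ennreal ((1 - d) * g x * \<rho>p) \<le> Dp x + ?c"
      using d \<tau> by (simp add: ennreal_mult)
    have num: "(1 - e) * \<rho> + ((1 + d) * \<rho>m + \<tau>) + (1 - d) * \<tau> \<le> (1 - d) * \<rho>p"
        unfolding left_diff_distrib distrib_right mult_1_left using h \<rho>_eq by linarith
    have "(Dm x + ?c) + (P G x + ennreal ((1 - e) * \<rho> * g x))
        = P G x + (ennreal ((1 - e) * \<rho> * g x) + Dm x + ?c)" by (simp add: ac_simps)
    also have "\<dots> \<le> P G x + (ennreal ((1 - e) * \<rho> * g x) + ennreal (g x * ((1 + d) * \<rho>m + \<tau>)) + ?c)"
      by (intro add_left_mono add_right_mono Dm)
    also have "ennreal ((1 - e) * \<rho> * g x) + ennreal (g x * ((1 + d) * \<rho>m + \<tau>)) + ?c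
        = ennreal (g x * ((1 - e) * \<rho> + ((1 + d) * \<rho>m + \<tau>) + (1 - d) * \<tau>))"
    proof -
      have nn: "0 \<le> (1 - e) * \<rho> * g x" "0 \<le> g x * ((1 + d) * \<rho>m + \<tau>)" "0 \<le> (1 - d) * g x * \<tau>"
        using e d \<tau> \<rho>_pos \<rho>m_nonneg by (auto intro!: mult_nonneg_nonneg add_nonneg_nonneg)
      show ?thesis
        unfolding ennreal_plus[OF nn(1,2), symmetric] ennreal_plus[OF add_nonneg_nonneg[OF nn(1,2)] nn(3), symmetric]
        by (simp add: algebra_simps)
    qed
    also have "P G x + \<dots> \<le> P G x + ennreal (g x * ((1 - d) * \<rho>p))"
      by (intro add_left_mono ennreal_leI mult_left_mono num) simp
    also have "\<dots> \<le> P G x + (Dp x + ?c)"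
      using Dp by (intro add_left_mono) (simp add: mult_ac)
    also have "\<dots> = (Dm x + ?c) + G x"
      using G_identity[OF x] by (simp add: ac_simps)
    finally show ?thesis
      using Dm_finite[OF x] by (subst (asm) ennreal_add_left_cancel_le) auto
  qed
  then show ?thesis using x1(1) by (intro exI[of _ "max x1 x2"]) auto
qed

text \<open>Now \<open>Dp\<close> is needed from above, and the part with large A survives as
  \<open>R K\<close>. The statement is kept for all large K, since K has to be chosen later so that
  \<open>log_tail K\<close> is small as well.\<close>

lemma G_sub_eventually:
  assumes e: "0 < e" "e < 1"
  shows "\<forall>\<^sub>F K in at_top. \<exists>x0>0. \<forall>x\<ge>x0.
    G x \<le> P G x + (ennreal ((1 + e) * \<rho> * g x) + R K (\<lambda>x. ennreal (g x)) x)"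
proof -
  obtain d where d: "0 < d" "d < 1" "d * (\<rho>p + \<rho>m) \<le> e * \<rho> / 4" using small_window[OF e(1)] .
  define \<tau> where "\<tau> = e * \<rho> / 4"
  have \<tau>: "0 < \<tau>" using e \<rho>_pos by (simp add: \<tau>_def)
  have h: "d * \<rho>p + d * \<rho>m \<le> \<tau>" "0 < d * \<tau>" "e * \<rho> = 4 * \<tau>" "0 < \<tau>"
    using d \<tau> by (simp_all only: \<tau>_def distrib_left) auto
  show ?thesis using log_tail_small[OF \<tau>] eventually_ge_at_top[of 1]
  proof eventually_elim
    case (elim K)
    obtain x2 where x2: "\<And>x t. x2 \<le> x \<Longrightarrow> t \<in> {x / K..x * K} \<Longrightarrow> (1 - d) * g x \<le> g t \<and> g t \<le> (1 + d) * g x"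
      using g_uniform[OF elim(2) d(1,2)] unfolding eventually_at_top_linorder by blast
    have "G x \<le> P G x + (ennreal ((1 + e) * \<rho> * g x) + R K (\<lambda>x. ennreal (g x)) x)" if "max 1 x2 \<le> x" for x
    proof -
      have x: "0 < x" using that by simp
      note unif = x2[of x]
      let ?c = "ennreal ((1 - d) * g x * \<tau>)" and ?R = "R K (\<lambda>x. ennreal (g x)) x"
      have Dp: "Dp x \<le> ennreal ((1 + d) * g x * \<rho>p) + ?R"
        using that by (intro Dp_upper[OF x elim(2) d(1,2) unif]) auto
      have "ennreal ((1 - d) * g x * \<rho>m) \<le> Dm x + ennreal ((1 - d) * g x) * log_tail K"
        using that by (intro Dm_lower[OF x elim(2) d(1,2) unif]) auto
      also have "\<dots> \<le> Dm x + ennreal ((1 - d) * g x) * ennreal \<tau>"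
        by (intro add_left_mono mult_left_mono elim) auto
      finally have Dm: "ennreal ((1 - d) * g x * \<rho>m) \<le> Dm x + ?c"
        using d \<tau> by (simp add: ennreal_mult)
      have num: "(1 + d) * \<rho>p + (1 - d) * \<tau> \<le> (1 + e) * \<rho> + (1 - d) * \<rho>m"
        unfolding left_diff_distrib distrib_right mult_1_left using h \<rho>_eq by linarith
      have "(Dm x + ?c) + G x = P G x + Dp x + ?c"
        using G_identity[OF x] by (simp add: ac_simps)
      also have "\<dots> \<le> P G x + (ennreal ((1 + d) * g x * \<rho>p) + ?R) + ?c"
        by (intro add_left_mono add_right_mono Dp)
      also have "\<dots> = P G x + ?R + (ennreal ((1 + d) * g x * \<rho>p) + ?c)" by (simp add: ac_simps)
      also have "ennreal ((1 + d) * g x * \<rho>p) + ?c = ennreal (g x * ((1 + d) * \<rho>p + (1 - d) * \<tau>))"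
      proof -
        have nn: "0 \<le> (1 + d) * g x * \<rho>p" "0 \<le> (1 - d) * g x * \<tau>"
          using d \<tau> \<rho>p_nonneg by (auto intro!: mult_nonneg_nonneg add_nonneg_nonneg)
        show ?thesis unfolding ennreal_plus[OF nn, symmetric] by (simp add: algebra_simps)
      qed
      also have "P G x + ?R + \<dots> \<le> P G x + ?R + ennreal (g x * ((1 + e) * \<rho> + (1 - d) * \<rho>m))"
        by (intro add_left_mono ennreal_leI mult_left_mono num) simp
      also have "ennreal (g x * ((1 + e) * \<rho> + (1 - d) * \<rho>m))
          = ennreal ((1 + e) * \<rho> * g x) + ennreal ((1 - d) * g x * \<rho>m)"
        using e d \<rho>_pos \<rho>m_nonneg by (subst ennreal_plus[symmetric]) (auto simp: distrib_left mult_ac)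
      also have "P G x + ?R + \<dots> \<le> P G x + ?R + (ennreal ((1 + e) * \<rho> * g x) + (Dm x + ?c))"
        by (intro add_left_mono Dm)
      also have "\<dots> = (Dm x + ?c) + (P G x + (ennreal ((1 + e) * \<rho> * g x) + ?R))"
        by (simp add: ac_simps)
      finally show ?thesis
        using Dm_finite[OF x] by (subst (asm) ennreal_add_left_cancel_le) auto
    qed
    then show ?case by (intro exI[of _ "max 1 x2"]) auto
  qed
qed

end

section \<open>Tails of the stationary law\<close>

lemma nn_integral_haar_powr_tail:
  assumes "0 < p"
  shows "(\<integral>\<^sup>+t. ennreal (t powr (- p)) * indicator {1..} t \<partial>haar) = ennreal (1 / p)"
proof -
  have "(\<integral>\<^sup>+t. ennreal (t powr (- p)) * indicator {1..} t \<partial>haar)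
      = (\<integral>\<^sup>+t. ennreal (t powr (- p - 1)) * indicator {1..} t \<partial>lborel)"
    by (simp add: nn_integral_haar, intro nn_integral_cong)
      (auto simp: indicator_def powr_diff simp flip: ennreal_mult)
  also have "\<dots> = ennreal (0 - (- (1 powr (- p) / p)))"
  proof (rule nn_integral_FTC_atLeast)
    show "DERIV (\<lambda>t. - (t powr (- p) / p)) t :> t powr (- p - 1)" if "1 \<le> t" for t
      using that assms by (auto intro!: derivative_eq_intros simp: powr_diff)
    have "((\<lambda>t. t powr (- p)) \<longlongrightarrow> 0) at_top"
      using assms by (intro tendsto_neg_powr filterlim_ident) auto
    then have "((\<lambda>t. - (t powr (- p) / p)) \<longlongrightarrow> - (0 / p)) at_top"
      using assms by (intro tendsto_intros) auto
    then show "((\<lambda>t. - (t powr (- p) / p)) \<longlongrightarrow> 0) at_top" by simp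
  qed auto
  finally show ?thesis by simp
qed

lemma (in prob_space) tail_tendsto_0:
  fixes Y :: "'a \<Rightarrow> real"
  assumes [measurable]: "Y \<in> borel_measurable M" and e: "0 < e"
  shows "\<exists>R>0. \<forall>x\<ge>R. prob {\<omega> \<in> space M. x < Y \<omega>} \<le> e"
proof -
  have "(\<lambda>n. prob {\<omega> \<in> space M. real n < Y \<omega>}) \<longlonglongrightarrow> prob (\<Inter>n. {\<omega> \<in> space M. real n < Y \<omega>})"
    by (rule finite_Lim_measure_decseq) (auto intro!: decseq_SucI)
  moreover have "(\<Inter>n. {\<omega> \<in> space M. real n < Y \<omega>}) = {}"
    by (auto simp: not_less) (metis linorder_not_less real_arch_simple)
  ultimately have "(\<lambda>n. prob {\<omega> \<in> space M. real n < Y \<omega>}) \<longlonglongrightarrow> 0" by simp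
  from order_tendstoD(2)[OF this e] obtain n where "prob {\<omega> \<in> space M. real n < Y \<omega>} < e"
    by (auto simp: eventually_sequentially)
  moreover have "prob {\<omega> \<in> space M. x < Y \<omega>} \<le> prob {\<omega> \<in> space M. real n < Y \<omega>}" if "real n \<le> x" for x
    using that by (intro finite_measure_mono) auto
  ultimately show ?thesis by (intro exI[of _ "max 1 (real n)"]) (auto intro: order_trans less_imp_le)
qed

section \<open>The tail of a law under the random dilation\<close>

locale dilation_law = dilation M A a + mu: prob_space \<mu>
  for M :: "'a measure" and A a and \<mu> :: "real measure" +
  assumes sets_mu [measurable_cong]: "sets \<mu> = sets borel"
begin

definition "T x = measure \<mu> {x<..}"

definition "f x = ennreal (x powr a * T x)"

lemma space_mu [simp]: "space \<mu> = UNIV"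
  using sets_eq_imp_space_eq[OF sets_mu] by simp

lemma T_antimono: "x \<le> y \<Longrightarrow> T y \<le> T x"
  unfolding T_def by (intro mu.finite_measure_mono) auto

lemma T_bounds [simp]: "0 \<le> T x" "T x \<le> 1"
  by (auto simp: T_def)

lemma T_measurable [measurable]: "T \<in> borel_measurable borel"
  by (intro borel_measurable_antimono antimonoI T_antimono)

lemma f_measurable [measurable]: "f \<in> borel_measurable borel"
  unfolding f_def by measurable

abbreviation "Z \<equiv> M \<Otimes>\<^sub>M \<mu>"

text \<open>Conditioning on A: up to the factor x^a, \<open>P f x\<close> is the probability that A
  times an independent \<mu>-distributed variable exceeds x. This turns set inclusions on the
  product space into inequalities for \<open>f\<close>.\<close>

lemma P_f:
  assumes x: "0 < x"
  shows "P f x = ennreal (x powr a) * emeasure (Z) {z \<in> space (Z). x < A (fst z) * snd z}"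
proof -
  have "emeasure (Z) {z \<in> space (Z). x < A (fst z) * snd z}
      = (\<integral>\<^sup>+\<omega>. emeasure \<mu> (Pair \<omega> -` {z \<in> space (Z). x < A (fst z) * snd z}) \<partial>M)"
    by (rule mu.emeasure_pair_measure_alt) measurable
  then have "ennreal (x powr a) * emeasure (Z) {z \<in> space (Z). x < A (fst z) * snd z}
      = (\<integral>\<^sup>+\<omega>. ennreal (x powr a) * emeasure \<mu> (Pair \<omega> -` {z \<in> space (Z). x < A (fst z) * snd z}) \<partial>M)"
    by (simp, intro nn_integral_cmult[symmetric] mu.measurable_emeasure_Pair) measurable
  also have "\<dots> = P f x"
    unfolding P_def
  proof (intro nn_integral_cong)
    fix \<omega> assume \<omega>: "\<omega> \<in> space M"
    then consider "A \<omega> = 0" | "0 < A \<omega>" using A_nonneg by fastforce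
    then show "ennreal (x powr a) * emeasure \<mu> (Pair \<omega> -` {z \<in> space (Z). x < A (fst z) * snd z})
        = ennreal (A \<omega> powr a) * f (x / A \<omega>)"
    proof cases
      case 1
      then have "Pair \<omega> -` {z \<in> space (Z). x < A (fst z) * snd z} = {}" using x by auto
      then show ?thesis using 1 by (simp only:) simp
    next
      case 2
      then have "Pair \<omega> -` {z \<in> space (Z). x < A (fst z) * snd z} = {x / A \<omega><..}"
        using \<omega> by (auto simp: space_pair_measure divide_less_eq mult.commute)
      then show ?thesis
        using 2 x by (simp add: f_def T_def mu.emeasure_eq_measure powr_divide flip: ennreal_mult)
    qed
  qed
  finally show ?thesis by simp
qed

end

locale perpetuity = renewal_kernel M A a b q + dilation_law M A a \<mu>
  for M :: "'a measure" and A a b q \<mu> +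
  assumes mu_nonneg: "AE y in \<mu>. 0 \<le> y"
    and mom_less_1: "\<And>p. 0 < p \<Longrightarrow> p < a \<Longrightarrow> mom p < 1"
begin

lemma nn_integral_product:
  assumes [measurable]: "h \<in> borel_measurable M" "k \<in> borel_measurable borel"
  shows "(\<integral>\<^sup>+z. h (fst z) * k (snd z) \<partial>Z) = (\<integral>\<^sup>+\<omega>. h \<omega> \<partial>M) * (\<integral>\<^sup>+y. k y \<partial>\<mu> :: ennreal)"
  by (subst mu.nn_integral_fst[symmetric]) (auto simp: nn_integral_cmult nn_integral_multc)

text \<open>A supersolution inequality that fails only on small arguments, by at most C x^b, is
  repaired at the cost of a bounded summand. Asymptotic inequalities thus become global ones, as the
  comparison principle requires.\<close>

lemma supersol_patch:
  assumes u [measurable]: "u \<in> borel_measurable borel" and x0: "0 < x0" and C: "0 \<le> C"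
    and le: "\<And>x. 0 < x \<Longrightarrow> P u x + s x \<le> u x + ennreal (C * x powr b) * indicator {..x0} x"
  obtains E c where "E \<in> borel_measurable borel" "0 \<le> c" "\<And>x. E x \<le> ennreal c"
    "supersol (\<lambda>x. u x + E x) s"
proof -
  obtain E c where E: "E \<in> borel_measurable borel" "0 \<le> c" "\<And>x. E x \<le> ennreal c"
      "supersol E (\<lambda>x. ennreal (C * x powr b) * indicator {..x0} x)"
    using bounded_supersol_near_0[OF x0 C] by blast
  have "supersol (\<lambda>x. u x + E x) s"
    unfolding supersol_def
  proof (intro allI impI)
    fix x :: real assume x: "0 < x"
    have "P (\<lambda>x. u x + E x) x + s x = (P u x + s x) + P E x"
      unfolding P_add[OF u E(1)] by (simp add: ac_simps)
    also have "\<dots> \<le> (u x + ennreal (C * x powr b) * indicator {..x0} x) + P E x"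
      by (intro add_right_mono le x)
    also have "\<dots> = u x + (P E x + ennreal (C * x powr b) * indicator {..x0} x)" by (simp add: ac_simps)
    also have "\<dots> \<le> u x + E x"
      using E(4) x unfolding supersol_def by (intro add_left_mono) auto
    finally show "P (\<lambda>x. u x + E x) x + s x \<le> u x + E x" .
  qed
  with E(1-3) show thesis by (rule that)
qed

text \<open>Log-uniform average over the arguments between x u and x v. Below, the window lies to
  the left of x for the upper bound and to the right of x for the lower bound.\<close>

definition smooth :: "real \<Rightarrow> real \<Rightarrow> (real \<Rightarrow> ennreal) \<Rightarrow> real \<Rightarrow> ennreal" where
  "smooth u v = mix haar (\<lambda>s. ennreal (1 / ln (v / u)) * indicator {u..v} s) (\<lambda>s. s)"

context
  fixes u v :: real
  assumes uv: "0 < u" "u < v"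
begin

lemma smooth_facts:
  "sigma_finite_measure haar"
  "(\<lambda>s. ennreal (1 / ln (v / u)) * indicator {u..v} s) \<in> borel_measurable haar"
  "(\<lambda>s. s) \<in> borel_measurable haar"
  "AE s in haar. 0 < s"
  using sigma_finite_haar AE_haar_pos by auto

lemmas smooth_measurable = mix_measurable[OF smooth_facts, folded smooth_def]
  and smooth_mono = mix_mono[OF smooth_facts, folded smooth_def]
  and smooth_add = mix_add[OF smooth_facts, folded smooth_def]
  and smooth_subsol = subsol_mix[OF smooth_facts, folded smooth_def]
  and P_smooth = P_mix[OF smooth_facts, folded smooth_def]

lemma smooth_const: "smooth u v (\<lambda>_. c) x = c"
proof -
  have l: "0 < ln (v / u)" using uv by simp
  have "smooth u v (\<lambda>_. c) x = ennreal (1 / ln (v / u)) * c * (\<integral>\<^sup>+s. indicator {u..v} s \<partial>haar)"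
    unfolding smooth_def mix_def
    by (subst nn_integral_cmult[symmetric]) (auto intro!: nn_integral_cong simp: mult_ac)
  also have "\<dots> = c * (ennreal (1 / ln (v / u)) * ennreal (ln (v / u)))"
    using uv by (subst nn_integral_haar_Icc) (auto simp: mult_ac)
  also have "ennreal (1 / ln (v / u)) * ennreal (ln (v / u)) = 1"
    using l by (simp flip: ennreal_mult)
  finally show ?thesis by simp
qed

lemma smooth_le:
  assumes "\<And>s. u \<le> s \<Longrightarrow> s \<le> v \<Longrightarrow> h (x * s) \<le> c"
  shows "smooth u v h x \<le> c"
proof -
  have "smooth u v h x \<le> smooth u v (\<lambda>_. c) x"
    unfolding smooth_def mix_def using assms
    by (intro nn_integral_mono) (auto simp: indicator_def intro!: mult_left_mono)
  then show ?thesis by (simp add: smooth_const)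
qed

lemma smooth_ge:
  assumes "\<And>s. u \<le> s \<Longrightarrow> s \<le> v \<Longrightarrow> c \<le> h (x * s)"
  shows "c \<le> smooth u v h x"
proof -
  have "smooth u v (\<lambda>_. c) x \<le> smooth u v h x"
    unfolding smooth_def mix_def using assms
    by (intro nn_integral_mono) (auto simp: indicator_def intro!: mult_left_mono)
  then show ?thesis by (simp add: smooth_const)
qed

lemma smooth_le_window:
  assumes [measurable]: "\<psi> \<in> borel_measurable borel"
    and l: "1 / l \<le> u" "v \<le> l" and x: "0 < x"
  shows "smooth u v \<psi> x
    \<le> (\<integral>\<^sup>+t. ennreal (1 / ln (v / u)) * \<psi> t * indicator {x / l..x * l} t \<partial>haar)"
proof -
  have "0 < l" using l uv by linarith
  have "smooth u v \<psi> x \<le> (\<integral>\<^sup>+s. ennreal (1 / ln (v / u)) * \<psi> (x * s) * indicator {x / l..x * l} (x * s) \<partial>haar)"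
    unfolding smooth_def mix_def
  proof (intro nn_integral_mono)
    fix s
    have "x * s \<in> {x / l..x * l}" if s: "s \<in> {u..v}"
    proof -
      have "x * (1 / l) \<le> x * s" "x * s \<le> x * l" using s l x by (intro mult_left_mono; simp)+
      then show ?thesis by simp
    qed
    then show "ennreal (1 / ln (v / u)) * indicator {u..v} s * \<psi> (x * s)
        \<le> ennreal (1 / ln (v / u)) * \<psi> (x * s) * indicator {x / l..x * l} (x * s)"
      by (auto simp: indicator_def)
  qed
  also have "\<dots> = (\<integral>\<^sup>+t. ennreal (1 / ln (v / u)) * \<psi> t * indicator {x / l..x * l} t \<partial>haar)"
    by (rule nn_integral_haar_scale[OF _ x, of "\<lambda>t. ennreal (1 / ln (v / u)) * \<psi> t * indicator {x / l..x * l} t"])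
      measurable
  finally show ?thesis .
qed

end

lemma bounded_supersol_smooth:
  assumes uv: "0 < u" "u < v" and [measurable]: "\<psi> \<in> borel_measurable borel"
    and fin: "(\<integral>\<^sup>+t. \<psi> t \<partial>haar) < \<infinity>"
  obtains V c where "V \<in> borel_measurable borel" "0 \<le> c" "\<And>x. V x \<le> ennreal c"
    "supersol V (smooth u v \<psi>)"
proof -
  define l where "l = max 1 (max v (1 / u))"
  have l: "1 \<le> l" "v \<le> l" "1 / u \<le> l" by (auto simp: l_def)
  then have "1 / l \<le> u" using uv by (simp add: divide_simps mult.commute)
  have m: "(\<lambda>t. ennreal (1 / ln (v / u)) * \<psi> t) \<in> borel_measurable borel" by measurable
  have fin': "(\<integral>\<^sup>+t. ennreal (1 / ln (v / u)) * \<psi> t \<partial>haar) < \<infinity>"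
    using fin by (simp add: nn_integral_cmult ennreal_mult_less_top)
  obtain V c where V: "V \<in> borel_measurable borel" "0 \<le> c" "\<And>x. V x \<le> ennreal c"
    "supersol V (\<lambda>x. \<integral>\<^sup>+t. ennreal (1 / ln (v / u)) * \<psi> t * indicator {x / l..x * l} t \<partial>haar)"
    using bounded_supersol_window[OF m fin' l(1)] by blast
  from supersol_mono[OF V(4)] smooth_le_window[OF uv assms(3) \<open>1 / l \<le> u\<close> l(2)]
  have "supersol V (smooth u v \<psi>)" by blast
  with V(1-3) show thesis by (rule that)
qed

text \<open>\<open>T\<close> decreases, so f(x s) is at least s^a f(x) for s \<le> 1. Averaging to
  the left of x therefore loses at most the factor l^a, which is close to 1 when l is.\<close>

lemma f_le_smooth:
  assumes x: "0 < x" and l: "1 < l"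
  shows "f x \<le> ennreal (l powr a) * smooth (1 / l) 1 f x"
proof -
  have "f x = ennreal (l powr a) * (ennreal (l powr (- a)) * f x)"
    using l by (simp add: f_def powr_minus flip: ennreal_mult)
  also have "\<dots> \<le> ennreal (l powr a) * smooth (1 / l) 1 f x"
  proof (intro mult_left_mono smooth_ge)
    fix s assume s: "1 / l \<le> s" "s \<le> 1"
    then have s0: "0 < s" using l by (auto intro: less_le_trans[of 0 "1 / l"])
    have "l powr (- a) \<le> s powr a"
      using powr_mono2[of a "1 / l" s] s l b_pos b_less by (simp add: powr_divide powr_minus inverse_eq_divide)
    moreover have "T x \<le> T (x * s)" using s x by (intro T_antimono) (simp add: mult_le_cancel_left1)
    ultimately have "l powr (- a) * (x powr a * T x) \<le> s powr a * (x powr a * T (x * s))"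
      by (intro mult_mono) auto
    then show "ennreal (l powr (- a)) * f x \<le> f (x * s)"
      using x s0 by (simp add: f_def powr_mult mult_ac flip: ennreal_mult)
  qed (use l in auto)
  finally show ?thesis .
qed

lemma smooth_le_f:
  assumes x: "0 < x" and l: "1 < l"
  shows "smooth 1 l f x \<le> ennreal (l powr a) * f x"
proof (rule smooth_le)
  fix s assume s: "1 \<le> s" "s \<le> l"
  have "s powr a \<le> l powr a" using s b_pos b_less by (intro powr_mono2) auto
  moreover have "T (x * s) \<le> T x" using s x by (intro T_antimono) (simp add: mult_le_cancel_left1)
  ultimately have "s powr a * (x powr a * T (x * s)) \<le> l powr a * (x powr a * T x)"
    by (intro mult_mono) auto
  then show "f (x * s) \<le> ennreal (l powr a) * f x"
    using x s by (simp add: f_def powr_mult mult_ac flip: ennreal_mult)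
qed (use l in auto)

lemma emeasure_fst:
  assumes [measurable]: "Measurable.pred M Q"
  shows "emeasure (Z) {z \<in> space (Z). Q (fst z)} = emeasure M {\<omega> \<in> space M. Q \<omega>}"
proof -
  have "{z \<in> space (Z). Q (fst z)} = {\<omega> \<in> space M. Q \<omega>} \<times> space \<mu>"
    by (auto simp: space_pair_measure)
  then show ?thesis
    by (simp only:) (subst mu.emeasure_pair_measure_Times, auto simp: mu.emeasure_space_1[simplified])
qed

text \<open>If A y + B exceeds x, then A y > c x or B > (1 - c) x. The first event gives
  \<open>T\<close> as a subsolution for the dilation A/c at exponent 0, where x^(-p) is an
  eigenfunction. Since E[A^p] < 1 there is room for some c < 1 that keeps the eigenvalue below
  1.\<close>

lemma tail_le_powr:
  assumes B [measurable]: "B \<in> borel_measurable M"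
    and upper: "\<And>x. 0 < x \<Longrightarrow> emeasure \<mu> {x<..}
      \<le> emeasure (Z) {z \<in> space (Z). x < A (fst z) * snd z + B (fst z)}"
    and B_tail: "\<exists>C\<ge>0. \<forall>x>0. prob {\<omega> \<in> space M. x < B \<omega>} \<le> C * x powr (- p)"
    and p: "0 < p" "p < a"
  shows "\<exists>C\<ge>0. \<forall>x>0. T x \<le> C * x powr (- p)"
proof -
  obtain m where m: "mom p = ennreal m" "0 \<le> m" "m < 1"
    using mom_less_1[OF p] by (cases "mom p") (auto simp: ennreal_less_one_iff)
  \<comment> \<open>Chosen so that c^p is the midpoint of m and 1; the eigenvalue of the enlarged
    dilation is then m / c^p = q' < 1.\<close>
  define c where "c = ((1 + m) / 2) powr (1 / p)"
  have c_powr: "c powr p = (1 + m) / 2" using m p by (simp add: c_def powr_powr)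
  have c: "0 < c" "c < 1"
    using m p powr_less_mono2[of "1 / p" "(1 + m) / 2" 1] by (auto simp: c_def)
  define q' where "q' = 2 * m / (1 + m)"
  have q': "0 \<le> q'" "q' < 1" using m by (auto simp: q'_def divide_less_eq)
  interpret D: dilation_law M "\<lambda>\<omega>. A \<omega> / c" 0 \<mu>
    by unfold_locales (use A_nonneg c sets_mu in auto)
  have Df: "D.f x = ennreal (T x)" if "0 < x" for x
    using that by (simp add: D.f_def D.T_def T_def)
  obtain CB where CB: "0 \<le> CB" "\<And>x. 0 < x \<Longrightarrow> prob {\<omega> \<in> space M. x < B \<omega>} \<le> CB * x powr (- p)"
    using B_tail by auto
  \<comment> \<open>Solves C q' + CB (1 - c)^(-p) = C, which makes C x^(-p) an exact solution for
    the power bound of the source.\<close>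
  define C where "C = CB * (1 - c) powr (- p) / (1 - q')"
  have C: "0 \<le> C" using CB q' by (simp add: C_def)
  let ?s = "\<lambda>x. ennreal (prob {\<omega> \<in> space M. (1 - c) * x < B \<omega>})"
  have mom_p: "D.mom p = ennreal q'"
  proof -
    have "D.mom p = (\<integral>\<^sup>+\<omega>. ennreal (2 / (1 + m)) * ennreal (A \<omega> powr p) \<partial>M)"
      unfolding D.mom_def using A_nonneg c m
      by (intro nn_integral_cong) (auto simp: powr_divide c_powr simp flip: ennreal_mult)
    also have "\<dots> = ennreal (2 / (1 + m)) * mom p" unfolding mom_def by (rule nn_integral_cmult) measurable
    also have "\<dots> = ennreal q'" using m by (simp add: q'_def flip: ennreal_mult)
    finally show ?thesis .
  qed
  \<comment> \<open>With \<open>0 powr 0 = 0\<close> the moment of order 0 is the probability of A >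
    0, hence at most 1.\<close>
  have mom_0: "D.mom 0 \<le> 1"
  proof -
    have "D.mom 0 \<le> (\<integral>\<^sup>+\<omega>. 1 \<partial>M)"
      unfolding D.mom_def by (intro nn_integral_mono) simp
    then show ?thesis by (simp add: emeasure_space_1)
  qed
  have sub: "D.subsol D.f ?s"
    unfolding D.subsol_def
  proof (intro allI impI)
    fix x :: real assume x: "0 < x"
    have "D.f x = emeasure \<mu> {x<..}" using x by (simp add: Df T_def mu.emeasure_eq_measure)
    also have "\<dots> \<le> emeasure (Z) {z \<in> space (Z). x < A (fst z) * snd z + B (fst z)}"
      by (rule upper[OF x])
    also have "\<dots> \<le> emeasure (Z) ({z \<in> space (Z). x < A (fst z) / c * snd z}
        \<union> {z \<in> space (Z). (1 - c) * x < B (fst z)})"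
    proof (intro emeasure_mono)
      show "{z \<in> space (Z). x < A (fst z) * snd z + B (fst z)}
        \<subseteq> {z \<in> space (Z). x < A (fst z) / c * snd z} \<union> {z \<in> space (Z). (1 - c) * x < B (fst z)}"
        using c by (auto simp: field_simps)
    qed measurable
    also have "\<dots> \<le> emeasure (Z) {z \<in> space (Z). x < A (fst z) / c * snd z}
        + emeasure (Z) {z \<in> space (Z). (1 - c) * x < B (fst z)}"
      by (rule emeasure_subadditive) measurable
    also have "\<dots> = D.P D.f x + ?s x"
      using x by (subst emeasure_fst[of "\<lambda>\<omega>. (1 - c) * x < B \<omega>"]) (auto simp: D.P_f emeasure_eq_measure)
    finally show "D.f x \<le> D.P D.f x + ?s x" .
  qed
  have super: "D.supersol (\<lambda>x. ennreal C * ennreal (x powr (- p))) ?s"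
    unfolding D.supersol_def
  proof (intro allI impI)
    fix x :: real assume x: "0 < x"
    have "D.P (\<lambda>x. ennreal C * ennreal (x powr (- p))) x = ennreal (C * q' * x powr (- p))"
    proof -
      have "D.P (\<lambda>x. ennreal C * ennreal (x powr (- p))) x = ennreal C * D.P (\<lambda>x. ennreal (x powr (- p))) x"
        by (rule D.P_cmult) measurable
      also have "\<dots> = ennreal C * (ennreal (x powr (- p)) * ennreal q')"
        using D.P_powr[OF x, of "- p"] mom_p by simp
      finally show ?thesis using C q' by (simp add: mult_ac flip: ennreal_mult)
    qed
    moreover have "?s x \<le> ennreal (CB * ((1 - c) * x) powr (- p))"
      using x c by (intro ennreal_leI CB) auto
    moreover have "CB * ((1 - c) * x) powr (- p) = C * (1 - q') * x powr (- p)"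
      using x c q' by (simp add: C_def powr_mult)
    ultimately have "D.P (\<lambda>x. ennreal C * ennreal (x powr (- p))) x + ?s x
        \<le> ennreal (C * q' * x powr (- p)) + ennreal (C * (1 - q') * x powr (- p))"
      by (simp only: add_left_mono)
    also have "\<dots> = ennreal (C * q' * x powr (- p) + C * (1 - q') * x powr (- p))"
      using C q' by (intro ennreal_plus[symmetric]) auto
    also have "\<dots> = ennreal C * ennreal (x powr (- p))"
      using C by (simp add: algebra_simps flip: ennreal_mult)
    finally show "D.P (\<lambda>x. ennreal C * ennreal (x powr (- p))) x + ?s x \<le> ennreal C * ennreal (x powr (- p))" .
  qed
  have "T x \<le> C * x powr (- p)" if x: "0 < x" for x
  proof -
    have "D.f x \<le> ennreal C * ennreal (x powr (- p))"
    proof (rule D.comparison[OF _ _ sub super _ mom_0, where b = "- p" and q = q'])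
      show "D.mom (0 - - p) \<le> ennreal q'" by (simp add: mom_p)
      fix e :: real assume e: "0 < e"
      \<comment> \<open>Beyond R the tail is at most e; before R the trivial bound 1 is at most
        (R/x)^p. No decay rate for \<open>T\<close> is presupposed.\<close>
      obtain R where R: "0 < R" "\<And>x. R \<le> x \<Longrightarrow> T x \<le> e"
        using mu.tail_tendsto_0[of "\<lambda>y. y" e] e by (auto simp: T_def greaterThan_def measurable_ident_sets[OF sets_mu])
      have "D.f x \<le> ennreal (e + R powr p * x powr (- p))" if x: "0 < x" for x
      proof (cases "R \<le> x")
        case True
        then show ?thesis using R(2)[OF True] x by (auto simp: Df intro!: ennreal_leI add_increasing2)
      next
        case False
        have "1 \<le> (R / x) powr p" using False x p by (intro ge_one_powr_ge_zero) auto
        also have "\<dots> = R powr p * x powr (- p)" using R x by (simp add: powr_divide powr_minus_divide)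
        finally have "T x \<le> e + R powr p * x powr (- p)" using e by (intro order_trans[OF T_bounds(2)]) auto
        then show ?thesis using x by (simp add: Df ennreal_leI)
      qed
      then show "\<exists>C\<ge>0. \<forall>x>0. D.f x \<le> ennreal (e + C * x powr (- p))" by (intro exI[of _ "R powr p"]) auto
    qed (use x q' in \<open>auto simp: ennreal_mult_less_top\<close>)
    then have "ennreal (T x) \<le> ennreal (C * x powr (- p))" using x C by (simp add: Df ennreal_mult)
    then show ?thesis using C by (subst (asm) ennreal_le_iff) auto
  qed
  then show ?thesis using C by blast
qed

lemma moment_finite:
  assumes tail: "\<exists>C\<ge>0. \<forall>x>0. T x \<le> C * x powr (- p)" and r: "0 < r" "r < p"
  shows "(\<integral>\<^sup>+y. ennreal (max 0 y powr r) \<partial>\<mu>) < \<infinity>"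
proof -
  obtain C where C: "0 \<le> C" "\<And>x. 0 < x \<Longrightarrow> T x \<le> C * x powr (- p)" using tail by auto
  have meas: "(\<lambda>y. y) \<in> borel_measurable \<mu>" by (simp add: measurable_ident_sets[OF sets_mu])
  have eq: "(\<integral>\<^sup>+y. ennreal (max 0 y powr r) \<partial>\<mu>) = ennreal r * (\<integral>\<^sup>+t. ennreal (t powr r * T t) \<partial>haar)"
    using mu.nn_integral_powr_eq_tail[OF meas r(1)] by (simp add: T_def greaterThan_def)
  have "(\<integral>\<^sup>+t. ennreal (t powr r * T t) \<partial>haar)
      \<le> (\<integral>\<^sup>+t. ennreal (t powr r) * indicator {..1} t
          + ennreal C * (ennreal (t powr (- (p - r))) * indicator {1..} t) \<partial>haar)"
  proof (rule nn_integral_mono_AE, rule AE_mp[OF AE_haar_pos], rule AE_I2, rule impI)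
    fix t :: real assume t: "0 < t"
    show "ennreal (t powr r * T t) \<le> ennreal (t powr r) * indicator {..1} t
          + ennreal C * (ennreal (t powr (- (p - r))) * indicator {1..} t)"
    proof (cases "t \<le> 1")
      case True
      have "t powr r * T t \<le> t powr r" by (simp add: mult_left_le)
      then show ?thesis using True by (simp add: add_increasing2 ennreal_leI)
    next
      case False
      have "t powr r * T t \<le> t powr r * (C * t powr (- p))" using C(2)[OF t] by (intro mult_left_mono) auto
      also have "\<dots> = C * t powr (- (p - r))" by (simp add: powr_diff powr_minus divide_inverse)
      finally show ?thesis using False C by (simp add: ennreal_leI flip: ennreal_mult)
    qed
  qed
  also have "\<dots> = ennreal (1 / r) + ennreal C * ennreal (1 / (p - r))"
  proof -
    have "(\<integral>\<^sup>+t. ennreal (t powr r) * indicator {..1} t \<partial>haar) = ennreal (1 / r)"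
      using nn_integral_haar_powr_atMost[OF r(1), of 1] by simp
    moreover have "(\<integral>\<^sup>+t. ennreal (t powr (- (p - r))) * indicator {1..} t \<partial>haar) = ennreal (1 / (p - r))"
      using r by (intro nn_integral_haar_powr_tail) simp
    moreover have "(\<integral>\<^sup>+t. h t + c * k t \<partial>haar) = (\<integral>\<^sup>+t. h t \<partial>haar) + c * (\<integral>\<^sup>+t. k t \<partial>haar)"
      if "h \<in> borel_measurable haar" "k \<in> borel_measurable haar" for h k c
      using that by (simp add: nn_integral_add nn_integral_cmult)
    ultimately show ?thesis by simp
  qed
  also have "\<dots> < \<infinity>" by (simp add: ennreal_mult_less_top)
  finally show ?thesis unfolding eq by (simp add: ennreal_mult_less_top)
qed

text \<open>Independence factors the integral into the mixed moment of A and Y and the moment of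
  order r of \<mu>, which is finite by the tail bound at an exponent between r and a.\<close>

lemma max_mult_powr_finite:
  assumes [measurable]: "Y \<in> borel_measurable M"
    and r: "0 < r" "r < a"
    and tail: "\<And>p. 0 < p \<Longrightarrow> p < a \<Longrightarrow> \<exists>C\<ge>0. \<forall>x>0. T x \<le> C * x powr (- p)"
    and fin: "(\<integral>\<^sup>+\<omega>. ennreal (A \<omega> powr r * max 0 (Y \<omega>) powr s) \<partial>M) < \<infinity>"
  shows "(\<integral>\<^sup>+z. ennreal (max 0 (Y (fst z)) powr s * (A (fst z) * snd z) powr r) \<partial>Z) < \<infinity>"
proof -
  have r': "r < (r + a) / 2" "0 < (r + a) / 2" "(r + a) / 2 < a" using r by auto
  have mom_r: "(\<integral>\<^sup>+y. ennreal (max 0 y powr r) \<partial>\<mu>) < \<infinity>"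
    using moment_finite[OF tail[OF r'(2,3)] r(1) r'(1)] .
  interpret pair_sigma_finite M \<mu> ..
  have nn: "AE z in Z. 0 \<le> snd z"
    by (rule AE_pair_measure, measurable, simp add: mu_nonneg)
  have "(\<integral>\<^sup>+z. ennreal (max 0 (Y (fst z)) powr s * (A (fst z) * snd z) powr r) \<partial>Z)
      = (\<integral>\<^sup>+z. ennreal (A (fst z) powr r * max 0 (Y (fst z)) powr s) * ennreal (max 0 (snd z) powr r) \<partial>Z)"
  proof (rule nn_integral_cong_AE, rule AE_mp[OF nn], rule AE_I2, rule impI)
    fix z assume "z \<in> space (Z)" "0 \<le> snd z"
    then have "0 \<le> A (fst z)" using A_nonneg[of "fst z"] by (auto simp: space_pair_measure)
    then show "ennreal (max 0 (Y (fst z)) powr s * (A (fst z) * snd z) powr r)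
        = ennreal (A (fst z) powr r * max 0 (Y (fst z)) powr s) * ennreal (max 0 (snd z) powr r)"
      using \<open>0 \<le> snd z\<close> by (subst ennreal_mult[symmetric]) (auto simp: powr_mult max_absorb2 mult_ac)
  qed
  also have "\<dots> = (\<integral>\<^sup>+\<omega>. ennreal (A \<omega> powr r * max 0 (Y \<omega>) powr s) \<partial>M) * (\<integral>\<^sup>+y. ennreal (max 0 y powr r) \<partial>\<mu>)"
    by (rule nn_integral_product) measurable
  also have "\<dots> < \<infinity>" using fin mom_r by (simp add: ennreal_mult_less_top)
  finally show ?thesis .
qed

end

text \<open>The total loss in the upper bound: one factor 1 + d for undoing the average, two for the
  source \<open>big\<close>, and 1 - d for G as an approximate solution.\<close>

lemma exists_small_upper:
  fixes e :: real assumes "0 < e"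
  shows "\<exists>d>0. d < 1 \<and> (1 + d) ^ 3 / (1 - d) \<le> 1 + e"
proof -
  have "((\<lambda>d::real. (1 + d) ^ 3 / (1 - d)) \<longlongrightarrow> (1 + 0) ^ 3 / (1 - 0)) (at_right 0)"
    by (intro tendsto_intros) auto
  then have "\<forall>\<^sub>F d in at_right 0. (1 + d) ^ 3 / (1 - d) < 1 + e"
    using assms by (intro order_tendstoD(2)) auto
  then have "\<forall>\<^sub>F d::real in at_right 0. 0 < d \<and> d < 1 \<and> (1 + d) ^ 3 / (1 - d) \<le> 1 + e"
    using eventually_at_right_real[OF zero_less_one] by eventually_elim auto
  then show ?thesis by (auto dest: eventually_happens simp: trivial_limit_at_right_real)
qed

text \<open>The total loss in the lower bound: factors 1 - d for averaging g and for absorbing d G,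
  factors 1 + d for the averaged \<open>f\<close> and for G as an approximate solution.\<close>

lemma exists_small_lower:
  fixes e :: real assumes "0 < e"
  shows "\<exists>d>0. d < 1 \<and> 1 - e \<le> (1 - d) ^ 2 / (1 + d) ^ 2"
proof -
  have "((\<lambda>d::real. (1 - d) ^ 2 / (1 + d) ^ 2) \<longlongrightarrow> (1 - 0) ^ 2 / (1 + 0) ^ 2) (at_right 0)"
    by (intro tendsto_intros) auto
  then have "\<forall>\<^sub>F d in at_right 0. 1 - e < (1 - d) ^ 2 / (1 + d) ^ 2"
    using assms by (intro order_tendstoD(1)) auto
  then have "\<forall>\<^sub>F d::real in at_right 0. 0 < d \<and> d < 1 \<and> 1 - e \<le> (1 - d) ^ 2 / (1 + d) ^ 2"
    using eventually_at_right_real[OF zero_less_one] by eventually_elim auto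
  then show ?thesis by (auto dest: eventually_happens simp: trivial_limit_at_right_real)
qed

text \<open>Here p stands for A y and w for the additive term. The three conditions force \<theta> w
  \<le> p, so p + w is of the order of p, and the window from p to p + w has logarithmic length at
  most w/p. As w/p is bounded by 1/\<theta>, the exponent 1 can be lowered to \<beta>, which
  produces the integrand of a mixed moment.\<close>

lemma jump_window_integral:
  fixes \<theta> \<beta> a p w :: real
  assumes \<theta>: "0 < \<theta>" "\<theta> < 1" and \<beta>: "0 < \<beta>" "\<beta> \<le> 1" and a: "0 < a" and p: "0 \<le> p"
  shows "(\<integral>\<^sup>+x. (if p \<le> x \<and> x < p + w \<and> w \<le> (1 - \<theta>) * x then ennreal (x powr a) else 0) \<partial>haar)
    \<le> ennreal ((1 + 1 / \<theta>) powr a * (1 / \<theta>) powr (1 - \<beta>)) * ennreal (max 0 w powr \<beta> * p powr (a - \<beta>))"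
    (is "?L \<le> _")
proof (cases "0 < w \<and> \<theta> * w \<le> p")
  case False
  have no: "\<not> (p \<le> x \<and> x < p + w \<and> w \<le> (1 - \<theta>) * x)" for x
  proof
    assume x: "p \<le> x \<and> x < p + w \<and> w \<le> (1 - \<theta>) * x"
    then have w: "0 < w" by linarith
    have "(1 - \<theta>) * x \<le> (1 - \<theta>) * (p + w)" using x \<theta> by (intro mult_left_mono) auto
    then have "w \<le> (1 - \<theta>) * (p + w)" using x by linarith
    then have "\<theta> * w \<le> p - \<theta> * p" by (simp add: algebra_simps)
    then have "\<theta> * w \<le> p" using \<theta> p mult_nonneg_nonneg[of \<theta> p] by linarith
    with False w show False by simp
  qed
  then have "?L = (\<integral>\<^sup>+x. 0 \<partial>haar)" by (intro nn_integral_cong) auto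
  then show ?thesis by simp
next
  case True
  then have w: "0 < w" "\<theta> * w \<le> p" by auto
  then have p0: "0 < p" using \<theta> mult_pos_pos[of \<theta> w] by linarith
  have wp: "w / p \<le> 1 / \<theta>" "0 < w / p" using w p0 \<theta> by (simp_all add: field_simps)
  have "?L \<le> (\<integral>\<^sup>+x. ennreal ((p + w) powr a) * indicator {p..p + w} x \<partial>haar)"
    using p0 a by (intro nn_integral_mono) (auto simp: indicator_def intro!: ennreal_leI powr_mono2)
  also have "\<dots> = ennreal ((p + w) powr a) * ennreal (ln ((p + w) / p))"
    using p0 w by (subst nn_integral_cmult, simp, subst nn_integral_haar_Icc) auto
  also have "\<dots> = ennreal ((p + w) powr a * ln ((p + w) / p))"
    using p0 w by (intro ennreal_mult[symmetric]) auto
  also have "\<dots> \<le> ennreal ((1 + 1 / \<theta>) powr a * (1 / \<theta>) powr (1 - \<beta>) * (max 0 w powr \<beta> * p powr (a - \<beta>)))"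
  proof (rule ennreal_leI)
    have "ln ((p + w) / p) \<le> w / p"
      using p0 wp ln_add_one_self_le_self[of "w / p"] by (simp add: add_divide_distrib)
    also have "w / p = (w / p) powr \<beta> * (w / p) powr (1 - \<beta>)" using w p0 by (simp flip: powr_add)
    also have "\<dots> \<le> (w / p) powr \<beta> * (1 / \<theta>) powr (1 - \<beta>)"
      using wp \<beta> by (intro mult_left_mono powr_mono2) auto
    finally have ln_le: "ln ((p + w) / p) \<le> (w / p) powr \<beta> * (1 / \<theta>) powr (1 - \<beta>)" .
    have "w \<le> p * (1 / \<theta>)" using w \<theta> by (simp add: field_simps)
    then have "p + w \<le> (1 + 1 / \<theta>) * p" by (simp add: algebra_simps)
    then have "(p + w) powr a \<le> ((1 + 1 / \<theta>) * p) powr a" using p0 w a by (intro powr_mono2) auto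
    then have "(p + w) powr a \<le> (1 + 1 / \<theta>) powr a * p powr a" using p0 \<theta> by (simp add: powr_mult)
    then have "(p + w) powr a * ln ((p + w) / p)
        \<le> (1 + 1 / \<theta>) powr a * p powr a * ((w / p) powr \<beta> * (1 / \<theta>) powr (1 - \<beta>))"
      using ln_le p0 w by (intro mult_mono) auto
    also have "p powr a * (w / p) powr \<beta> = w powr \<beta> * p powr (a - \<beta>)"
      using p0 w by (simp add: powr_divide powr_diff)
    then have "(1 + 1 / \<theta>) powr a * p powr a * ((w / p) powr \<beta> * (1 / \<theta>) powr (1 - \<beta>))
        = (1 + 1 / \<theta>) powr a * (1 / \<theta>) powr (1 - \<beta>) * (max 0 w powr \<beta> * p powr (a - \<beta>))"
      using w by (simp add: max_absorb2)
    finally show "(p + w) powr a * ln ((p + w) / p)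
        \<le> (1 + 1 / \<theta>) powr a * (1 / \<theta>) powr (1 - \<beta>) * (max 0 w powr \<beta> * p powr (a - \<beta>))" .
  qed
  finally show ?thesis by (simp add: ennreal_mult)
qed

section \<open>The upper bound\<close>

locale perpetuity_upper = perpetuity M A a b q \<mu> + renewal_tail M A a b q Y
  for M :: "'a measure" and A a b q \<mu> Y +
  assumes upper: "\<And>x. 0 < x \<Longrightarrow> emeasure \<mu> {x<..}
      \<le> emeasure (Z) {z \<in> space (Z). x < A (fst z) * snd z + Y (fst z)}"
    and mixed_moment: "\<exists>\<eta>. 0 < \<eta> \<and> \<eta> < a \<and>
      (\<integral>\<^sup>+\<omega>. ennreal (A \<omega> powr \<eta> * max 0 (Y \<omega>) powr (a - \<eta>)) \<partial>M) < \<infinity>"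
begin

text \<open>Slow variation makes the tail of Y itself O(x^(-p)) for every p < a, so the a priori
  bound applies.\<close>

lemma T_le_powr:
  assumes p: "0 < p" "p < a"
  shows "\<exists>C\<ge>0. \<forall>x>0. T x \<le> C * x powr (- p)"
proof (rule tail_le_powr[OF Y_measurable upper _ p])
  obtain C where C: "0 \<le> C" "\<And>x. 0 < x \<Longrightarrow> g x \<le> C * x powr (a - p)"
    using g_growth[of "a - p"] p by auto
  have "prob {\<omega> \<in> space M. x < Y \<omega>} \<le> C * x powr (- p)" if x: "0 < x" for x
  proof -
    have "prob {\<omega> \<in> space M. x < Y \<omega>} = x powr (- a) * g x"
      using x by (simp add: tail_fn_def powr_minus)
    also have "\<dots> \<le> x powr (- a) * (C * x powr (a - p))" by (intro mult_left_mono C x) auto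
    also have "\<dots> = C * (x powr (- a) * x powr (a - p))" by simp
    also have "\<dots> = C * x powr (- p)" by (simp flip: powr_add)
    finally show ?thesis .
  qed
  then show "\<exists>C\<ge>0. \<forall>x>0. prob {\<omega> \<in> space M. x < Y \<omega>} \<le> C * x powr (- p)" using C(1) by blast
qed

lemma f_growth: "\<exists>C\<ge>0. \<forall>x>0. f x \<le> ennreal (C * x powr b)"
proof -
  obtain C where C: "0 \<le> C" "\<And>x. 0 < x \<Longrightarrow> T x \<le> C * x powr (- (a - b))"
    using T_le_powr[of "a - b"] b_pos b_less by auto
  have "f x \<le> ennreal (C * x powr b)" if x: "0 < x" for x
  proof -
    have "x powr a * T x \<le> x powr a * (C * x powr (- (a - b)))" by (intro mult_left_mono C x) auto
    also have "\<dots> = C * (x powr a * x powr (- (a - b)))" by simp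
    also have "\<dots> = C * x powr b" by (simp flip: powr_add)
    finally show ?thesis by (simp add: f_def ennreal_leI)
  qed
  then show ?thesis using C(1) by blast
qed

definition "big \<theta> x = ennreal (x powr a * prob {\<omega> \<in> space M. (1 - \<theta>) * x < Y \<omega>})"

text \<open>This source need not be small compared with \<open>g\<close> pointwise; only its integral against \<open>dt/t\<close> is
  finite.\<close>

definition "jump \<theta> x = (\<integral>\<^sup>+z. (if A (fst z) * snd z \<le> x \<and> x < A (fst z) * snd z + Y (fst z) \<and> Y (fst z) \<le> (1 - \<theta>) * x
  then ennreal (x powr a) else 0) \<partial>Z)"

lemma big_eq: "0 < x \<Longrightarrow> \<theta> < 1 \<Longrightarrow> big \<theta> x = ennreal ((1 - \<theta>) powr (- a) * g ((1 - \<theta>) * x))"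
  by (simp add: big_def tail_fn_def powr_mult powr_minus)

lemma big_measurable [measurable]: "big \<theta> \<in> borel_measurable borel"
proof -
  have [measurable]: "(\<lambda>x. prob {\<omega> \<in> space M. x < Y \<omega>}) \<in> borel_measurable borel"
    by (intro borel_measurable_antimono antimonoI finite_measure_mono) auto
  show ?thesis unfolding big_def by measurable
qed

lemma jump_measurable [measurable]: "jump \<theta> \<in> borel_measurable borel"
proof -
  interpret pair_sigma_finite M \<mu> ..
  interpret Z: sigma_finite_measure Z ..
  show ?thesis unfolding jump_def by measurable
qed

lemma jump_integrable:
  assumes \<theta>: "0 < \<theta>" "\<theta> < 1"
  shows "(\<integral>\<^sup>+x. jump \<theta> x \<partial>haar) < \<infinity>"
proof -
  obtain \<eta> where \<eta>: "0 < \<eta>" "\<eta> < a"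
      "(\<integral>\<^sup>+\<omega>. ennreal (A \<omega> powr \<eta> * max 0 (Y \<omega>) powr (a - \<eta>)) \<partial>M) < \<infinity>"
    using mixed_moment by auto
  \<comment> \<open>At most 1 for the logarithmic window estimate, and at most a - \<eta> for the
    interpolation that follows.\<close>
  define \<beta> where "\<beta> = min 1 (a - \<eta>)"
  have \<beta>: "0 < \<beta>" "\<beta> \<le> 1" "\<beta> \<le> a - \<eta>" "\<beta> < a" using \<eta> by (auto simp: \<beta>_def)
  interpret pair_sigma_finite M \<mu> ..
  interpret Z: sigma_finite_measure Z ..
  interpret ZH: pair_sigma_finite Z haar ..
  have nn: "AE z in Z. 0 \<le> snd z"
    by (rule AE_pair_measure, measurable, simp add: mu_nonneg)
  let ?C = "ennreal ((1 + 1 / \<theta>) powr a * (1 / \<theta>) powr (1 - \<beta>))"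
  have "(\<integral>\<^sup>+\<omega>. ennreal (A \<omega> powr (a - \<beta>) * max 0 (Y \<omega>) powr \<beta>) \<partial>M)
      \<le> (\<integral>\<^sup>+\<omega>. ennreal (A \<omega> powr a) + ennreal (A \<omega> powr \<eta> * max 0 (Y \<omega>) powr (a - \<eta>)) \<partial>M)"
  proof (intro nn_integral_mono)
    fix \<omega> assume \<omega>: "\<omega> \<in> space M"
    define x y where "x = A \<omega>" "y = max 0 (Y \<omega>)"
    have "0 \<le> x" "0 \<le> y" using A_nonneg[OF \<omega>] by (auto simp: x_y_def)
    \<comment> \<open>Interpolation with the moment of order a of A: if y \<le> x the left side is
      at most x^a, otherwise (y/x)^\<beta> is at most (y/x)^(a-\<eta>).\<close>
    have "x powr (a - \<beta>) * y powr \<beta> \<le> x powr a + x powr \<eta> * y powr (a - \<eta>)"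
    proof (cases "x = 0 \<or> y \<le> x")
      case True
      then have "x powr (a - \<beta>) * y powr \<beta> \<le> x powr (a - \<beta>) * x powr \<beta>"
        using \<beta> \<open>0 \<le> y\<close> by (cases "x = 0") (auto intro!: mult_left_mono powr_mono2)
      also have "\<dots> = x powr a" by (simp flip: powr_add)
      finally show ?thesis by (simp add: add_increasing2)
    next
      case False
      then have x: "0 < x" "x \<le> y" using \<open>0 \<le> x\<close> by auto
      have "x powr (a - \<beta>) * y powr \<beta> = x powr a * (y / x) powr \<beta>"
        using x by (simp add: powr_divide powr_diff)
      also have "\<dots> \<le> x powr a * (y / x) powr (a - \<eta>)"
        using x \<beta> by (intro mult_left_mono powr_mono) auto
      also have "\<dots> = x powr \<eta> * y powr (a - \<eta>)"
        using x by (simp add: powr_divide powr_diff)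
      finally show ?thesis by (simp add: add_increasing)
    qed
    then show "ennreal (A \<omega> powr (a - \<beta>) * max 0 (Y \<omega>) powr \<beta>)
        \<le> ennreal (A \<omega> powr a) + ennreal (A \<omega> powr \<eta> * max 0 (Y \<omega>) powr (a - \<eta>))"
      unfolding x_y_def by (simp add: ennreal_leI flip: ennreal_plus)
  qed
  also have "\<dots> = mom a + (\<integral>\<^sup>+\<omega>. ennreal (A \<omega> powr \<eta> * max 0 (Y \<omega>) powr (a - \<eta>)) \<partial>M)"
    unfolding mom_def by (rule nn_integral_add) measurable
  also have "\<dots> < \<infinity>" using \<eta>(3) mom_1 by simp
  finally have fin: "(\<integral>\<^sup>+z. ennreal (max 0 (Y (fst z)) powr \<beta> * (A (fst z) * snd z) powr (a - \<beta>)) \<partial>Z) < \<infinity>"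
    using \<beta> by (intro max_mult_powr_finite T_le_powr) auto
  have "(\<integral>\<^sup>+x. jump \<theta> x \<partial>haar) = (\<integral>\<^sup>+z. (\<integral>\<^sup>+x. (if A (fst z) * snd z \<le> x \<and> x < A (fst z) * snd z + Y (fst z) \<and> Y (fst z) \<le> (1 - \<theta>) * x
      then ennreal (x powr a) else 0) \<partial>haar) \<partial>Z)"
    unfolding jump_def by (rule ZH.Fubini') measurable
  also have "\<dots> \<le> (\<integral>\<^sup>+z. ?C * ennreal (max 0 (Y (fst z)) powr \<beta> * (A (fst z) * snd z) powr (a - \<beta>)) \<partial>Z)"
  proof (rule nn_integral_mono_AE, rule AE_mp[OF nn], rule AE_I2, rule impI)
    fix z assume "z \<in> space (Z)" "0 \<le> snd z"
    then have "0 \<le> A (fst z) * snd z" using A_nonneg[of "fst z"] by (auto simp: space_pair_measure)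
    then show "(\<integral>\<^sup>+x. (if A (fst z) * snd z \<le> x \<and> x < A (fst z) * snd z + Y (fst z) \<and> Y (fst z) \<le> (1 - \<theta>) * x
      then ennreal (x powr a) else 0) \<partial>haar) \<le> ?C * ennreal (max 0 (Y (fst z)) powr \<beta> * (A (fst z) * snd z) powr (a - \<beta>))"
      using \<theta> \<beta> b_pos b_less by (intro jump_window_integral) auto
  qed
  also have "\<dots> = ?C * (\<integral>\<^sup>+z. ennreal (max 0 (Y (fst z)) powr \<beta> * (A (fst z) * snd z) powr (a - \<beta>)) \<partial>Z)"
    by (rule nn_integral_cmult) measurable
  also have "\<dots> < \<infinity>" using fin by (simp add: ennreal_mult_less_top)
  finally show ?thesis .
qed

text \<open>The event A y + Y > x is covered by A y > x, which gives \<open>P f\<close>, by Y > (1 -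
  \<theta>) x, which gives a source asymptotic to a multiple of g, and by the remainder, where A y
  has not passed x and Y is at most (1 - \<theta>) x.\<close>

lemma f_subsol:
  assumes \<theta>: "0 < \<theta>" "\<theta> < 1"
  shows "subsol f (\<lambda>x. big \<theta> x + jump \<theta> x)"
  unfolding subsol_def
proof (intro allI impI)
  fix x :: real assume x: "0 < x"
  let ?S1 = "{z \<in> space Z. x < A (fst z) * snd z}"
  let ?S2 = "{z \<in> space Z. (1 - \<theta>) * x < Y (fst z)}"
  let ?S3 = "{z \<in> space Z. A (fst z) * snd z \<le> x \<and> x < A (fst z) * snd z + Y (fst z) \<and> Y (fst z) \<le> (1 - \<theta>) * x}"
  have jump: "jump \<theta> x = ennreal (x powr a) * emeasure Z ?S3"
  proof -
    have "jump \<theta> x = (\<integral>\<^sup>+z. ennreal (x powr a) * indicator ?S3 z \<partial>Z)"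
      unfolding jump_def by (intro nn_integral_cong) (auto simp: indicator_def)
    also have "\<dots> = ennreal (x powr a) * emeasure Z ?S3"
      by (rule nn_integral_cmult_indicator) measurable
    finally show ?thesis .
  qed
  have "f x = ennreal (x powr a) * emeasure \<mu> {x<..}"
    by (simp add: f_def T_def mu.emeasure_eq_measure ennreal_mult)
  also have "\<dots> \<le> ennreal (x powr a) * emeasure Z {z \<in> space Z. x < A (fst z) * snd z + Y (fst z)}"
    by (intro mult_left_mono upper x) auto
  also have "\<dots> \<le> ennreal (x powr a) * emeasure Z (?S1 \<union> ?S2 \<union> ?S3)"
  proof (intro mult_left_mono emeasure_mono)
    show "{z \<in> space Z. x < A (fst z) * snd z + Y (fst z)} \<subseteq> ?S1 \<union> ?S2 \<union> ?S3" by auto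
    show "?S1 \<union> ?S2 \<union> ?S3 \<in> sets Z" by measurable
  qed auto
  also have "\<dots> \<le> ennreal (x powr a) * (emeasure Z ?S1 + emeasure Z ?S2 + emeasure Z ?S3)"
  proof (intro mult_left_mono)
    have "emeasure Z (?S1 \<union> ?S2 \<union> ?S3) \<le> emeasure Z (?S1 \<union> ?S2) + emeasure Z ?S3"
      by (rule emeasure_subadditive) measurable
    also have "emeasure Z (?S1 \<union> ?S2) \<le> emeasure Z ?S1 + emeasure Z ?S2"
      by (rule emeasure_subadditive) measurable
    finally show "emeasure Z (?S1 \<union> ?S2 \<union> ?S3) \<le> emeasure Z ?S1 + emeasure Z ?S2 + emeasure Z ?S3"
      by (simp add: add_right_mono)
  qed auto
  also have "\<dots> = P f x + (big \<theta> x + jump \<theta> x)"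
    unfolding jump P_f[OF x] big_def
    by (subst emeasure_fst[of "\<lambda>\<omega>. (1 - \<theta>) * x < Y \<omega>"])
      (auto simp: distrib_left emeasure_eq_measure ennreal_mult add.assoc)
  finally show "f x \<le> P f x + (big \<theta> x + jump \<theta> x)" .
qed

text \<open>The averaged \<open>f\<close> is compared with c1 G + V + E, where V dominates the
  potential of the averaged \<open>jump\<close> and E repairs small arguments. Both are bounded and
  end up in C.\<close>

theorem f_upper:
  assumes e: "0 < e"
  shows "\<exists>C\<ge>0. \<forall>x>0. f x \<le> ennreal ((1 + e) / \<rho>) * G x + ennreal C"
proof -
  obtain d where d: "0 < d" "d < 1" "(1 + d) ^ 3 / (1 - d) \<le> 1 + e" using exists_small_upper[OF e] by auto
  have a: "0 < a" using b_pos b_less by simp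
  \<comment> \<open>One parameter serves twice: undoing the average costs l^a = 1 + d, and the
    choice 1 - \<theta> = 1/l makes the factor (1 - \<theta>)^(-a) in \<open>big\<close> equal to 1
    + d as well.\<close>
  define l where "l = (1 + d) powr (1 / a)"
  define \<theta> where "\<theta> = 1 - 1 / l"
  \<comment> \<open>Solves c1 (1 - d) \<rho> = (1 + d)^2, so that the source produced by c1 G covers
    the averaged \<open>big\<close>.\<close>
  define c1 where "c1 = (1 + d) ^ 2 / ((1 - d) * \<rho>)"
  have l: "1 < l" using d a by (simp add: l_def gr_one_powr)
  have l_a: "l powr a = 1 + d" using d a by (simp add: l_def powr_powr)
  have \<theta>: "0 < \<theta>" "\<theta> < 1" using l by (auto simp: \<theta>_def)
  have \<theta>_a: "(1 - \<theta>) powr (- a) = 1 + d" using l l_a by (simp add: \<theta>_def powr_divide powr_minus)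
  have c1: "0 \<le> c1" using d \<rho>_pos by (simp add: c1_def)
  have uv: "0 < 1 / l" "1 / l < 1" using l by auto
  let ?S = "smooth (1 / l) 1"
  obtain V cV where V [measurable]: "V \<in> borel_measurable borel" and V': "0 \<le> cV" "\<And>x. V x \<le> ennreal cV"
    "supersol V (?S (jump \<theta>))"
    using bounded_supersol_smooth[OF uv jump_measurable jump_integrable[OF \<theta>]] by blast
  obtain x1 where x1: "0 < x1" "\<And>x. x1 \<le> x \<Longrightarrow> P G x + ennreal ((1 - d) * \<rho> * g x) \<le> G x"
    using G_super_eventually[OF d(1,2)] by auto
  \<comment> \<open>The average lowers the argument by a factor of at most l and \<open>big\<close>
    by exactly l, so g is needed on a window of ratio l^2.\<close>
  have l2: "1 \<le> l ^ 2" using l by (intro one_le_power) auto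
  obtain x2 where x2: "\<And>x t. x2 \<le> x \<Longrightarrow> t \<in> {x / l ^ 2..x * l ^ 2} \<Longrightarrow> g t \<le> (1 + d) * g x"
    using g_uniform[OF l2 d(1,2)] unfolding eventually_at_top_linorder by blast
  obtain CG where CG: "0 \<le> CG" "\<And>x. 0 < x \<Longrightarrow> P G x \<le> ennreal (CG * x powr b)" using G_P_growth by auto
  obtain Cg where Cg: "0 \<le> Cg" "\<And>x. 0 < x \<Longrightarrow> g x \<le> Cg * x powr b" using g_growth[of b] b_pos b_less by auto
  obtain Cf where Cf: "0 \<le> Cf" "\<And>x. 0 < x \<Longrightarrow> f x \<le> ennreal (Cf * x powr b)" using f_growth by auto
  have s_pos: "0 < s" if "1 / l \<le> s" for s using that uv by linarith
  have big_far: "?S (big \<theta>) x \<le> ennreal ((1 + d) ^ 2 * g x)" if x: "max x1 x2 \<le> x" for x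
  proof (rule smooth_le[OF uv])
    fix s assume s: "1 / l \<le> s" "s \<le> 1"
    have x0: "0 < x" using x x1 by simp
    have "x * s / l \<in> {x / l ^ 2..x * l ^ 2}"
    proof -
      have "x * (1 / l) / l \<le> x * s / l" using s x0 l by (intro divide_right_mono mult_left_mono) auto
      moreover have "x * s / l \<le> x * s" using s_pos[OF s(1)] x0 l by (simp add: divide_le_eq)
      moreover have "x * s \<le> x * l ^ 2"
        using order_trans[OF s(2) l2] x0 by (intro mult_left_mono) auto
      ultimately show ?thesis by (simp add: power2_eq_square)
    qed
    then have "g (x * s / l) \<le> (1 + d) * g x" using x by (intro x2) auto
    then have "(1 + d) * g (x * s / l) \<le> (1 + d) * ((1 + d) * g x)" using d by (intro mult_left_mono) auto
    then show "big \<theta> (x * s) \<le> ennreal ((1 + d) ^ 2 * g x)"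
      using x0 s_pos[OF s(1)] \<theta> \<theta>_a
      by (subst big_eq) (auto simp: \<theta>_def power2_eq_square mult_ac intro!: ennreal_leI)
  qed
  \<comment> \<open>A crude bound valid for every argument; it pays for the small x that are handed
    to \<open>supersol_patch\<close>.\<close>
  have big_all: "?S (big \<theta>) x \<le> ennreal ((1 + d) * Cg * x powr b)" if x: "0 < x" for x
  proof (rule smooth_le[OF uv])
    fix s assume s: "1 / l \<le> s" "s \<le> 1"
    have "(1 - \<theta>) * s \<le> 1" using s \<theta> s_pos[OF s(1)] by (intro mult_le_one) auto
    then have le: "(1 - \<theta>) * (x * s) \<le> x" using x by (simp add: mult.left_commute mult_left_le)
    have pos: "0 < (1 - \<theta>) * (x * s)" using x s_pos[OF s(1)] \<theta> by auto
    have "g ((1 - \<theta>) * (x * s)) \<le> Cg * ((1 - \<theta>) * (x * s)) powr b" by (intro Cg pos)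
    also have "\<dots> \<le> Cg * x powr b" using le pos Cg b_pos by (intro mult_left_mono powr_mono2) auto
    finally have "(1 + d) * g ((1 - \<theta>) * (x * s)) \<le> (1 + d) * (Cg * x powr b)" using d by (intro mult_left_mono) auto
    then show "big \<theta> (x * s) \<le> ennreal ((1 + d) * Cg * x powr b)"
      using x s_pos[OF s(1)] \<theta> \<theta>_a by (subst big_eq) (auto simp: mult_ac intro!: ennreal_leI)
  qed
  let ?u = "\<lambda>x. ennreal c1 * G x + V x" and ?x0 = "max x1 x2" and ?C = "c1 * CG + (1 + d) * Cg"
  have [measurable]: "?S (big \<theta>) \<in> borel_measurable borel" "?S (jump \<theta>) \<in> borel_measurable borel"
    by (rule smooth_measurable[OF uv]; measurable)+
  have S_add: "?S (\<lambda>x. big \<theta> x + jump \<theta> x) = (\<lambda>x. ?S (big \<theta>) x + ?S (jump \<theta>) x)"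
    by (rule ext, rule smooth_add[OF uv]; measurable)
  have le: "P ?u x + (?S (big \<theta>) x + ?S (jump \<theta>) x) \<le> ?u x + ennreal (?C * x powr b) * indicator {..?x0} x"
    if x: "0 < x" for x
  proof -
    have main: "ennreal c1 * P G x + ?S (big \<theta>) x \<le> ennreal c1 * G x + ennreal (?C * x powr b) * indicator {..?x0} x"
    proof (cases "x \<le> ?x0")
      case True
      have "ennreal c1 * P G x + ?S (big \<theta>) x \<le> ennreal c1 * ennreal (CG * x powr b) + ennreal ((1 + d) * Cg * x powr b)"
        by (intro add_mono mult_left_mono CG big_all x) auto
      also have "\<dots> = ennreal (?C * x powr b)"
        using c1 CG Cg d by (simp add: algebra_simps flip: ennreal_mult ennreal_plus)
      finally show ?thesis using True by (simp add: add_increasing)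
    next
      case False
      have "ennreal c1 * P G x + ?S (big \<theta>) x \<le> ennreal c1 * P G x + ennreal ((1 + d) ^ 2 * g x)"
        using False by (intro add_left_mono big_far) auto
      also have "ennreal ((1 + d) ^ 2 * g x) = ennreal c1 * ennreal ((1 - d) * \<rho> * g x)"
        using c1 d \<rho>_pos by (simp add: c1_def flip: ennreal_mult)
      also have "ennreal c1 * P G x + \<dots> = ennreal c1 * (P G x + ennreal ((1 - d) * \<rho> * g x))"
        by (simp add: distrib_left)
      also have "\<dots> \<le> ennreal c1 * G x" using False by (intro mult_left_mono x1) auto
      finally show ?thesis using False by simp
    qed
    have "P ?u x = ennreal c1 * P G x + P V x" by (simp add: P_add P_cmult)
    then have "P ?u x + (?S (big \<theta>) x + ?S (jump \<theta>) x)
        = (ennreal c1 * P G x + ?S (big \<theta>) x) + (P V x + ?S (jump \<theta>) x)" by (simp add: ac_simps)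
    also have "\<dots> \<le> (ennreal c1 * G x + ennreal (?C * x powr b) * indicator {..?x0} x) + V x"
      using V'(3) x unfolding supersol_def by (intro add_mono main) auto
    finally show ?thesis by (simp add: ac_simps)
  qed
  have "0 < ?x0" "0 \<le> ?C" using x1 c1 CG Cg d by auto
  then obtain E cE where E: "E \<in> borel_measurable borel" "0 \<le> cE" "\<And>x. E x \<le> ennreal cE"
    "supersol (\<lambda>x. ?u x + E x) (\<lambda>x. ?S (big \<theta>) x + ?S (jump \<theta>) x)"
    using supersol_patch[of ?u ?x0 ?C "\<lambda>x. ?S (big \<theta>) x + ?S (jump \<theta>) x", OF _ _ _ le] by (auto simp del: max_less_iff_conj less_max_iff_disj)
  note [measurable] = E(1)
  have sub: "subsol (?S f) (\<lambda>x. ?S (big \<theta>) x + ?S (jump \<theta>) x)"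
    using smooth_subsol[OF uv f_measurable _ f_subsol[OF \<theta>]] unfolding S_add by measurable
  have comp: "?S f x \<le> ?u x + E x" if x: "0 < x" for x
  proof (rule comparison[OF _ _ sub E(4) _ mom_a mom_b q _ x])
    show "?S f \<in> borel_measurable borel" by (rule smooth_measurable[OF uv]) measurable
    show "?u x + E x < \<infinity>" if "0 < x" for x
      using G_finite[OF that] V'(2)[of x] E(3)[of x]
      by (auto simp: ennreal_mult_less_top intro: le_less_trans)
    fix \<epsilon> :: real assume "0 < \<epsilon>"
    have "?S f x \<le> ennreal (\<epsilon> + Cf * x powr b)" if x: "0 < x" for x
    proof (rule smooth_le[OF uv])
      fix s assume s: "1 / l \<le> s" "s \<le> 1"
      have "f (x * s) \<le> ennreal (Cf * (x * s) powr b)" using x s_pos[OF s(1)] by (intro Cf) auto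
      also have "\<dots> \<le> ennreal (\<epsilon> + Cf * x powr b)"
        using x s s_pos[OF s(1)] Cf b_pos \<open>0 < \<epsilon>\<close>
        by (intro ennreal_leI add_increasing mult_left_mono powr_mono2) (auto simp: mult_left_le)
      finally show "f (x * s) \<le> ennreal (\<epsilon> + Cf * x powr b)" .
    qed
    then show "\<exists>C\<ge>0. \<forall>x>0. ?S f x \<le> ennreal (\<epsilon> + C * x powr b)" using Cf(1) by blast
  qed measurable
  have "f x \<le> ennreal ((1 + e) / \<rho>) * G x + ennreal ((1 + d) * (cV + cE))" if x: "0 < x" for x
  proof -
    have "f x \<le> ennreal (1 + d) * ?S f x" using f_le_smooth[OF x l] by (simp add: l_a)
    also have "\<dots> \<le> ennreal (1 + d) * (ennreal c1 * G x + (ennreal cV + ennreal cE))"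
      using comp[OF x] V'(2)[of x] E(3)[of x]
      by (intro mult_left_mono) (auto intro: order_trans add_mono simp: add.assoc)
    also have "\<dots> = ennreal ((1 + d) * c1) * G x + ennreal ((1 + d) * (cV + cE))"
    proof -
      have "ennreal ((1 + d) * c1) = ennreal (1 + d) * ennreal c1"
        "ennreal ((1 + d) * (cV + cE)) = ennreal (1 + d) * (ennreal cV + ennreal cE)"
        using d c1 V'(1) E(2) by (simp_all add: ennreal_mult[of "1 + d"] del: ennreal_plus flip: ennreal_plus)
      then show ?thesis by (simp only: distrib_left mult.assoc)
    qed
    also have "\<dots> \<le> ennreal ((1 + e) / \<rho>) * G x + ennreal ((1 + d) * (cV + cE))"
    proof (intro add_right_mono mult_right_mono ennreal_leI)
      have "(1 + d) * c1 = (1 + d) ^ 3 / (1 - d) / \<rho>" by (simp add: c1_def power2_eq_square power3_eq_cube)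
      also have "\<dots> \<le> (1 + e) / \<rho>" using d \<rho>_pos by (intro divide_right_mono) auto
      finally show "(1 + d) * c1 \<le> (1 + e) / \<rho>" .
    qed simp
    finally show ?thesis .
  qed
  then show ?thesis using d V'(1) E(2) by (intro exI[of _ "(1 + d) * (cV + cE)"]) auto
qed

end

section \<open>The lower bound\<close>

locale perpetuity_lower = perpetuity M A a b q \<mu> + renewal_tail M A a b q Y
  for M :: "'a measure" and A a b q \<mu> Y +
  assumes lower: "\<And>x. 0 < x \<Longrightarrow>
      emeasure (Z) {z \<in> space (Z). x < max (A (fst z) * snd z) (Y (fst z))} \<le> emeasure \<mu> {x<..}"
    and mixed_moment: "\<exists>\<eta>. 0 < \<eta> \<and> \<eta> < a \<and>
      (\<integral>\<^sup>+\<omega>. ennreal (A \<omega> powr \<eta> * max 0 (Y \<omega>) powr (a - \<eta>)) \<partial>M) < \<infinity>"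
    and T_tail: "\<And>p. 0 < p \<Longrightarrow> p < a \<Longrightarrow> \<exists>C\<ge>0. \<forall>x>0. T x \<le> C * x powr (- p)"
begin

text \<open>The overlap term in inclusion-exclusion for the event that the maximum of A y and Y
  exceeds x.\<close>

definition "joint x = (\<integral>\<^sup>+z. (if x < A (fst z) * snd z \<and> x < Y (fst z) then ennreal (x powr a) else 0) \<partial>Z)"

lemma joint_measurable [measurable]: "joint \<in> borel_measurable borel"
proof -
  interpret pair_sigma_finite M \<mu> ..
  interpret Z: sigma_finite_measure Z ..
  show ?thesis unfolding joint_def by measurable
qed

text \<open>The inner integral is a multiple of min(p, w)^a, with p = A y and w = Y, and this is at
  most w^(a-\<eta>) p^\<eta>; independence then separates y.\<close>

lemma joint_integrable: "(\<integral>\<^sup>+x. joint x \<partial>haar) < \<infinity>"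
proof -
  obtain \<eta> where \<eta>: "0 < \<eta>" "\<eta> < a"
      "(\<integral>\<^sup>+\<omega>. ennreal (A \<omega> powr \<eta> * max 0 (Y \<omega>) powr (a - \<eta>)) \<partial>M) < \<infinity>"
    using mixed_moment by auto
  have a: "0 < a" using \<eta> by simp
  interpret pair_sigma_finite M \<mu> ..
  interpret Z: sigma_finite_measure Z ..
  interpret ZH: pair_sigma_finite Z haar ..
  have nn: "AE z in Z. 0 \<le> snd z"
    by (rule AE_pair_measure, measurable, simp add: mu_nonneg)
  have "(\<integral>\<^sup>+x. joint x \<partial>haar) = (\<integral>\<^sup>+z. (\<integral>\<^sup>+x. (if x < A (fst z) * snd z \<and> x < Y (fst z)
      then ennreal (x powr a) else 0) \<partial>haar) \<partial>Z)"
    unfolding joint_def by (rule ZH.Fubini') measurable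
  also have "\<dots> \<le> (\<integral>\<^sup>+z. ennreal (1 / a) * ennreal (max 0 (Y (fst z)) powr (a - \<eta>) * (A (fst z) * snd z) powr \<eta>) \<partial>Z)"
  proof (rule nn_integral_mono_AE, rule AE_mp[OF nn], rule AE_I2, rule impI)
    fix z assume "z \<in> space (Z)" "0 \<le> snd z"
    define p w where "p = A (fst z) * snd z" and "w = Y (fst z)"
    have p: "0 \<le> p" using \<open>z \<in> _\<close> \<open>0 \<le> snd z\<close> A_nonneg[of "fst z"] by (auto simp: p_def space_pair_measure)
    have "(\<integral>\<^sup>+x. (if x < p \<and> x < w then ennreal (x powr a) else 0) \<partial>haar)
        = (\<integral>\<^sup>+x. ennreal (x powr a) * indicator {..<min p w} x \<partial>haar)"
      by (intro nn_integral_cong) auto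
    also have "\<dots> = ennreal (max 0 (min p w) powr a / a)" by (rule nn_integral_haar_powr_lessThan[OF a])
    also have "\<dots> \<le> ennreal (1 / a * (max 0 w powr (a - \<eta>) * p powr \<eta>))"
    proof (rule ennreal_leI)
      have "max 0 (min p w) powr a = max 0 (min p w) powr (a - \<eta>) * max 0 (min p w) powr \<eta>"
        by (simp flip: powr_add)
      also have "\<dots> \<le> max 0 w powr (a - \<eta>) * p powr \<eta>"
        using \<eta> p by (intro mult_mono powr_mono2) auto
      finally show "max 0 (min p w) powr a / a \<le> 1 / a * (max 0 w powr (a - \<eta>) * p powr \<eta>)"
        using a by (simp add: divide_right_mono)
    qed
    also have "\<dots> = ennreal (1 / a) * ennreal (max 0 w powr (a - \<eta>) * p powr \<eta>)"
      using a by (intro ennreal_mult) auto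
    finally show "(\<integral>\<^sup>+x. (if x < A (fst z) * snd z \<and> x < Y (fst z) then ennreal (x powr a) else 0) \<partial>haar)
        \<le> ennreal (1 / a) * ennreal (max 0 (Y (fst z)) powr (a - \<eta>) * (A (fst z) * snd z) powr \<eta>)"
      unfolding p_def w_def .
  qed
  also have "\<dots> = ennreal (1 / a) * (\<integral>\<^sup>+z. ennreal (max 0 (Y (fst z)) powr (a - \<eta>) * (A (fst z) * snd z) powr \<eta>) \<partial>Z)"
    by (rule nn_integral_cmult) measurable
  also have "\<dots> < \<infinity>"
    using max_mult_powr_finite[OF Y_measurable \<eta>(1,2) T_tail \<eta>(3)] by (simp add: ennreal_mult_less_top)
  finally show ?thesis .
qed

text \<open>Inclusion-exclusion, with the overlap moved to the right-hand side to stay in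
  \<open>ennreal\<close>.\<close>

lemma f_super_joint:
  assumes x: "0 < x"
  shows "P f x + ennreal (g x) \<le> f x + joint x"
proof -
  let ?S1 = "{z \<in> space Z. x < A (fst z) * snd z}"
  let ?S2 = "{z \<in> space Z. x < Y (fst z)}"
  have [measurable]: "?S1 \<in> sets Z" "?S2 \<in> sets Z" by measurable
  have joint: "joint x = ennreal (x powr a) * emeasure Z (?S1 \<inter> ?S2)"
  proof -
    have "joint x = (\<integral>\<^sup>+z. ennreal (x powr a) * indicator (?S1 \<inter> ?S2) z \<partial>Z)"
      unfolding joint_def by (intro nn_integral_cong) (auto simp: indicator_def)
    also have "\<dots> = ennreal (x powr a) * emeasure Z (?S1 \<inter> ?S2)"
      by (rule nn_integral_cmult_indicator) measurable
    finally show ?thesis .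
  qed
  have "P f x + ennreal (g x) = ennreal (x powr a) * (emeasure Z ?S1 + emeasure Z ?S2)"
    unfolding P_f[OF x] tail_fn_def
    by (subst emeasure_fst[of "\<lambda>\<omega>. x < Y \<omega>"]) (auto simp: distrib_left emeasure_eq_measure ennreal_mult)
  also have "emeasure Z ?S1 + emeasure Z ?S2 = emeasure Z (?S1 \<union> ?S2) + emeasure Z (?S1 \<inter> ?S2)"
    by (rule emeasure_Un_Int) measurable
  also have "?S1 \<union> ?S2 = {z \<in> space Z. x < max (A (fst z) * snd z) (Y (fst z))}" by (auto simp: less_max_iff_disj)
  also have "ennreal (x powr a) * (emeasure Z {z \<in> space Z. x < max (A (fst z) * snd z) (Y (fst z))} + emeasure Z (?S1 \<inter> ?S2))
      \<le> ennreal (x powr a) * (emeasure \<mu> {x<..} + emeasure Z (?S1 \<inter> ?S2))"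
    by (intro mult_left_mono add_right_mono lower x) auto
  also have "\<dots> = f x + joint x"
    by (simp add: distrib_left joint f_def T_def mu.emeasure_eq_measure ennreal_mult)
  finally show ?thesis .
qed

text \<open>G is compared with c2 F + R K H + E3. Here F is the averaged \<open>f\<close> up to
  bounded terms, with source (1 - d) g, and H is a supersolution with source g, so that R K H
  dominates the potential of the error \<open>R K g\<close>. As R K H is at most d G plus a
  constant, it is absorbed on the left.\<close>

theorem f_lower:
  assumes e: "0 < e" "e < 1"
  shows "\<exists>C\<ge>0. \<forall>x>0. (1 - e) / \<rho> * int_tilde g x \<le> x powr a * T x + C"
proof -
  obtain d where d: "0 < d" "d < 1" "1 - e \<le> (1 - d) ^ 2 / (1 + d) ^ 2" using exists_small_lower[OF e(1)] by auto
  have a: "0 < a" using b_pos b_less by simp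
  define l where "l = (1 + d) powr (1 / a)"
  \<comment> \<open>Solves c2 (1 - d) = (1 + d) \<rho>, matching the source of F with the main
    source of G.\<close>
  define c2 where "c2 = (1 + d) * \<rho> / (1 - d)"
  have l: "1 < l" using d a by (simp add: l_def gr_one_powr)
  have l_a: "l powr a = 1 + d" using d a by (simp add: l_def powr_powr)
  have c2: "0 \<le> c2" using d \<rho>_pos by (simp add: c2_def)
  have uv: "0 < (1::real)" "1 < l" using l by auto
  let ?S = "smooth 1 l" and ?g = "\<lambda>x. ennreal (g x)"
  obtain V cV where V [measurable]: "V \<in> borel_measurable borel" and V': "0 \<le> cV" "\<And>x. V x \<le> ennreal cV"
    "supersol V (?S joint)"
    using bounded_supersol_smooth[OF uv joint_measurable joint_integrable] by blast
  obtain CG where CG: "0 \<le> CG" "\<And>x. 0 < x \<Longrightarrow> G x \<le> ennreal (CG * x powr b)"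
      "\<And>x. 0 < x \<Longrightarrow> P G x \<le> ennreal (CG * x powr b)" using G_P_growth by auto
  obtain Cg where Cg: "0 \<le> Cg" "\<And>x. 0 < x \<Longrightarrow> g x \<le> Cg * x powr b" using g_growth[of b] b_pos b_less by auto
  obtain x2 where x2: "\<And>x t. x2 \<le> x \<Longrightarrow> t \<in> {x / l..x * l} \<Longrightarrow> (1 - d) * g x \<le> g t"
    using g_uniform[OF less_imp_le[OF l] d(1,2)] unfolding eventually_at_top_linorder by blast
  have [measurable]: "?S f \<in> borel_measurable borel" "?S joint \<in> borel_measurable borel"
    by (rule smooth_measurable[OF uv]; measurable)+
  let ?u = "\<lambda>x. ?S f x + V x" and ?x1 = "max 1 x2"
  have super_u: "P ?u x + ?S ?g x \<le> ?u x" if x: "0 < x" for x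
  proof -
    have "P (?S f) x + ?S ?g x = ?S (\<lambda>x. P f x + ?g x) x"
      by (subst smooth_add[OF uv], measurable, subst P_smooth[OF uv]) auto
    also have "\<dots> \<le> ?S (\<lambda>x. f x + joint x) x"
      by (intro smooth_mono[OF uv] f_super_joint x)
    also have "\<dots> = ?S f x + ?S joint x" by (rule smooth_add[OF uv]) measurable
    finally have 1: "P (?S f) x + ?S ?g x \<le> ?S f x + ?S joint x" .
    have 2: "P V x + ?S joint x \<le> V x" using V'(3) x by (auto simp: supersol_def)
    have "?S joint x + (P ?u x + ?S ?g x) = (P (?S f) x + ?S ?g x) + (P V x + ?S joint x)"
      by (simp add: P_add ac_simps)
    also have "\<dots> \<le> (?S f x + ?S joint x) + V x" by (intro add_mono 1 2)
    also have "\<dots> = ?S joint x + ?u x" by (simp add: ac_simps)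
    finally have le: "?S joint x + (P ?u x + ?S ?g x) \<le> ?S joint x + ?u x" .
    \<comment> \<open>The averaged overlap is dominated by V, hence finite, and can be cancelled
      from both sides.\<close>
    have "?S joint x \<le> P V x + ?S joint x" by (simp add: add_increasing)
    also note 2
    also note V'(2)[of x]
    finally have "?S joint x \<le> ennreal cV" .
    then have "?S joint x \<noteq> \<top>" by (auto simp: top_unique)
    with le show ?thesis by (simp add: ennreal_add_left_cancel_le)
  qed
  have "P ?u x + ennreal ((1 - d) * g x) \<le> ?u x + ennreal (Cg * x powr b) * indicator {..?x1} x" if x: "0 < x" for x
  proof (cases "x \<le> ?x1")
    case True
    have "P ?u x \<le> P ?u x + ?S ?g x" by (simp add: add_increasing2)
    also note super_u[OF x]
    finally have "P ?u x \<le> ?u x" .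
    moreover have "(1 - d) * g x \<le> 1 * (Cg * x powr b)" using d Cg(2)[OF x] by (intro mult_mono) auto
    ultimately show ?thesis using True by (intro add_mono) (auto intro!: ennreal_leI)
  next
    case False
    have "ennreal ((1 - d) * g x) \<le> ?S ?g x"
    proof (rule smooth_ge[OF uv])
      fix s assume s: "1 \<le> s" "s \<le> l"
      have "x / l \<le> x * 1" using x l by (simp add: divide_le_eq)
      also have "x * 1 \<le> x * s" using x s by (intro mult_left_mono) auto
      finally have "x * s \<in> {x / l..x * l}" using s x by auto
      then show "ennreal ((1 - d) * g x) \<le> ?g (x * s)" using False by (intro ennreal_leI x2) auto
    qed
    then have "P ?u x + ennreal ((1 - d) * g x) \<le> P ?u x + ?S ?g x" by (rule add_left_mono)
    also have "\<dots> \<le> ?u x" by (rule super_u[OF x])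
    finally show ?thesis using False by simp
  qed
  moreover have "0 < ?x1" by simp
  ultimately obtain E1 cE1 where E1: "E1 \<in> borel_measurable borel" "0 \<le> cE1" "\<And>x. E1 x \<le> ennreal cE1"
    "supersol (\<lambda>x. ?u x + E1 x) (\<lambda>x. ennreal ((1 - d) * g x))"
    using supersol_patch[of ?u ?x1 Cg "\<lambda>x. ennreal ((1 - d) * g x)"] Cg(1) by (auto simp del: max_less_iff_conj less_max_iff_disj)
  note [measurable] = E1(1)
  let ?F = "\<lambda>x. ?u x + E1 x"

  \<comment> \<open>For H only the order of magnitude of G matters, so a fixed loss of one half is
    accepted; the factor 2/\<rho> then normalises the source to g.\<close>
  obtain x3 where x3: "0 < x3" "\<And>x. x3 \<le> x \<Longrightarrow> P G x + ennreal ((1 - 1/2) * \<rho> * g x) \<le> G x"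
    using G_super_eventually[of "1/2"] by auto
  let ?h = "\<lambda>x. ennreal (\<rho> / 2 * g x)" and ?C3 = "CG + \<rho> / 2 * Cg"
  have C3: "0 \<le> ?C3" using CG Cg \<rho>_pos by simp
  have "P G x + ?h x \<le> G x + ennreal (?C3 * x powr b) * indicator {..x3} x" if x: "0 < x" for x
  proof (cases "x \<le> x3")
    case True
    have "\<rho> / 2 * g x \<le> \<rho> / 2 * (Cg * x powr b)" using \<rho>_pos by (intro mult_left_mono Cg x) auto
    then have "P G x + ?h x \<le> ennreal (CG * x powr b) + ennreal (\<rho> / 2 * (Cg * x powr b))"
      by (intro add_mono CG x ennreal_leI)
    also have "\<dots> = ennreal (?C3 * x powr b)"
      using CG Cg \<rho>_pos by (subst ennreal_plus[symmetric]) (auto simp: algebra_simps)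
    finally show ?thesis using True by (simp add: add_increasing)
  next
    case False
    then show ?thesis using x3(2)[of x] by simp
  qed
  then obtain E2 cE2 where E2: "E2 \<in> borel_measurable borel" "0 \<le> cE2" "\<And>x. E2 x \<le> ennreal cE2"
    "supersol (\<lambda>x. G x + E2 x) ?h"
    using supersol_patch[OF G_measurable x3(1) C3, where s = ?h] by blast
  note [measurable] = E2(1)
  let ?H = "\<lambda>x. ennreal (2 / \<rho>) * (G x + E2 x)"
  have H: "supersol ?H ?g"
  proof -
    have "supersol ?H (\<lambda>x. ennreal (2 / \<rho>) * ?h x)"
      by (rule supersol_cmult[OF _ E2(4)]) measurable
    then show ?thesis using \<rho>_pos by (simp flip: ennreal_mult)
  qed

  \<comment> \<open>Multiplied by the factor 2/\<rho> in H, this bound on \<open>log_tail K\<close>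
    leaves exactly d in front of G.\<close>
  have "0 < d * \<rho> / 2" using d \<rho>_pos by simp
  from log_tail_small[OF this] G_sub_eventually[OF d(1,2)] eventually_ge_at_top[of 1]
  have "\<forall>\<^sub>F K in at_top. log_tail K \<le> ennreal (d * \<rho> / 2) \<and> 1 \<le> K \<and> (\<exists>x0>0. \<forall>x\<ge>x0.
      G x \<le> P G x + (ennreal ((1 + d) * \<rho> * g x) + R K ?g x))"
    by eventually_elim auto
  then obtain K x4 where K: "log_tail K \<le> ennreal (d * \<rho> / 2)" "1 \<le> K"
    and x4: "0 < x4" "\<And>x. x4 \<le> x \<Longrightarrow> G x \<le> P G x + (ennreal ((1 + d) * \<rho> * g x) + R K ?g x)"
    by (auto dest!: eventually_happens)
  obtain E3 cE3 where E3: "E3 \<in> borel_measurable borel" "0 \<le> cE3" "\<And>x. E3 x \<le> ennreal cE3"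
    "supersol E3 (\<lambda>x. ennreal (CG * x powr b) * indicator {..x4} x)"
    using bounded_supersol_near_0[OF x4(1) CG(1)] by blast
  note [measurable] = E3(1)
  let ?s = "\<lambda>x. ennreal ((1 + d) * \<rho> * g x) + R K ?g x + ennreal (CG * x powr b) * indicator {..x4} x"
  let ?w = "\<lambda>x. ennreal c2 * ?F x + R K ?H x + E3 x"
  have sub: "subsol G ?s"
    unfolding subsol_def
  proof (intro allI impI)
    fix x :: real assume x: "0 < x"
    show "G x \<le> P G x + ?s x"
    proof (cases "x \<le> x4")
      case True
      then show ?thesis using CG(2)[OF x] by (simp add: add_increasing)
    next
      case False
      then show ?thesis using x4(2)[of x] by simp
    qed
  qed
  have super: "supersol ?w ?s"
  proof -
    have "supersol (\<lambda>x. ennreal c2 * ?F x) (\<lambda>x. ennreal c2 * ennreal ((1 - d) * g x))"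
      by (rule supersol_cmult[OF _ E1(4)]) measurable
    moreover have "(\<lambda>x. ennreal c2 * ennreal ((1 - d) * g x)) = (\<lambda>x. ennreal ((1 + d) * \<rho> * g x))"
      using d \<rho>_pos c2 by (auto simp: c2_def simp flip: ennreal_mult)
    ultimately have 1: "supersol (\<lambda>x. ennreal c2 * ?F x) (\<lambda>x. ennreal ((1 + d) * \<rho> * g x))" by simp
    have 2: "supersol (R K ?H) (R K ?g)" by (rule R_supersol[OF _ _ H]) measurable
    have [measurable]: "R K ?H \<in> borel_measurable borel" by (rule R_measurable) measurable
    show ?thesis by (intro supersol_add 1 2 E3(4)) measurable
  qed
  have RH: "R K ?H x \<le> ennreal d * G x + ennreal (d * cE2)" if x: "0 < x" for x
  proof -
    let ?k = "\<lambda>x. ennreal (2 / \<rho>) * (G x + ennreal cE2)"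
    have "R K ?H x \<le> R K ?k x"
      unfolding R_def by (intro mix_mono[OF R_facts] mult_left_mono add_left_mono E2(3) x) auto
    also have "\<dots> \<le> ?k x * log_tail K"
      by (rule R_le[OF K(2) _ _ x]) (auto intro!: mult_left_mono add_right_mono G_mono)
    also have "\<dots> \<le> ?k x * ennreal (d * \<rho> / 2)" by (intro mult_left_mono K) auto
    also have "\<dots> = (ennreal (2 / \<rho>) * ennreal (d * \<rho> / 2)) * (G x + ennreal cE2)" by (simp only: mult_ac)
    also have "ennreal (2 / \<rho>) * ennreal (d * \<rho> / 2) = ennreal d"
      using \<rho>_pos d by (simp flip: ennreal_mult)
    also have "ennreal d * (G x + ennreal cE2) = ennreal d * G x + ennreal (d * cE2)"
      using d E2(2) by (simp add: distrib_left ennreal_mult)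
    finally show ?thesis .
  qed
  have F_le: "?F x \<le> ennreal (1 + d) * f x + ennreal (cV + cE1)" if x: "0 < x" for x
  proof -
    have "?S f x \<le> ennreal (1 + d) * f x" using smooth_le_f[OF x l] by (simp add: l_a)
    then have "?F x \<le> ennreal (1 + d) * f x + ennreal cV + ennreal cE1"
      by (intro add_mono V' E1(3))
    then show ?thesis using V'(1) E1(2) by (simp add: add.assoc)
  qed
  have f_fin: "f x < \<infinity>" for x by (simp add: f_def)
  have w_fin: "?w x < \<infinity>" if x: "0 < x" for x
  proof -
    have "?F x < \<infinity>" using f_fin[of x] by (intro le_less_trans[OF F_le[OF x]]) (simp add: ennreal_mult_less_top)
    moreover have "R K ?H x < \<infinity>" using G_finite[OF x] by (intro le_less_trans[OF RH[OF x]]) (simp add: ennreal_mult_less_top)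
    moreover have "E3 x < \<infinity>" using E3(3)[of x] by (auto intro: le_less_trans)
    ultimately show ?thesis by (auto simp: ennreal_mult_less_top)
  qed
  have comp: "G x \<le> ?w x" if x: "0 < x" for x
  proof (rule comparison[OF _ _ sub super w_fin mom_a mom_b q _ x])
    have [measurable]: "R K ?H \<in> borel_measurable borel" by (rule R_measurable) measurable
    show "?w \<in> borel_measurable borel" by measurable
    fix \<epsilon> :: real assume "0 < \<epsilon>"
    have "G x \<le> ennreal (\<epsilon> + CG * x powr b)" if "0 < x" for x
      using CG(2)[OF that] \<open>0 < \<epsilon>\<close> by (elim order_trans) (auto intro: ennreal_leI)
    then show "\<exists>C\<ge>0. \<forall>x>0. G x \<le> ennreal (\<epsilon> + C * x powr b)" using CG(1) by blast
  qed measurable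

  define C where "C = (1 - d) / ((1 + d) ^ 2 * \<rho>) * (c2 * (cV + cE1) + d * cE2 + cE3)"
  have "(1 - e) / \<rho> * int_tilde g x \<le> x powr a * T x + C" if x: "0 < x" for x
  proof -
    define y r where "y = int_tilde g x" and "r = x powr a * T x"
    have y: "0 \<le> y" "G x = ennreal y" using G_eq[OF x] int_tilde_nonneg by (auto simp: y_def)
    have r: "0 \<le> r" "f x = ennreal r" by (auto simp: r_def f_def)
    have "G x \<le> ennreal c2 * (ennreal (1 + d) * f x + ennreal (cV + cE1)) + (ennreal d * G x + ennreal (d * cE2)) + ennreal cE3"
      by (rule order_trans[OF comp[OF x]]) (intro add_mono mult_left_mono F_le RH E3(3) x; simp)
    also have "\<dots> = ennreal (c2 * ((1 + d) * r + (cV + cE1)) + (d * y + d * cE2) + cE3)"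
      using y r c2 d V'(1) E1(2) E2(2) E3(2) by (simp add: ennreal_mult ennreal_plus)
    finally have "y \<le> c2 * ((1 + d) * r + (cV + cE1)) + (d * y + d * cE2) + cE3"
      unfolding y using y r c2 d V'(1) E1(2) E2(2) E3(2) by (subst (asm) ennreal_le_iff) auto
    then have "(1 - d) * y \<le> c2 * (1 + d) * r + (c2 * (cV + cE1) + d * cE2 + cE3)" by (simp add: algebra_simps)
    then have "(1 - d) / ((1 + d) ^ 2 * \<rho>) * ((1 - d) * y)
        \<le> (1 - d) / ((1 + d) ^ 2 * \<rho>) * (c2 * (1 + d) * r + (c2 * (cV + cE1) + d * cE2 + cE3))"
      using d \<rho>_pos by (intro mult_left_mono) auto
    also have "\<dots> = (1 - d) / ((1 + d) ^ 2 * \<rho>) * (c2 * (1 + d)) * r + C"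
      by (subst distrib_left) (simp only: C_def mult.assoc)
    also have "(1 - d) / ((1 + d) ^ 2 * \<rho>) * (c2 * (1 + d)) = 1"
      using d \<rho>_pos by (simp add: c2_def power2_eq_square)
    also have "(1 - d) / ((1 + d) ^ 2 * \<rho>) * ((1 - d) * y) = (1 - d) ^ 2 / (1 + d) ^ 2 / \<rho> * y"
      by (simp add: power2_eq_square)
    finally have "(1 - d) ^ 2 / (1 + d) ^ 2 / \<rho> * y \<le> r + C" by simp
    moreover have "(1 - e) / \<rho> * y \<le> (1 - d) ^ 2 / (1 + d) ^ 2 / \<rho> * y"
      using d y \<rho>_pos by (intro mult_right_mono divide_right_mono) auto
    ultimately show ?thesis unfolding y_def r_def by linarith
  qed
  moreover have "0 \<le> C"
    using c2 d V'(1) E1(2) E2(2) E3(2) \<rho>_pos unfolding C_def by (intro mult_nonneg_nonneg add_nonneg_nonneg) auto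
  ultimately show ?thesis by blast
qed

end

section \<open>Random Lipschitz maps\<close>

text \<open>For each n only countably many values occur, which makes evaluation along them
  measurable. They are rational and stay nonnegative for nonnegative x, so almost sure statements on
  the nonnegative rationals extend by continuity.\<close>

definition dyadic_floor :: "nat \<Rightarrow> real \<Rightarrow> real" where
  "dyadic_floor n x = real_of_int \<lfloor>2 ^ n * x\<rfloor> / 2 ^ n"

lemma dyadic_floor_tendsto: "(\<lambda>n. dyadic_floor n x) \<longlonglongrightarrow> x"
proof (rule real_tendsto_sandwich)
  show "\<forall>\<^sub>F n in sequentially. x - (1 / 2) ^ n \<le> dyadic_floor n x"
  proof (intro always_eventually allI)
    fix n
    have "2 ^ n * x - 1 \<le> real_of_int \<lfloor>2 ^ n * x\<rfloor>" by linarith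
    then have "(2 ^ n * x - 1) / 2 ^ n \<le> dyadic_floor n x"
      unfolding dyadic_floor_def by (intro divide_right_mono) auto
    then show "x - (1 / 2) ^ n \<le> dyadic_floor n x" by (simp add: diff_divide_distrib power_one_over)
  qed
  show "\<forall>\<^sub>F n in sequentially. dyadic_floor n x \<le> x"
    by (intro always_eventually allI) (simp add: dyadic_floor_def divide_le_eq mult.commute)
  have "(\<lambda>n. x - (1 / 2 :: real) ^ n) \<longlonglongrightarrow> x - 0"
    by (intro tendsto_intros LIMSEQ_realpow_zero) auto
  then show "(\<lambda>n. x - (1 / 2) ^ n) \<longlonglongrightarrow> x" by simp
qed auto

lemma dyadic_floor_rat: "dyadic_floor n x \<in> \<rat>"
  by (simp add: dyadic_floor_def)

lemma dyadic_floor_nonneg: "0 \<le> x \<Longrightarrow> 0 \<le> dyadic_floor n x"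
  by (simp add: dyadic_floor_def)

text \<open>Evaluation is not measurable on the space of all functions; this limit along dyadic
  approximations is, and it agrees with evaluation on continuous functions.\<close>

definition ev :: "(real \<Rightarrow> real) \<times> real \<Rightarrow> real" where
  "ev z = lim (\<lambda>n. fst z (dyadic_floor n (snd z)))"

lemma ev_measurable [measurable]: "ev \<in> borel_measurable (map_space \<Otimes>\<^sub>M borel)"
proof -
  have "(\<lambda>z. fst z (dyadic_floor n (snd z))) \<in> borel_measurable (map_space \<Otimes>\<^sub>M borel)" for n
    unfolding dyadic_floor_def
  proof (rule measurable_compose_countable[where f = "\<lambda>i z. fst z (real_of_int i / 2 ^ n)"])
    show "(\<lambda>z. fst z (real_of_int i / 2 ^ n)) \<in> borel_measurable (map_space \<Otimes>\<^sub>M borel)" for i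
      by measurable
    show "(\<lambda>z. \<lfloor>2 ^ n * (snd z :: real)\<rfloor>) \<in> (map_space \<Otimes>\<^sub>M borel) \<rightarrow>\<^sub>M count_space UNIV"
      by measurable
  qed
  then show ?thesis unfolding ev_def by measurable
qed

lemma ev_eq:
  assumes "continuous_on UNIV \<psi>"
  shows "ev (\<psi>, x) = \<psi> x"
proof -
  have "isCont \<psi> x" using assms by (simp add: continuous_on_eq_continuous_at)
  then have "(\<lambda>n. \<psi> (dyadic_floor n x)) \<longlonglongrightarrow> \<psi> x"
    by (rule isCont_tendsto_compose) (rule dyadic_floor_tendsto)
  then show ?thesis unfolding ev_def by (simp add: limI)
qed

lemma random_lipschitz_map_measurable:
  "random_lipschitz_map M \<Psi> \<Longrightarrow> \<Psi> \<in> measurable M map_space"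
  by (simp add: random_lipschitz_map_def)

lemma random_lipschitz_map_continuous:
  "random_lipschitz_map M \<Psi> \<Longrightarrow> \<omega> \<in> space M \<Longrightarrow> continuous_on UNIV (\<Psi> \<omega>)"
  unfolding random_lipschitz_map_def using lipschitz_on_continuous_on by blast

lemma lipschitz_le_lip_const:
  assumes f: "C-lipschitz_on UNIV f"
  shows "\<bar>f x - f y\<bar> \<le> lip_const f * \<bar>x - y\<bar>"
proof (cases "x = y")
  case False
  have "bdd_above ((\<lambda>(x, y). \<bar>f x - f y\<bar> / \<bar>x - y\<bar>) ` {(x, y). x \<noteq> y})"
    using lipschitz_onD[OF f] by (intro bdd_aboveI2[of _ _ C]) (auto simp: dist_real_def divide_le_eq)
  then have "(case (x, y) of (x, y) \<Rightarrow> \<bar>f x - f y\<bar> / \<bar>x - y\<bar>) \<le> lip_const f"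
    unfolding lip_const_def using False by (intro cSUP_upper) auto
  then show ?thesis using False by (simp add: divide_le_eq)
qed simp

text \<open>The limit l may be -\<infinity>, so a real rate c strictly between l and 0 is used,
  giving decay like exp(c)^n. Where L n is not positive this bound is trivial.\<close>

lemma ext_log_slope_imp_tendsto_0:
  fixes L :: "nat \<Rightarrow> real"
  assumes lim: "(\<lambda>n. ext_log (L n) / ereal (real n)) \<longlonglongrightarrow> l" and l: "l < 0"
  shows "\<exists>r. r \<longlonglongrightarrow> 0 \<and> (\<forall>\<^sub>F n in sequentially. L n \<le> r n)"
proof -
  obtain c where c: "l < ereal c" "ereal c < 0"
    using ereal_dense2[OF l] by auto
  then have "c < 0" by simp
  have "\<forall>\<^sub>F n in sequentially. ext_log (L n) / ereal (real n) < ereal c"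
    by (rule order_tendstoD(2)[OF lim c(1)])
  then have "\<forall>\<^sub>F n in sequentially. L n \<le> exp c ^ n"
    using eventually_gt_at_top[of 0]
  proof eventually_elim
    case (elim n)
    show ?case
    proof (cases "0 < L n")
      case True
      then have "ln (L n) / real n < c" using elim by (simp add: ext_log_def)
      then have "ln (L n) < real n * c" using elim(2) by (simp add: divide_less_eq mult.commute)
      then have "exp (ln (L n)) \<le> exp (real n * c)" by (subst exp_le_cancel_iff) simp
      then show ?thesis using True by (simp add: exp_of_nat_mult)
    next
      case False
      have "0 \<le> exp c ^ n" by simp
      with False show ?thesis by linarith
    qed
  qed
  moreover have "(\<lambda>n. exp c ^ n) \<longlonglongrightarrow> 0" using \<open>c < 0\<close> by (intro LIMSEQ_realpow_zero) auto
  ultimately show ?thesis by blast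
qed

section \<open>Iterated random maps and the stationary law\<close>

lemma comp_upto_lipschitz:
  assumes "\<And>k. 1 \<le> k \<Longrightarrow> \<exists>C. C-lipschitz_on UNIV (\<psi> k)"
  shows "\<exists>C. C-lipschitz_on UNIV (comp_upto \<psi> n)"
proof (induction n)
  case 0
  show ?case by (auto intro!: exI[of _ 1] lipschitz_onI)
next
  case (Suc n)
  then obtain C where C: "C-lipschitz_on UNIV (comp_upto \<psi> n)" by auto
  obtain D where D: "D-lipschitz_on UNIV (\<psi> (Suc n))" using assms[of "Suc n"] by auto
  have "D-lipschitz_on (comp_upto \<psi> n ` UNIV) (\<psi> (Suc n))" by (rule lipschitz_on_subset[OF D]) simp
  from lipschitz_on_compose[OF C this] show ?case by auto
qed

lemma comp_upto_nonneg:
  assumes "\<And>k x. 1 \<le> k \<Longrightarrow> 0 \<le> x \<Longrightarrow> 0 \<le> \<psi> k x"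
  shows "0 \<le> comp_upto \<psi> n 0"
  using assms by (induction n) auto

text \<open>A version of \<open>comp_upto\<close> that is jointly measurable in the maps and the
  starting point; the two agree for continuous maps.\<close>

primrec comp_ev :: "(nat \<Rightarrow> real \<Rightarrow> real) \<Rightarrow> nat \<Rightarrow> real \<Rightarrow> real" where
  "comp_ev \<phi> 0 x = x"
| "comp_ev \<phi> (Suc n) x = ev (\<phi> (Suc n), comp_ev \<phi> n x)"

lemma comp_ev_measurable:
  "n \<le> m \<Longrightarrow> (\<lambda>z. comp_ev (fst z) n (snd z)) \<in> borel_measurable (PiM {1..m} (\<lambda>_. map_space) \<Otimes>\<^sub>M borel)"
proof (induction n)
  case (Suc n)
  then have [measurable]: "(\<lambda>z. comp_ev (fst z) n (snd z)) \<in> borel_measurable (PiM {1..m} (\<lambda>_. map_space) \<Otimes>\<^sub>M borel)"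
    by simp
  have [measurable]: "(\<lambda>z. fst z (Suc n)) \<in> (PiM {1..m} (\<lambda>_. map_space) \<Otimes>\<^sub>M borel) \<rightarrow>\<^sub>M map_space"
    using Suc.prems by (intro measurable_compose[OF measurable_fst measurable_component_singleton]) auto
  show ?case by (simp del: One_nat_def)
qed simp

lemma comp_ev_restrict: "n \<le> m \<Longrightarrow> comp_ev (restrict \<phi> {1..m}) n x = comp_ev \<phi> n x"
  by (induction n) auto

lemma comp_ev_eq:
  assumes "\<And>k. 1 \<le> k \<Longrightarrow> continuous_on UNIV (\<psi> k)"
  shows "comp_ev \<psi> n x = comp_upto \<psi> n x"
  using assms by (induction n) (auto simp: ev_eq)

text \<open>Independence makes the joint law of \<Phi> and X a product, so stationarity becomes a
  fixed-point equation for the law of X in terms of the law of \<Psi>, and the space carrying X can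
  be left behind.\<close>

lemma stationary_distr:
  fixes M :: "'a measure" and K :: "'c measure"
  assumes M: "prob_space M" and K: "prob_space K"
    and \<Psi>: "random_lipschitz_map M \<Psi>" and stat: "stationary_solution M \<Psi> K \<Phi> X"
  shows "distr K borel X = distr (distr M map_space \<Psi> \<Otimes>\<^sub>M distr K borel X) borel ev"
proof -
  interpret M: prob_space M by fact
  interpret K: prob_space K by fact
  have X [measurable]: "X \<in> borel_measurable K" and \<Phi>: "random_lipschitz_map K \<Phi>"
    and law: "distr K map_space \<Phi> = distr M map_space \<Psi>"
    and indep: "K.indep_set {X -` S \<inter> space K | S. S \<in> sets borel} {\<Phi> -` S \<inter> space K | S. S \<in> sets map_space}"
    and eq: "distr K borel X = distr K borel (\<lambda>\<omega>. \<Phi> \<omega> (X \<omega>))"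
    using stat by (auto simp: stationary_solution_def random_map_copy_def)
  have [measurable]: "\<Phi> \<in> K \<rightarrow>\<^sub>M map_space" using \<Phi> by (rule random_lipschitz_map_measurable)
  interpret Q: prob_space "distr K map_space \<Phi>" by (rule K.prob_space_distr) measurable
  interpret mu: prob_space "distr K borel X" by (rule K.prob_space_distr) measurable
  have prod: "distr K map_space \<Phi> \<Otimes>\<^sub>M distr K borel X = distr K (map_space \<Otimes>\<^sub>M borel) (\<lambda>\<omega>. (\<Phi> \<omega>, X \<omega>))"
  proof (rule pair_measure_eqI)
    show "sigma_finite_measure (distr K map_space \<Phi>)" "sigma_finite_measure (distr K borel X)"
      by unfold_locales
    show "sets (distr K map_space \<Phi> \<Otimes>\<^sub>M distr K borel X)
        = sets (distr K (map_space \<Otimes>\<^sub>M borel) (\<lambda>\<omega>. (\<Phi> \<omega>, X \<omega>)))"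
      by (simp cong: sets_pair_measure_cong)
  next
    fix A B assume AB: "A \<in> sets (distr K map_space \<Phi>)" "B \<in> sets (distr K borel X)"
    then have [measurable]: "A \<in> sets map_space" "B \<in> sets borel" by auto
    have "(\<lambda>\<omega>. (\<Phi> \<omega>, X \<omega>)) -` (A \<times> B) \<inter> space K = (X -` B \<inter> space K) \<inter> (\<Phi> -` A \<inter> space K)" by auto
    moreover have "K.prob ((X -` B \<inter> space K) \<inter> (\<Phi> -` A \<inter> space K)) = K.prob (X -` B \<inter> space K) * K.prob (\<Phi> -` A \<inter> space K)"
      using AB by (intro K.indep_setD[OF indep]) auto
    ultimately show "emeasure (distr K map_space \<Phi>) A * emeasure (distr K borel X) B
        = emeasure (distr K (map_space \<Otimes>\<^sub>M borel) (\<lambda>\<omega>. (\<Phi> \<omega>, X \<omega>))) (A \<times> B)"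
      by (simp add: emeasure_distr K.emeasure_eq_measure mult.commute flip: ennreal_mult)
  qed
  have "distr K borel X = distr K borel (\<lambda>\<omega>. ev (\<Phi> \<omega>, X \<omega>))"
    unfolding eq by (intro distr_cong) (auto simp: ev_eq random_lipschitz_map_continuous[OF \<Phi>])
  also have "\<dots> = distr (distr K (map_space \<Otimes>\<^sub>M borel) (\<lambda>\<omega>. (\<Phi> \<omega>, X \<omega>))) borel ev"
    by (subst distr_distr) (auto simp: comp_def)
  finally show ?thesis unfolding prod[symmetric] law .
qed

lemma nn_integral_stationary:
  fixes Q :: "(real \<Rightarrow> real) measure" and \<mu> :: "real measure"
  assumes Q: "prob_space Q" "sets Q = sets map_space" and \<mu>: "prob_space \<mu>" "sets \<mu> = sets borel"
    and stat: "\<mu> = distr (Q \<Otimes>\<^sub>M \<mu>) borel ev" and h [measurable]: "h \<in> borel_measurable borel"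
  shows "(\<integral>\<^sup>+y. (\<integral>\<^sup>+\<psi>. h (ev (\<psi>, y)) \<partial>Q) \<partial>\<mu>) = (\<integral>\<^sup>+y. h y \<partial>\<mu> :: ennreal)"
proof -
  interpret Q: prob_space Q by fact
  interpret mu: prob_space \<mu> by fact
  interpret pair_sigma_finite Q \<mu> ..
  note [measurable_cong] = Q(2) \<mu>(2)
  have "(\<integral>\<^sup>+y. h y \<partial>\<mu>) = (\<integral>\<^sup>+y. h y \<partial>distr (Q \<Otimes>\<^sub>M \<mu>) borel ev)" using stat by simp
  also have "\<dots> = (\<integral>\<^sup>+z. h (ev z) \<partial>(Q \<Otimes>\<^sub>M \<mu>))" by (rule nn_integral_distr) measurable
  also have "\<dots> = (\<integral>\<^sup>+y. (\<integral>\<^sup>+\<psi>. h (ev (\<psi>, y)) \<partial>Q) \<partial>\<mu>)"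
    by (rule nn_integral_snd[symmetric]) measurable
  finally show ?thesis by simp
qed

text \<open>The law \<mu> is preserved by n independent steps. The last map is independent of the
  earlier ones; averaging it out turns \<open>h\<close> into another test function \<open>k\<close>,
  to which the induction hypothesis applies, and one use of stationarity returns to
  \<open>h\<close>. Hence the induction is over all \<open>h\<close>.\<close>

lemma nn_integral_comp_ev:
  fixes M :: "'a measure" and N :: "'b measure" and \<mu> :: "real measure"
  assumes M: "prob_space M" and N: "prob_space N"
    and \<Psi>: "random_lipschitz_map M \<Psi>" and iid: "iid_copies M \<Psi> N \<Psi>s"
    and \<mu>: "prob_space \<mu>" "sets \<mu> = sets borel"
    and stat: "\<mu> = distr (distr M map_space \<Psi> \<Otimes>\<^sub>M \<mu>) borel ev"
  shows "h \<in> borel_measurable borel \<Longrightarrow>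
    (\<integral>\<^sup>+x. (\<integral>\<^sup>+\<omega>. h (comp_ev (\<lambda>k. \<Psi>s k \<omega>) n x) \<partial>N) \<partial>\<mu>) = (\<integral>\<^sup>+y. h y \<partial>\<mu> :: ennreal)"
proof (induction n arbitrary: h)
  case 0
  interpret N: prob_space N by fact
  show ?case by (simp add: N.emeasure_space_1)
next
  case (Suc n)
  interpret M: prob_space M by fact
  interpret N: prob_space N by fact
  define Q where "Q = distr M map_space \<Psi>"
  have Q: "prob_space Q"
    unfolding Q_def by (rule M.prob_space_distr) (rule random_lipschitz_map_measurable[OF \<Psi>])
  have [measurable_cong]: "sets Q = sets map_space" by (simp add: Q_def)
  interpret Q: prob_space Q by fact
  have [measurable]: "h \<in> borel_measurable borel" by fact
  have copy: "\<Psi>s k \<in> N \<rightarrow>\<^sub>M map_space" "distr N map_space (\<Psi>s k) = Q" if "1 \<le> k" for k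
    using iid that by (auto simp: iid_copies_def random_map_copy_def random_lipschitz_map_def Q_def)
  have indep: "N.indep_vars (\<lambda>_. map_space) \<Psi>s {1..}" using iid by (simp add: iid_copies_def)
  let ?I = "PiM {1..n} (\<lambda>_. map_space)" and ?J = "PiM {Suc n} (\<lambda>_. map_space)"
  let ?U = "\<lambda>\<omega>. restrict (\<lambda>k. \<Psi>s k \<omega>) {1..n}" and ?V = "\<lambda>\<omega>. restrict (\<lambda>k. \<Psi>s k \<omega>) {Suc n}"
  have "N.indep_var ?I ?U ?J ?V" by (rule N.indep_var_restrict[OF indep]) auto
  then have U [measurable]: "?U \<in> N \<rightarrow>\<^sub>M ?I" and V [measurable]: "?V \<in> N \<rightarrow>\<^sub>M ?J"
    and prod: "distr N ?I ?U \<Otimes>\<^sub>M distr N ?J ?V = distr N (?I \<Otimes>\<^sub>M ?J) (\<lambda>\<omega>. (?U \<omega>, ?V \<omega>))"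
    by (auto simp: N.indep_var_distribution_eq)
  define k where "k y = (\<integral>\<^sup>+\<psi>. h (ev (\<psi>, y)) \<partial>Q)" for y
  have k [measurable]: "k \<in> borel_measurable borel" unfolding k_def by measurable
  have step: "(\<integral>\<^sup>+\<omega>. h (comp_ev (\<lambda>k. \<Psi>s k \<omega>) (Suc n) x) \<partial>N) = (\<integral>\<^sup>+\<omega>. k (comp_ev (\<lambda>k. \<Psi>s k \<omega>) n x) \<partial>N)" for x
  proof -
    interpret DV: prob_space "distr N ?J ?V" by (rule N.prob_space_distr) measurable
    have [measurable]: "(\<lambda>u. comp_ev u n x) \<in> borel_measurable ?I"
      using measurable_compose[OF _ comp_ev_measurable[of n n], of "\<lambda>u. (u, x)" ?I] by simp
    have comp [measurable]: "(\<lambda>v. v (Suc n)) \<in> ?J \<rightarrow>\<^sub>M map_space"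
      by (rule measurable_component_singleton) simp
    have "(\<integral>\<^sup>+\<omega>. h (comp_ev (\<lambda>k. \<Psi>s k \<omega>) (Suc n) x) \<partial>N)
        = (\<integral>\<^sup>+\<omega>. (\<lambda>(u, v). h (ev (v (Suc n), comp_ev u n x))) (?U \<omega>, ?V \<omega>) \<partial>N)"
      by (simp add: comp_ev_restrict del: One_nat_def)
    also have "\<dots> = (\<integral>\<^sup>+(u, v). h (ev (v (Suc n), comp_ev u n x)) \<partial>distr N (?I \<Otimes>\<^sub>M ?J) (\<lambda>\<omega>. (?U \<omega>, ?V \<omega>)))"
      by (subst nn_integral_distr) measurable
    also have "\<dots> = (\<integral>\<^sup>+u. (\<integral>\<^sup>+v. h (ev (v (Suc n), comp_ev u n x)) \<partial>distr N ?J ?V) \<partial>distr N ?I ?U)"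
    proof -
      have "(\<lambda>(u, v). h (ev (v (Suc n), comp_ev u n x))) \<in> borel_measurable (distr N ?I ?U \<Otimes>\<^sub>M distr N ?J ?V)"
        by measurable
      from DV.nn_integral_fst[OF this] show ?thesis unfolding prod by simp
    qed
    also have "\<dots> = (\<integral>\<^sup>+\<omega>. (\<integral>\<^sup>+v. h (ev (v (Suc n), comp_ev (?U \<omega>) n x)) \<partial>distr N ?J ?V) \<partial>N)"
      by (rule nn_integral_distr) measurable
    also have "\<dots> = (\<integral>\<^sup>+\<omega>. k (comp_ev (\<lambda>k. \<Psi>s k \<omega>) n x) \<partial>N)"
    proof (intro nn_integral_cong)
      fix \<omega>
      have "(\<integral>\<^sup>+v. h (ev (v (Suc n), y)) \<partial>distr N ?J ?V) = k y" for y
        unfolding k_def copy(2)[of "Suc n", simplified, symmetric]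
        using copy(1)[of "Suc n"] by (simp add: nn_integral_distr)
      then show "(\<integral>\<^sup>+v. h (ev (v (Suc n), comp_ev (?U \<omega>) n x)) \<partial>distr N ?J ?V) = k (comp_ev (\<lambda>k. \<Psi>s k \<omega>) n x)"
        by (simp add: comp_ev_restrict del: One_nat_def)
    qed
    finally show ?thesis .
  qed
  have "(\<integral>\<^sup>+x. (\<integral>\<^sup>+\<omega>. h (comp_ev (\<lambda>k. \<Psi>s k \<omega>) (Suc n) x) \<partial>N) \<partial>\<mu>) = (\<integral>\<^sup>+y. k y \<partial>\<mu>)"
    unfolding step by (rule Suc.IH) measurable
  also have "\<dots> = (\<integral>\<^sup>+y. h y \<partial>\<mu>)"
    unfolding k_def using stat by (intro nn_integral_stationary Q \<mu>) (auto simp: Q_def)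
  finally show ?case .
qed

text \<open>The mass below -\<delta> equals the probability that n steps started from \<mu> end
  below -\<delta>. Pathwise, the composed map at x is at least its value at 0 minus r(n) |x| with
  r(n) tending to 0, so this probability tends to 0 by dominated convergence, first over the maps
  and then over the start. The result is essential because the sandwich for \<Psi> holds on x \<ge>
  0 only.\<close>

lemma stationary_nonneg:
  fixes M :: "'a measure" and N :: "'b measure" and \<mu> :: "real measure"
  assumes M: "prob_space M" and N: "prob_space N"
    and \<Psi>: "random_lipschitz_map M \<Psi>" and iid: "iid_copies M \<Psi> N \<Psi>s" and contr: "contractive_as N \<Psi>s"
    and \<mu>: "prob_space \<mu>" "sets \<mu> = sets borel"
    and stat: "\<mu> = distr (distr M map_space \<Psi> \<Otimes>\<^sub>M \<mu>) borel ev"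
    and pos: "\<And>x. 0 \<le> x \<Longrightarrow> AE \<omega> in M. 0 \<le> \<Psi> \<omega> x"
  shows "AE y in \<mu>. 0 \<le> y"
proof -
  interpret M: prob_space M by fact
  interpret N: prob_space N by fact
  interpret mu: prob_space \<mu> by fact
  note [measurable_cong] = \<mu>(2)
  have [measurable]: "\<Psi> \<in> M \<rightarrow>\<^sub>M map_space" by (rule random_lipschitz_map_measurable[OF \<Psi>])
  have copy: "random_lipschitz_map N (\<Psi>s k)" "distr N map_space (\<Psi>s k) = distr M map_space \<Psi>" if "1 \<le> k" for k
    using iid that by (auto simp: iid_copies_def random_map_copy_def)
  \<comment> \<open>The exceptional set may depend on the point; restricting to rationals makes it a
    single null set and a measurable condition on the map.\<close>
  have "AE \<omega> in M. \<forall>q\<in>{0..} \<inter> \<rat>. 0 \<le> \<Psi> \<omega> q"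
    using pos by (subst AE_ball_countable) (auto intro: countable_Int2 countable_rat)
  then have "AE \<psi> in distr M map_space \<Psi>. \<forall>q\<in>{0..} \<inter> \<rat>. 0 \<le> \<psi> q"
  proof (subst AE_distr_iff)
    have "(\<Inter>q\<in>{0..} \<inter> \<rat>. {\<psi> \<in> space map_space. 0 \<le> \<psi> q}) \<in> sets map_space"
      by (intro sets.countable_INT' countable_Int2 countable_rat) auto
    also have "(\<Inter>q\<in>{0..} \<inter> \<rat>. {\<psi> \<in> space map_space. 0 \<le> \<psi> q})
        = {\<psi> \<in> space map_space. \<forall>q\<in>{0..} \<inter> \<rat>. 0 \<le> \<psi> q}" by auto
    finally show "{\<psi> \<in> space map_space. \<forall>q\<in>{0..} \<inter> \<rat>. 0 \<le> \<psi> q} \<in> sets map_space" .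
  qed auto
  then have "AE \<psi> in distr N map_space (\<Psi>s k). \<forall>q\<in>{0..} \<inter> \<rat>. 0 \<le> \<psi> q" if "1 \<le> k" for k
    unfolding copy(2)[OF that] .
  then have "AE \<omega> in N. \<forall>q\<in>{0..} \<inter> \<rat>. 0 \<le> \<Psi>s k \<omega> q" if "1 \<le> k" for k
    using that by (intro AE_distrD[OF random_lipschitz_map_measurable[OF copy(1)]])
  then have "AE \<omega> in N. \<forall>k\<in>{1..}. \<forall>q\<in>{0..} \<inter> \<rat>. 0 \<le> \<Psi>s k \<omega> q"
    by (subst AE_ball_countable) auto
  with contr[unfolded contractive_as_def]
  have lim: "AE \<omega> in N. \<forall>x. \<forall>\<delta>>0. \<forall>\<^sub>F n in sequentially. - \<delta> < comp_ev (\<lambda>k. \<Psi>s k \<omega>) n x"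
    using AE_space
  proof eventually_elim
    case (elim \<omega>)
    let ?\<psi> = "\<lambda>k. \<Psi>s k \<omega>"
    have lip: "\<exists>C. C-lipschitz_on UNIV (?\<psi> k)" if "1 \<le> k" for k
      using copy(1)[OF that] elim(3) by (auto simp: random_lipschitz_map_def)
    have cont: "continuous_on UNIV (?\<psi> k)" if "1 \<le> k" for k
      using lip[OF that] lipschitz_on_continuous_on by blast
    have nonneg: "0 \<le> ?\<psi> k x" if "1 \<le> k" "0 \<le> x" for k x
    proof (rule LIMSEQ_le_const)
      have "isCont (?\<psi> k) x" using cont[OF that(1)] by (simp add: continuous_on_eq_continuous_at)
      then show "(\<lambda>n. ?\<psi> k (dyadic_floor n x)) \<longlonglongrightarrow> ?\<psi> k x"
        by (rule isCont_tendsto_compose) (rule dyadic_floor_tendsto)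
      show "\<exists>N. \<forall>n\<ge>N. 0 \<le> ?\<psi> k (dyadic_floor n x)"
        using elim(2) that dyadic_floor_rat dyadic_floor_nonneg[OF that(2)] by auto
    qed
    obtain r where r: "r \<longlonglongrightarrow> 0" "\<forall>\<^sub>F n in sequentially. lip_const (comp_upto ?\<psi> n) \<le> r n"
    proof -
      obtain m where m: "m < 0" "(\<lambda>n. ext_log (lip_const (comp_upto ?\<psi> n)) / ereal (real n)) \<longlonglongrightarrow> m"
        using elim(1) by auto
      show ?thesis using ext_log_slope_imp_tendsto_0[OF m(2,1)] that by blast
    qed
    show "\<forall>x. \<forall>\<delta>>0. \<forall>\<^sub>F n in sequentially. - \<delta> < comp_ev ?\<psi> n x"
    proof (intro allI impI)
      fix x \<delta> :: real assume "0 < \<delta>"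
      have "(\<lambda>n. r n * \<bar>x\<bar>) \<longlonglongrightarrow> 0 * \<bar>x\<bar>" by (intro tendsto_intros r)
      then have "\<forall>\<^sub>F n in sequentially. r n * \<bar>x\<bar> < \<delta>"
        using \<open>0 < \<delta>\<close> by (intro order_tendstoD(2)) auto
      with r(2) show "\<forall>\<^sub>F n in sequentially. - \<delta> < comp_ev ?\<psi> n x"
      proof eventually_elim
        case (elim n)
        obtain C where "C-lipschitz_on UNIV (comp_upto ?\<psi> n)" using comp_upto_lipschitz[of ?\<psi> n, OF lip] by blast
        then have "\<bar>comp_upto ?\<psi> n x - comp_upto ?\<psi> n 0\<bar> \<le> lip_const (comp_upto ?\<psi> n) * \<bar>x - 0\<bar>"
          by (rule lipschitz_le_lip_const)
        also have "\<dots> \<le> r n * \<bar>x\<bar>" using elim(1) by (simp add: mult_right_mono)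
        finally have "comp_upto ?\<psi> n 0 - r n * \<bar>x\<bar> \<le> comp_upto ?\<psi> n x" by linarith
        moreover have "0 \<le> comp_upto ?\<psi> n 0" by (rule comp_upto_nonneg) (rule nonneg)
        ultimately show ?case using elim(2) comp_ev_eq[OF cont, where n = n and x = x] by simp
      qed
    qed
  qed
  have path [measurable]: "(\<lambda>z. comp_ev (\<lambda>k. \<Psi>s k (snd z)) n (fst z)) \<in> borel_measurable (\<mu> \<Otimes>\<^sub>M N)" for n
  proof -
    have [measurable]: "\<Psi>s k \<in> N \<rightarrow>\<^sub>M map_space" if "k \<in> {1..n}" for k
      using that copy(1)[of k] random_lipschitz_map_measurable by auto
    have "(\<lambda>z. (restrict (\<lambda>k. \<Psi>s k (snd z)) {1..n}, fst z)) \<in> \<mu> \<Otimes>\<^sub>M N \<rightarrow>\<^sub>M PiM {1..n} (\<lambda>_. map_space) \<Otimes>\<^sub>M borel"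
      by (intro measurable_Pair measurable_restrict) measurable
    from measurable_compose[OF this comp_ev_measurable[OF order_refl]] show ?thesis
      by (simp add: comp_ev_restrict del: One_nat_def)
  qed
  let ?I = "\<lambda>\<delta> n x. \<integral>\<^sup>+\<omega>. indicator {..- \<delta>} (comp_ev (\<lambda>k. \<Psi>s k \<omega>) n x) \<partial>N :: ennreal"
  have neg: "emeasure \<mu> {..- \<delta>} = 0" if \<delta>: "0 < \<delta>" for \<delta> :: real
  proof -
    have [measurable]: "(\<lambda>\<omega>. comp_ev (\<lambda>k. \<Psi>s k \<omega>) n x) \<in> borel_measurable N" for n x
      using measurable_compose[OF measurable_Pair1'[of x \<mu> N] path[of n]] \<mu>(2) by (simp add: sets_eq_imp_space_eq[OF \<mu>(2)])
    have inner: "(\<lambda>n. ?I \<delta> n x) \<longlonglongrightarrow> 0" for x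
    proof -
      have "(\<lambda>n. ?I \<delta> n x) \<longlonglongrightarrow> (\<integral>\<^sup>+\<omega>. 0 \<partial>N)"
      proof (rule nn_integral_dominated_convergence[where w = "\<lambda>_. 1"])
        show "AE \<omega> in N. (\<lambda>n. indicator {..- \<delta>} (comp_ev (\<lambda>k. \<Psi>s k \<omega>) n x) :: ennreal) \<longlonglongrightarrow> 0"
          using lim
        proof eventually_elim
          case (elim \<omega>)
          then have "\<forall>\<^sub>F n in sequentially. - \<delta> < comp_ev (\<lambda>k. \<Psi>s k \<omega>) n x" using \<delta> by blast
          then show ?case
            by (intro tendsto_eventually) (auto elim!: eventually_mono simp: indicator_def)
        qed
      qed (auto simp: N.emeasure_space_1 indicator_def)
      then show ?thesis by simp
    qed
    have "(\<lambda>n. \<integral>\<^sup>+x. ?I \<delta> n x \<partial>\<mu>) \<longlonglongrightarrow> (\<integral>\<^sup>+x. 0 \<partial>\<mu>)"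
    proof (rule nn_integral_dominated_convergence[where w = "\<lambda>_. 1"])
      show "(\<lambda>x. ?I \<delta> n x) \<in> borel_measurable \<mu>" for n by measurable
      have "?I \<delta> n x \<le> (\<integral>\<^sup>+\<omega>. 1 \<partial>N)" for n x by (intro nn_integral_mono) (auto simp: indicator_def)
      then show "AE x in \<mu>. ?I \<delta> n x \<le> 1" for n by (simp add: N.emeasure_space_1)
    qed (auto simp: mu.emeasure_space_1 inner)
    moreover have "(\<integral>\<^sup>+x. ?I \<delta> n x \<partial>\<mu>) = emeasure \<mu> {..- \<delta>}" for n
      using nn_integral_comp_ev[OF M N \<Psi> iid \<mu> stat, of "indicator {..- \<delta>}" n] by simp
    ultimately have "(\<lambda>n::nat. emeasure \<mu> {..- \<delta>}) \<longlonglongrightarrow> 0" by simp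
    then show ?thesis by (simp add: LIMSEQ_const_iff)
  qed
  have "AE y in \<mu>. \<forall>m. - (1 / real (Suc m)) < y"
  proof (subst AE_all_countable, rule allI)
    fix m
    have "{..- (1 / real (Suc m))} \<in> null_sets \<mu>" using neg[of "1 / real (Suc m)"] by (auto simp: \<mu>(2))
    then have "AE y in \<mu>. y \<notin> {..- (1 / real (Suc m))}" by (rule AE_not_in)
    then show "AE y in \<mu>. - (1 / real (Suc m)) < y" by eventually_elim auto
  qed
  then show ?thesis
  proof eventually_elim
    case (elim y)
    show ?case
    proof (rule ccontr)
      assume "\<not> 0 \<le> y"
      then obtain m where "1 / real (Suc m) < - y" using reals_Archimedean[of "- y"] by (auto simp: inverse_eq_divide)
      with elim[rule_format, of m] show False by linarith
    qed
  qed
qed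

section \<open>Conclusion\<close>

text \<open>Strict weighted AM-GM for y and 1, from 1 + t < exp t at the two points (1 - p) s and -p
  s with s = ln y, whose weighted sum is 0. With y = A^\<alpha> it gives E[A^p] < 1.\<close>

lemma powr_less_affine:
  fixes y p :: real
  assumes y: "0 \<le> y" "y \<noteq> 1" and p: "0 < p" "p < 1"
  shows "y powr p < 1 - p + p * y"
proof (cases "y = 0")
  case False
  define s where "s = ln y"
  have s: "y = exp s" "s \<noteq> 0" using y False by (auto simp: s_def)
  have "1 + t < exp t" if "t \<noteq> 0" for t :: real
    using that exp_ge_add_one_self[of t] exp_minus_greater[of "-t"] by (cases "0 < t") (auto simp: less_le dest: exp_eq_one_iff[THEN iffD1])
  then have *: "1 + (1 - p) * s < exp ((1 - p) * s)" "1 + - p * s < exp (- p * s)"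
    using s p by (metis diff_gt_0_iff_gt less_irrefl mult_eq_0_iff, metis less_irrefl minus_equation_iff minus_zero mult_eq_0_iff p(1) s(2))
  have "exp (p * s) * (p * (1 + (1 - p) * s) + (1 - p) * (1 + - p * s))
      < exp (p * s) * (p * exp ((1 - p) * s) + (1 - p) * exp (- p * s))"
    using * p by (intro mult_strict_left_mono add_strict_mono) auto
  also have "\<dots> = p * exp (p * s + (1 - p) * s) + (1 - p) * exp (p * s + - p * s)"
    by (simp only: exp_add distrib_left mult_ac)
  also have "\<dots> = 1 - p + p * y" by (simp add: s algebra_simps)
  also have "p * (1 + (1 - p) * s) + (1 - p) * (1 + - p * s) = 1" by (simp add: algebra_simps)
  finally show ?thesis by (simp add: s powr_def)
qed (use p in simp)

text \<open>Strict convexity of y ln y at its tangent in 1. With y = A^\<alpha> the left side has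
  mean 0, hence \<rho> > 0.\<close>

lemma diff_one_less_mult_ln:
  fixes y :: real
  assumes "0 \<le> y" "y \<noteq> 1"
  shows "y - 1 < y * ln y"
proof (cases "y = 0")
  case False
  then have y: "0 < y" using assms by simp
  have "ln (1 / y) \<noteq> 1 / y - 1" using ln_eq_minus_one[of "1 / y"] y assms(2) by auto
  then have "ln (1 / y) < 1 / y - 1" using ln_le_minus_one[of "1 / y"] y by simp
  then have "y * - ln y < y * (1 / y - 1)" using y by (intro mult_strict_left_mono) (simp_all add: ln_div)
  then show ?thesis using y by (simp add: algebra_simps)
qed simp

section \<open>Consequences of A not being almost surely 1\<close>

context prob_space
begin

context
  fixes A :: "'a \<Rightarrow> real" and \<alpha> :: real
  assumes A [measurable]: "A \<in> borel_measurable M" and A_nonneg: "\<And>\<omega>. 0 \<le> A \<omega>" and \<alpha>: "0 < \<alpha>"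
    and int: "integrable M (\<lambda>\<omega>. A \<omega> powr \<alpha>)" and one: "(\<integral>\<omega>. A \<omega> powr \<alpha> \<partial>M) = 1"
    and not_one: "\<not> (AE \<omega> in M. A \<omega> = 1)"
begin

lemma powr_eq_one_imp: "A \<omega> powr \<alpha> = 1 \<Longrightarrow> A \<omega> = 1"
  using \<alpha> powr_eq_one_iff_gen[of "A \<omega>" \<alpha>] A_nonneg[of \<omega>] by (cases "A \<omega> = 0") auto

lemma integral_pos_unless_one:
  fixes h :: "'a \<Rightarrow> real"
  assumes h: "integrable M h" "\<And>\<omega>. A \<omega> \<noteq> 1 \<Longrightarrow> 0 < h \<omega>" "\<And>\<omega>. 0 \<le> h \<omega>"
  shows "0 < (\<integral>\<omega>. h \<omega> \<partial>M)"
proof -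
  have "\<not> (AE \<omega> in M. h \<omega> = 0)"
  proof
    assume "AE \<omega> in M. h \<omega> = 0"
    then have "AE \<omega> in M. A \<omega> = 1"
    proof eventually_elim
      case (elim \<omega>)
      then show ?case using h(2)[of \<omega>] by (cases "A \<omega> = 1") auto
    qed
    with not_one show False ..
  qed
  then have "(\<integral>\<omega>. h \<omega> \<partial>M) \<noteq> 0" using integral_nonneg_eq_0_iff_AE[OF h(1)] h(3) by auto
  then show ?thesis using h(3) by (simp add: less_le)
qed

lemma moment_less_1:
  assumes p: "0 < p" "p < \<alpha>"
  shows "integrable M (\<lambda>\<omega>. A \<omega> powr p)" "(\<integral>\<omega>. A \<omega> powr p \<partial>M) < 1"
proof -
  define r where "r = p / \<alpha>"
  have r: "0 < r" "r < 1" using p \<alpha> by (auto simp: r_def)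
  have eq: "A \<omega> powr p = (A \<omega> powr \<alpha>) powr r" for \<omega> using \<alpha> by (simp add: powr_powr r_def)
  have less: "A \<omega> powr p < 1 - r + r * A \<omega> powr \<alpha>" if "A \<omega> \<noteq> 1" for \<omega>
    unfolding eq using that powr_eq_one_imp r by (intro powr_less_affine) auto
  have le: "A \<omega> powr p \<le> 1 - r + r * A \<omega> powr \<alpha>" for \<omega>
    using less[of \<omega>] by (cases "A \<omega> = 1") auto
  show int_p: "integrable M (\<lambda>\<omega>. A \<omega> powr p)"
  proof (rule Bochner_Integration.integrable_bound)
    show "integrable M (\<lambda>\<omega>. 1 - r + r * A \<omega> powr \<alpha>)" using int by simp
    show "AE \<omega> in M. norm (A \<omega> powr p) \<le> norm (1 - r + r * A \<omega> powr \<alpha>)"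
      using le r by (intro AE_I2) (auto intro: order_trans)
  qed measurable
  let ?h = "\<lambda>\<omega>. 1 - r + r * A \<omega> powr \<alpha> - A \<omega> powr p"
  have int_h: "integrable M ?h" using int int_p by simp
  have val: "(\<integral>\<omega>. ?h \<omega> \<partial>M) = 1 - (\<integral>\<omega>. A \<omega> powr p \<partial>M)"
    using int int_p one by (simp add: prob_space)
  have "0 < (\<integral>\<omega>. ?h \<omega> \<partial>M)"
    by (rule integral_pos_unless_one[OF int_h]) (use less le in auto)
  then show "(\<integral>\<omega>. A \<omega> powr p \<partial>M) < 1" unfolding val by linarith
qed

lemma log_moment_pos:
  assumes int_log: "integrable M (\<lambda>\<omega>. A \<omega> powr \<alpha> * ln (A \<omega>))"
  shows "0 < (\<integral>\<omega>. A \<omega> powr \<alpha> * ln (A \<omega>) \<partial>M)"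
proof -
  let ?h = "\<lambda>\<omega>. \<alpha> * (A \<omega> powr \<alpha> * ln (A \<omega>)) - A \<omega> powr \<alpha> + 1"
  have ln_eq: "A \<omega> powr \<alpha> * ln (A \<omega> powr \<alpha>) = \<alpha> * (A \<omega> powr \<alpha> * ln (A \<omega>))" for \<omega>
    using A_nonneg[of \<omega>] by (cases "A \<omega> = 0") (auto simp: ln_powr)
  have less: "0 < ?h \<omega>" if "A \<omega> \<noteq> 1" for \<omega>
    using diff_one_less_mult_ln[of "A \<omega> powr \<alpha>"] powr_eq_one_imp that unfolding ln_eq by force
  have le: "0 \<le> ?h \<omega>" for \<omega>
    using less[of \<omega>] by (cases "A \<omega> = 1") auto
  have int_h: "integrable M ?h" using int int_log by simp
  have val: "(\<integral>\<omega>. ?h \<omega> \<partial>M) = \<alpha> * (\<integral>\<omega>. A \<omega> powr \<alpha> * ln (A \<omega>) \<partial>M)"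
    using int int_log one by (simp add: prob_space)
  have "0 < \<alpha> * (\<integral>\<omega>. A \<omega> powr \<alpha> * ln (A \<omega>) \<partial>M)"
    unfolding val[symmetric] by (rule integral_pos_unless_one[OF int_h]) (use less le in auto)
  then show ?thesis using \<alpha> by (simp add: zero_less_mult_iff)
qed

end

end

text \<open>The conditional law of log A is then the point mass at 0, which lies in every
  lattice.\<close>

lemma AE_one_imp_arithmetic:
  assumes M: "prob_space M" and A [measurable]: "A \<in> borel_measurable M" and one: "AE \<omega> in M. A \<omega> = 1"
  shows "arithmetic_law (cond_law_log M A)"
proof -
  interpret prob_space M by fact
  let ?S = "{\<omega> \<in> space M. A \<omega> > 0}"
  have "AE \<omega> in M. \<omega> \<in> ?S" using one AE_space by eventually_elim auto
  then have "emeasure M ?S = 1" by (simp add: emeasure_eq_1_AE)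
  then have "AE \<omega> in uniform_measure M ?S. ln (A \<omega>) = 0"
    using one by (subst AE_uniform_measure) (auto elim!: eventually_mono)
  then have "AE x in cond_law_log M A. x = 0"
    unfolding cond_law_log_def by (subst AE_distr_iff) auto
  then have "AE x in cond_law_log M A. \<exists>k::int. x = 1 * of_int k"
    by eventually_elim (auto intro!: exI[of _ 0])
  then show ?thesis unfolding arithmetic_law_def by (intro exI[of _ 1]) auto
qed

text \<open>The quotient in \<open>asymp_equiv\<close> is 1 by convention where both functions
  vanish; divergence of H rules this out for large x. In the lower estimate d is used twice, and (1
  - d)^2 \<ge> 1 - 2 d > 1 - e.\<close>

lemma asymp_equiv_sandwich:
  fixes f H H1 :: "real \<Rightarrow> real"
  assumes \<rho>: "0 < \<rho>" and H: "filterlim H at_top at_top" and equiv: "H \<sim>[at_top] H1"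
    and bounds: "\<And>e. 0 < e \<Longrightarrow> \<forall>\<^sub>F x in at_top. (1 - e) / \<rho> * H1 x \<le> f x \<and> f x \<le> (1 + e) / \<rho> * H x"
  shows "f \<sim>[at_top] (\<lambda>x. 1 / \<rho> * H x)"
proof (rule asymp_equivI', rule tendstoI)
  fix e :: real assume e: "0 < e"
  define d where "d = min (1 / 2) (e / 3)"
  have d: "0 < d" "d < 1" "2 * d < e" using e by (auto simp: d_def min_def)
  have "H1 \<sim>[at_top] H" using equiv by (rule asymp_equiv_symI)
  then have "((\<lambda>x. if H1 x = 0 \<and> H x = 0 then 1 else H1 x / H x) \<longlongrightarrow> 1) at_top"
    by (simp add: asymp_equiv_def)
  from order_tendstoD(1)[OF this, of "1 - d"] d
  have "\<forall>\<^sub>F x in at_top. 1 - d < (if H1 x = 0 \<and> H x = 0 then 1 else H1 x / H x)" by simp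
  moreover have "\<forall>\<^sub>F x in at_top. 1 \<le> H x" using H by (simp add: filterlim_at_top)
  ultimately show "\<forall>\<^sub>F x in at_top. dist (f x / (1 / \<rho> * H x)) 1 < e"
    using bounds[OF d(1)]
  proof eventually_elim
    case (elim x)
    have Hx: "0 < H x" using elim by simp
    then have "1 - d < H1 x / H x" using elim(1) by auto
    then have "(1 - d) * H x \<le> H1 x" using Hx by (simp add: less_divide_eq)
    then have "(1 - d) / \<rho> * ((1 - d) * H x) \<le> (1 - d) / \<rho> * H1 x"
      using d \<rho> by (intro mult_left_mono) auto
    then have "(1 - d) / \<rho> * ((1 - d) * H x) \<le> f x" using elim(3) by linarith
    then have "(1 - d) * (1 - d) \<le> f x / (1 / \<rho> * H x)" using Hx \<rho> by (simp add: field_simps)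
    moreover have "1 - 2 * d \<le> (1 - d) * (1 - d)" by (simp add: algebra_simps)
    moreover have "f x / (1 / \<rho> * H x) \<le> 1 + d" using elim(3) Hx \<rho> by (simp add: field_simps)
    ultimately show ?case using d by (auto simp: dist_real_def)
  qed
qed

text \<open>For each fixed x the sandwich holds off a null set depending on x. Rationals and
  continuity give one null set for all x \<ge> 0, so x may be replaced by an independent
  \<mu>-distributed argument. The fixed-point equation is realised on the product of M and \<mu>,
  where \<Psi> keeps its joint law with A, B and B1.\<close>

lemma stationary_law_bounds:
  fixes M :: "'a measure" and \<mu> :: "real measure"
  assumes M: "prob_space M" and \<Psi>: "random_lipschitz_map M \<Psi>"
    and [measurable]: "A \<in> borel_measurable M" "B \<in> borel_measurable M" "B1 \<in> borel_measurable M"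
    and \<mu>: "prob_space \<mu>" "sets \<mu> = sets borel"
    and stat: "\<mu> = distr (distr M map_space \<Psi> \<Otimes>\<^sub>M \<mu>) borel ev"
    and nonneg: "AE y in \<mu>. 0 \<le> y"
    and bounds: "\<And>x. 0 \<le> x \<Longrightarrow> AE \<omega> in M. max (A \<omega> * x) (B1 \<omega>) \<le> \<Psi> \<omega> x \<and> \<Psi> \<omega> x \<le> A \<omega> * x + B \<omega>"
  shows "emeasure \<mu> {x<..} \<le> emeasure (M \<Otimes>\<^sub>M \<mu>) {z \<in> space (M \<Otimes>\<^sub>M \<mu>). x < A (fst z) * snd z + B (fst z)}"
    and "emeasure (M \<Otimes>\<^sub>M \<mu>) {z \<in> space (M \<Otimes>\<^sub>M \<mu>). x < max (A (fst z) * snd z) (B1 (fst z))} \<le> emeasure \<mu> {x<..}"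
proof -
  interpret M: prob_space M by fact
  interpret mu: prob_space \<mu> by fact
  interpret pair_sigma_finite M \<mu> ..
  note [measurable_cong] = \<mu>(2)
  have [measurable]: "\<Psi> \<in> M \<rightarrow>\<^sub>M map_space" by (rule random_lipschitz_map_measurable[OF \<Psi>])
  have id: "distr \<mu> borel (\<lambda>y. y) = \<mu>" by (rule distr_id2) (simp add: \<mu>(2))
  have "distr M map_space \<Psi> \<Otimes>\<^sub>M distr \<mu> borel (\<lambda>y. y)
      = distr (M \<Otimes>\<^sub>M \<mu>) (map_space \<Otimes>\<^sub>M borel) (\<lambda>(\<omega>, y). (\<Psi> \<omega>, y))"
    by (rule pair_measure_distr) (auto simp: id mu.sigma_finite_measure_axioms measurable_ident_sets[OF \<mu>(2)])
  then have prod: "distr M map_space \<Psi> \<Otimes>\<^sub>M \<mu>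
      = distr (M \<Otimes>\<^sub>M \<mu>) (map_space \<Otimes>\<^sub>M borel) (\<lambda>(\<omega>, y). (\<Psi> \<omega>, y))"
    by (simp only: id)
  have "distr (distr M map_space \<Psi> \<Otimes>\<^sub>M \<mu>) borel ev = distr (M \<Otimes>\<^sub>M \<mu>) borel (\<lambda>z. ev (\<Psi> (fst z), snd z))"
    unfolding prod by (subst distr_distr) (auto simp: comp_def case_prod_beta')
  with stat have law: "\<mu> = distr (M \<Otimes>\<^sub>M \<mu>) borel (\<lambda>z. ev (\<Psi> (fst z), snd z))" by simp
  have tail: "emeasure \<mu> {x<..} = emeasure (M \<Otimes>\<^sub>M \<mu>) {z \<in> space (M \<Otimes>\<^sub>M \<mu>). x < ev (\<Psi> (fst z), snd z)}"
    by (subst law, subst emeasure_distr) (auto intro!: arg_cong[where f = "emeasure _"])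
  have "AE \<omega> in M. \<forall>q\<in>{0..} \<inter> \<rat>. max (A \<omega> * q) (B1 \<omega>) \<le> \<Psi> \<omega> q \<and> \<Psi> \<omega> q \<le> A \<omega> * q + B \<omega>"
    using bounds by (subst AE_ball_countable) (auto intro: countable_Int2 countable_rat)
  then have "AE \<omega> in M. \<forall>y\<ge>0. max (A \<omega> * y) (B1 \<omega>) \<le> ev (\<Psi> \<omega>, y) \<and> ev (\<Psi> \<omega>, y) \<le> A \<omega> * y + B \<omega>"
    using AE_space
  proof eventually_elim
    case (elim \<omega>)
    show ?case
    proof (intro allI impI)
      fix y :: real assume y: "0 \<le> y"
      have cont: "continuous_on UNIV (\<Psi> \<omega>)" by (rule random_lipschitz_map_continuous[OF \<Psi> elim(2)])
      then have "isCont (\<Psi> \<omega>) y" by (simp add: continuous_on_eq_continuous_at)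
      then have lim: "(\<lambda>n. \<Psi> \<omega> (dyadic_floor n y)) \<longlonglongrightarrow> \<Psi> \<omega> y"
        by (rule isCont_tendsto_compose) (rule dyadic_floor_tendsto)
      have q: "dyadic_floor n y \<in> {0..} \<inter> \<rat>" for n
        using dyadic_floor_rat dyadic_floor_nonneg[OF y] by auto
      have "max (A \<omega> * y) (B1 \<omega>) \<le> \<Psi> \<omega> y"
        by (rule LIMSEQ_le[OF _ lim, where X = "\<lambda>n. max (A \<omega> * dyadic_floor n y) (B1 \<omega>)"])
          (use elim(1) q in \<open>auto intro!: tendsto_intros dyadic_floor_tendsto\<close>)
      moreover have "\<Psi> \<omega> y \<le> A \<omega> * y + B \<omega>"
        by (rule LIMSEQ_le[OF lim, where Y = "\<lambda>n. A \<omega> * dyadic_floor n y + B \<omega>"])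
          (use elim(1) q in \<open>auto intro!: tendsto_intros dyadic_floor_tendsto\<close>)
      ultimately show "max (A \<omega> * y) (B1 \<omega>) \<le> ev (\<Psi> \<omega>, y) \<and> ev (\<Psi> \<omega>, y) \<le> A \<omega> * y + B \<omega>"
        by (simp add: ev_eq[OF cont])
    qed
  qed
  then have ae: "AE z in M \<Otimes>\<^sub>M \<mu>. max (A (fst z) * snd z) (B1 (fst z)) \<le> ev (\<Psi> (fst z), snd z)
      \<and> ev (\<Psi> (fst z), snd z) \<le> A (fst z) * snd z + B (fst z)"
  proof (intro AE_pair_measure)
    show "AE \<omega> in M. AE y in \<mu>. max (A (fst (\<omega>, y)) * snd (\<omega>, y)) (B1 (fst (\<omega>, y))) \<le> ev (\<Psi> (fst (\<omega>, y)), snd (\<omega>, y))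
      \<and> ev (\<Psi> (fst (\<omega>, y)), snd (\<omega>, y)) \<le> A (fst (\<omega>, y)) * snd (\<omega>, y) + B (fst (\<omega>, y))"
      if "AE \<omega> in M. \<forall>y\<ge>0. max (A \<omega> * y) (B1 \<omega>) \<le> ev (\<Psi> \<omega>, y) \<and> ev (\<Psi> \<omega>, y) \<le> A \<omega> * y + B \<omega>"
      using that
    proof eventually_elim
      case (elim \<omega>)
      from nonneg show ?case by eventually_elim (use elim in auto)
    qed
  qed measurable
  show "emeasure \<mu> {x<..} \<le> emeasure (M \<Otimes>\<^sub>M \<mu>) {z \<in> space (M \<Otimes>\<^sub>M \<mu>). x < A (fst z) * snd z + B (fst z)}"
    unfolding tail using ae by (intro emeasure_mono_AE) auto
  show "emeasure (M \<Otimes>\<^sub>M \<mu>) {z \<in> space (M \<Otimes>\<^sub>M \<mu>). x < max (A (fst z) * snd z) (B1 (fst z))} \<le> emeasure \<mu> {x<..}"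
    unfolding tail using ae by (intro emeasure_mono_AE) auto
qed

theorem theorem1p3:
  fixes M :: "'a measure" and N :: "'b measure" and K :: "'c measure"
    and A B B1 :: "'a \<Rightarrow> real"
    and \<Psi> :: "'a \<Rightarrow> real \<Rightarrow> real"
    and \<Psi>s :: "nat \<Rightarrow> 'b \<Rightarrow> real \<Rightarrow> real"
    and \<Phi> :: "'c \<Rightarrow> real \<Rightarrow> real"
    and X :: "'c \<Rightarrow> real"
    and \<alpha> \<rho> :: real
  assumes "prob_space M" and "prob_space N" and "prob_space K"
    and "\<alpha> > 0"
    and "A \<in> borel_measurable M" and "B \<in> borel_measurable M" and "B1 \<in> borel_measurable M"
    and "random_lipschitz_map M \<Psi>"
    and "integrable M (\<lambda>\<omega>. log_plus (lip_const (\<Psi> \<omega>)))"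
    and "integrable M (\<lambda>\<omega>. log_plus \<bar>\<Psi> \<omega> 0\<bar>)"
    and "iid_copies M \<Psi> N \<Psi>s"
    and "contractive_as N \<Psi>s"
    and "AE \<omega> in M. A \<omega> \<ge> 0"
    and "\<not> arithmetic_law (cond_law_log M A)"
    and "integrable M (\<lambda>\<omega>. A \<omega> powr \<alpha>)"
    and "(\<integral>\<omega>. A \<omega> powr \<alpha> \<partial>M) = 1"
    and "integrable M (\<lambda>\<omega>. A \<omega> powr \<alpha> * ln (A \<omega>))"
    and "\<rho> = (\<integral>\<omega>. A \<omega> powr \<alpha> * ln (A \<omega>) \<partial>M)"
    and "slowly_varying (tail_fn M \<alpha> B)" and "slowly_varying (tail_fn M \<alpha> B1)"
    and "(\<integral>\<^sup>+\<omega>. ennreal (pos_part (B \<omega>) powr \<alpha>) \<partial>M) = \<infinity>"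
    and "(\<integral>\<^sup>+\<omega>. ennreal (pos_part (B1 \<omega>) powr \<alpha>) \<partial>M) = \<infinity>"
    and "\<forall>\<epsilon>\<in>{0<..<\<alpha>}. integrable M (\<lambda>\<omega>. neg_part (B \<omega>) powr (\<alpha> - \<epsilon>))"
    and "\<forall>\<epsilon>\<in>{0<..<\<alpha>}. integrable M (\<lambda>\<omega>. neg_part (B1 \<omega>) powr (\<alpha> - \<epsilon>))"
    and "\<exists>\<eta>\<in>{0<..<\<alpha>} \<inter> {0<..1}.
           integrable M (\<lambda>\<omega>. A \<omega> powr \<eta> * pos_part (B \<omega>) powr (\<alpha> - \<eta>))"
    and "\<exists>\<eta>\<^sub>1\<in>{0<..<\<alpha>} \<inter> {0<..1}.
           integrable M (\<lambda>\<omega>. A \<omega> powr \<eta>\<^sub>1 * pos_part (B1 \<omega>) powr (\<alpha> - \<eta>\<^sub>1))"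
    and "\<forall>x\<ge>0. AE \<omega> in M. max (A \<omega> * x) (B1 \<omega>) \<le> \<Psi> \<omega> x \<and> \<Psi> \<omega> x \<le> A \<omega> * x + B \<omega>"
    and "stationary_solution M \<Psi> K \<Phi> X"
  shows "(\<forall>\<epsilon>>0. \<forall>\<^sub>F x in at_top.
            (1 - \<epsilon>) / \<rho> * int_tilde (tail_fn M \<alpha> B1) x \<le> tail_fn K \<alpha> X x \<and>
            tail_fn K \<alpha> X x \<le> (1 + \<epsilon>) / \<rho> * int_tilde (tail_fn M \<alpha> B) x)
       \<and> (int_tilde (tail_fn M \<alpha> B) \<sim>[at_top] int_tilde (tail_fn M \<alpha> B1) \<longrightarrow>
            tail_fn K \<alpha> X \<sim>[at_top] (\<lambda>x. 1 / \<rho> * int_tilde (tail_fn M \<alpha> B) x))"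
proof -
  interpret prob_space M by fact
  interpret N: prob_space N by fact
  interpret K: prob_space K by fact
  note A [measurable] = assms(5) and B [measurable] = assms(6) and B1 [measurable] = assms(7)
  have \<alpha>: "0 < \<alpha>" by fact
  define \<mu> where "\<mu> = distr K borel X"
  have X [measurable]: "X \<in> borel_measurable K" using assms(28) by (simp add: stationary_solution_def)
  have \<mu>: "prob_space \<mu>" "sets \<mu> = sets borel"
    unfolding \<mu>_def by (auto intro: K.prob_space_distr)
  have stat: "\<mu> = distr (distr M map_space \<Psi> \<Otimes>\<^sub>M \<mu>) borel ev"
    unfolding \<mu>_def by (rule stationary_distr[OF assms(1,3,8,28)])
  \<comment> \<open>The dilation locale asks for nonnegativity at every point; this version differs
    from A on a null set only.\<close>
  define A' where "A' \<omega> = max (A \<omega>) 0" for \<omega>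
  have A'_meas [measurable]: "A' \<in> borel_measurable M" unfolding A'_def by measurable
  have A'_nonneg: "0 \<le> A' \<omega>" for \<omega> by (simp add: A'_def)
  have A': "AE \<omega> in M. A' \<omega> = A \<omega>" using assms(13) by eventually_elim (simp add: A'_def)
  have bounds: "AE \<omega> in M. max (A' \<omega> * x) (B1 \<omega>) \<le> \<Psi> \<omega> x \<and> \<Psi> \<omega> x \<le> A' \<omega> * x + B \<omega>" if "0 \<le> x" for x
    using A' assms(27)[rule_format, OF that] by eventually_elim auto
  have nonneg: "AE y in \<mu>. 0 \<le> y"
  proof (rule stationary_nonneg[OF assms(1,2,8,11,12) \<mu> stat])
    fix x :: real assume "0 \<le> x"
    then show "AE \<omega> in M. 0 \<le> \<Psi> \<omega> x"
      using bounds[OF \<open>0 \<le> x\<close>] by (auto elim!: eventually_mono intro: order_trans[OF mult_nonneg_nonneg[OF A'_nonneg]])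
  qed
  note law_bounds = stationary_law_bounds[OF assms(1,8) A'_meas B B1 \<mu> stat nonneg bounds]

  have cong: "AE \<omega> in M. A \<omega> powr \<alpha> = A' \<omega> powr \<alpha>"
      "AE \<omega> in M. A \<omega> powr \<alpha> * ln (A \<omega>) = A' \<omega> powr \<alpha> * ln (A' \<omega>)"
    using A' by (auto elim!: eventually_mono)
  have int: "integrable M (\<lambda>\<omega>. A' \<omega> powr \<alpha>)"
    by (rule integrable_cong_AE_imp[OF assms(15) _ cong(1)]) measurable
  have one: "(\<integral>\<omega>. A' \<omega> powr \<alpha> \<partial>M) = 1"
    unfolding assms(16)[symmetric] using cong(1) by (intro integral_cong_AE) auto
  have int_log: "integrable M (\<lambda>\<omega>. A' \<omega> powr \<alpha> * ln (A' \<omega>))"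
    by (rule integrable_cong_AE_imp[OF assms(17) _ cong(2)]) measurable
  have \<rho>: "\<rho> = (\<integral>\<omega>. A' \<omega> powr \<alpha> * ln (A' \<omega>) \<partial>M)"
    unfolding assms(18) using cong(2) by (intro integral_cong_AE) auto
  have not_one: "\<not> (AE \<omega> in M. A' \<omega> = 1)"
  proof
    assume "AE \<omega> in M. A' \<omega> = 1"
    with A' have "AE \<omega> in M. A \<omega> = 1" by eventually_elim simp
    then show False using AE_one_imp_arithmetic[OF assms(1) A] assms(14) by blast
  qed
  note moment = moment_less_1[OF A'_meas A'_nonneg \<alpha> int one not_one]
  have \<rho>_pos: "0 < \<rho>"
    unfolding \<rho> by (rule log_moment_pos[OF A'_meas A'_nonneg \<alpha> int one not_one int_log])

  interpret D: dilation M A' \<alpha> by unfold_locales (auto simp: A'_nonneg)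
  have mom: "D.mom p = ennreal (\<integral>\<omega>. A' \<omega> powr p \<partial>M)" if "integrable M (\<lambda>\<omega>. A' \<omega> powr p)" for p
    unfolding D.mom_def by (rule nn_integral_eq_integral[OF that]) auto
  have mom_\<alpha>: "D.mom \<alpha> = 1" using mom[OF int] one by simp
  \<comment> \<open>The comparison exponent is fixed as \<alpha>/2, so that the contracting
    eigenvalue is the moment of order \<alpha> - \<alpha>/2 = \<alpha>/2.\<close>
  define q where "q = (\<integral>\<omega>. A' \<omega> powr (\<alpha> / 2) \<partial>M)"
  have q: "0 \<le> q" "q < 1" "D.mom (\<alpha> / 2) = ennreal q"
    using moment[of "\<alpha> / 2"] mom[of "\<alpha> / 2"] \<alpha> unfolding q_def by (auto intro: integral_nonneg_AE)
  interpret D: renewal_kernel M A' \<alpha> "\<alpha> / 2" q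
    using \<alpha> q mom_\<alpha> int_log by unfold_locales auto
  have \<rho>_eq: "D.\<rho> = \<rho>" unfolding D.\<rho>_def \<rho> ..
  interpret D: perpetuity M A' \<alpha> "\<alpha> / 2" q \<mu>
  proof -
    interpret mu: prob_space \<mu> by (rule \<mu>(1))
    show "perpetuity M A' \<alpha> (\<alpha> / 2) q \<mu>"
    proof unfold_locales
      show "D.mom p < 1" if "0 < p" "p < \<alpha>" for p
        using moment[OF that] mom[of p] by (simp add: ennreal_less_one_iff)
    qed (use \<mu>(2) nonneg in auto)
  qed
  have mixed: "\<exists>\<eta>. 0 < \<eta> \<and> \<eta> < \<alpha> \<and> (\<integral>\<^sup>+\<omega>. ennreal (A' \<omega> powr \<eta> * max 0 (Y \<omega>) powr (\<alpha> - \<eta>)) \<partial>M) < \<infinity>"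
    if hyp: "\<exists>\<eta>\<in>{0<..<\<alpha>} \<inter> {0<..1}. integrable M (\<lambda>\<omega>. A \<omega> powr \<eta> * pos_part (Y \<omega>) powr (\<alpha> - \<eta>))" for Y
  proof -
    obtain \<eta> where \<eta>: "0 < \<eta>" "\<eta> < \<alpha>" "integrable M (\<lambda>\<omega>. A \<omega> powr \<eta> * pos_part (Y \<omega>) powr (\<alpha> - \<eta>))"
      using hyp by auto
    have "(\<integral>\<^sup>+\<omega>. ennreal (A' \<omega> powr \<eta> * max 0 (Y \<omega>) powr (\<alpha> - \<eta>)) \<partial>M)
        = (\<integral>\<^sup>+\<omega>. ennreal (A \<omega> powr \<eta> * pos_part (Y \<omega>) powr (\<alpha> - \<eta>)) \<partial>M)"
      using A' by (intro nn_integral_cong_AE) (auto elim!: eventually_mono simp: max.commute)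
    also have "\<dots> < \<infinity>"
      by (subst nn_integral_eq_integral[OF \<eta>(3)]) auto
    finally show ?thesis using \<eta>(1,2) by blast
  qed
  interpret U: perpetuity_upper M A' \<alpha> "\<alpha> / 2" q \<mu> B
    using assms(19) \<alpha> \<rho>_pos \<rho>_eq law_bounds(1) mixed[OF assms(25)] by unfold_locales auto
  \<comment> \<open>The overlap estimate of the lower bound needs moments of \<mu>, which come from
    the a priori tail bound obtained through B.\<close>
  interpret L: perpetuity_lower M A' \<alpha> "\<alpha> / 2" q \<mu> B1
    using assms(20) \<alpha> \<rho>_pos \<rho>_eq law_bounds(2) mixed[OF assms(26)] U.T_le_powr by unfold_locales auto

  let ?f = "tail_fn K \<alpha> X" and ?G = "int_tilde (tail_fn M \<alpha> B)" and ?G1 = "int_tilde (tail_fn M \<alpha> B1)"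
  have tail: "?f x = x powr \<alpha> * D.T x" for x
  proof -
    have "measure \<mu> {x<..} = measure K {\<omega> \<in> space K. x < X \<omega>}"
      unfolding \<mu>_def by (subst measure_distr) (auto intro!: arg_cong[where f = "measure K"])
    then show ?thesis by (simp add: tail_fn_def D.T_def)
  qed
  have G_top: "filterlim ?G at_top at_top" by (rule U.int_tilde_at_top[OF assms(21)])
  have G1_top: "filterlim ?G1 at_top at_top" by (rule L.int_tilde_at_top[OF assms(22)])
  \<comment> \<open>An additive constant is swallowed by an arbitrarily small multiple of a function
    tending to infinity; each bound below spends one part of its margin on this.\<close>
  have absorb: "\<forall>\<^sub>F x in at_top. C \<le> e / \<rho> * H x"
    if "filterlim H at_top at_top" "0 < e" for C e :: real and H :: "real \<Rightarrow> real"
  proof -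
    have "\<forall>\<^sub>F x in at_top. C * \<rho> / e \<le> H x" using that(1) by (simp add: filterlim_at_top)
    then show ?thesis
    proof eventually_elim
      case (elim x)
      then show ?case using that(2) \<rho>_pos by (simp add: field_simps)
    qed
  qed

  have upper: "\<forall>\<^sub>F x in at_top. ?f x \<le> (1 + e) / \<rho> * ?G x" if e: "0 < e" for e
  proof -
    obtain C where C: "0 \<le> C" "\<And>x. 0 < x \<Longrightarrow> D.f x \<le> ennreal ((1 + e / 2) / \<rho>) * U.G x + ennreal C"
      using U.f_upper[of "e / 2"] e unfolding \<rho>_eq by auto
    have "e / 2 > 0" using e by simp
    from absorb[OF G_top this, of C] eventually_gt_at_top[of 0] show ?thesis
    proof eventually_elim
      case (elim x)
      have "ennreal (?f x) \<le> ennreal ((1 + e / 2) / \<rho>) * ennreal (?G x) + ennreal C"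
        using C(2)[OF elim(2)] U.G_eq[OF elim(2)] by (simp add: D.f_def tail)
      also have "\<dots> = ennreal ((1 + e / 2) / \<rho> * ?G x + C)"
      proof -
        have nn: "0 \<le> (1 + e / 2) / \<rho>" "0 \<le> ?G x" using e \<rho>_pos U.int_tilde_nonneg by auto
        show ?thesis
          unfolding ennreal_mult[OF nn, symmetric] ennreal_plus[OF mult_nonneg_nonneg[OF nn] C(1), symmetric] ..
      qed
      finally have "?f x \<le> (1 + e / 2) / \<rho> * ?G x + C"
        using e \<rho>_pos C(1) U.int_tilde_nonneg by (subst (asm) ennreal_le_iff) auto
      also have "\<dots> \<le> (1 + e / 2) / \<rho> * ?G x + e / 2 / \<rho> * ?G x" using elim(1) by simp
      also have "\<dots> = (1 + e) / \<rho> * ?G x" using \<rho>_pos by (simp add: field_simps)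
      finally show ?case .
    qed
  qed
  have lower: "\<forall>\<^sub>F x in at_top. (1 - e) / \<rho> * ?G1 x \<le> ?f x" if e: "0 < e" for e
  proof -
    \<comment> \<open>One d is lost in the asymptotic bound and one in absorbing the constant. The
      cap at 1/2 keeps d < 1 when e is large.\<close>
    define d where "d = min (1 / 2) (e / 2)"
    have d: "0 < d" "d < 1" "2 * d \<le> e" using e by (auto simp: d_def)
    obtain C where C: "0 \<le> C" "\<And>x. 0 < x \<Longrightarrow> (1 - d) / \<rho> * ?G1 x \<le> x powr \<alpha> * D.T x + C"
      using L.f_lower[OF d(1,2)] unfolding \<rho>_eq by auto
    from absorb[OF G1_top d(1), of C] eventually_gt_at_top[of 0] show ?thesis
    proof eventually_elim
      case (elim x)
      have "(1 - e) / \<rho> * ?G1 x \<le> (1 - 2 * d) / \<rho> * ?G1 x"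
        using d(3) \<rho>_pos L.int_tilde_nonneg by (intro mult_right_mono divide_right_mono) auto
      also have "\<dots> = (1 - d) / \<rho> * ?G1 x - d / \<rho> * ?G1 x" using \<rho>_pos by (simp add: field_simps)
      also have "\<dots> \<le> ?f x" using order_trans[OF C(2)[OF elim(2)] add_left_mono[OF elim(1)]] unfolding tail diff_le_eq .
      finally show ?case .
    qed
  qed
  have both: "\<forall>\<^sub>F x in at_top. (1 - e) / \<rho> * ?G1 x \<le> ?f x \<and> ?f x \<le> (1 + e) / \<rho> * ?G x" if "0 < e" for e
    using upper[OF that] lower[OF that] by eventually_elim simp
  then show ?thesis
    using asymp_equiv_sandwich[OF \<rho>_pos G_top _ both] by auto
qed

end
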